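(* Let $m,n>0$, and let $D$ and $\Gamma$ be the domain and the curve described in the context, with the associated guided dynamical system $(\Gamma,\zeta,\Omega)$. The following are equivalent: (a) for any $g\in C^2(\partial D)$ there exists a unique generalized solution $u\in C^2(\overline{D})$ of the problem $$(m\partial_x+n\partial_y)\partial_x\partial_y u=0\ \text{ in } D,\qquad u=g\ \text{ on }\partial D;$$ (b) $(\Gamma,\zeta,\Omega)$ is $\Omega$-minimal.
   Context: Let $O=(0,0)$, $A_1=(1,0)$, $A_2=(0,1)$. $\Gamma$ is a $C^2$ curve in $\mathbb{R}^2$ (with a tangent space $T_q(\Gamma)$ at every point $q$) that intersects the axes exactly at $A_1$ and $A_2$, and $\Gamma=\{(\alpha_1(z),\alpha_2(z)): z\in[-1,1]\}$ where $\alpha_1,\alpha_2\in C^2([-1,1])$, $\alpha_1'\ge 0$, $\alpha_2'\le 0$; the parametrization runs from $A_2$ (at $z=-1$) to $A_1$ (at $z=1$). $D$ is the curvilinear triangle $OA_1A_2$ bounded by the segments $OA_1$, $OA_2$ and $\Gamma$. $C^2(\partial D)$ denotes the continuous functions on $\partial D$ whose restrictions to each of the three closed sides $OA_1$, $OA_2$, $\Gamma$ are $C^2$. Generalized solution: $u\in C(\overline{D})$ with $u|_{\partial D}=g$ and $-\int_D u\,(m\partial_x+n\partial_y)\partial_x\partial_y\varphi\,dx\,dy=0$ for every $\varphi\in C_0^\infty(D)$. For $p=(x,y)\in\overline{D}$ put $\pi_1p=(x,0)$, $\pi_2p=(0,y)$, and let $\pi_3p$ be the unique point of intersection of $\Gamma$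 with the line $\{p+(mt,nt):t\in\mathbb{R}\}$. Define $\zeta_1=\pi_3\circ\pi_1$, $\zeta_2=\pi_3\circ\pi_2$, maps of $\Gamma$ into itself, and $\zeta=(\zeta_1,\zeta_2)$. The guiding sets are $\Omega_1=\{q\in\Gamma:(0,1)\in T_q(\Gamma)\}$ (vertical tangent) and $\Omega_2=\{q\in\Gamma:(1,0)\in T_q(\Gamma)\}$ (horizontal tangent). An $\Omega$-proper orbit is a finite or infinite sequence $(p_1,p_2,\dots)$ in $\Gamma$ such that for every $j\ge2$ there is $i\in\{1,2\}$ with $p_{j-1}\notin\Omega_i$ and $p_j=\zeta_i(p_{j-1})$. $\Omega\text{-}OS(p)$ is the set of all $q$ for which there is a finite $\Omega$-proper orbit $(p,\dots,q)$ (the one-term orbit is allowed). $(\Gamma,\zeta,\Omega)$ is $\Omega$-minimal if $\overline{\Omega\text{-}OS(p)}=\Gamma$ for every $p\in\Gamma$. *)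

theory Defs
  imports "HOL-Analysis.Analysis"
begin

text \<open>\<open>C^k(S)\<close> for an interval \<open>S\<close>; derivatives at the end points are one-sided.\<close>

primrec C_diff_on :: "nat \<Rightarrow> real set \<Rightarrow> (real \<Rightarrow> real) \<Rightarrow> bool" where
  "C_diff_on 0 S f \<longleftrightarrow> continuous_on S f"
| "C_diff_on (Suc k) S f \<longleftrightarrow>
    (\<exists>f'. (\<forall>x\<in>S. (f has_real_derivative f' x) (at x within S)) \<and> C_diff_on k S f')"

text \<open>For an open set \<open>U\<close> and \<open>U \<subseteq> V \<subseteq> closure U\<close>: \<open>f\<close> is continuous on \<open>V\<close>, has partial
  derivatives of all orders up to \<open>k\<close> in \<open>U\<close>, and each of them extends to a continuous function
  on \<open>V\<close>. Thus \<open>V = U\<close> gives \<open>C^k(U)\<close>, and \<open>V = closure U\<close> gives \<open>C^k\<close> of the closure.\<close>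

primrec C_diff_upto :: "nat \<Rightarrow> (real \<times> real) set \<Rightarrow> (real \<times> real) set \<Rightarrow> (real \<times> real \<Rightarrow> real) \<Rightarrow> bool" where
  "C_diff_upto 0 U V f \<longleftrightarrow> continuous_on V f"
| "C_diff_upto (Suc k) U V f \<longleftrightarrow>
    continuous_on V f \<and>
    (\<exists>f1 f2.
      (\<forall>x y. (x, y) \<in> U \<longrightarrow>
        ((\<lambda>t. f (t, y)) has_real_derivative f1 (x, y)) (at x) \<and>
        ((\<lambda>t. f (x, t)) has_real_derivative f2 (x, y)) (at y)) \<and>
      C_diff_upto k U V f1 \<and> C_diff_upto k U V f2)"

definition C2_closure :: "(real \<times> real) set \<Rightarrow> (real \<times> real \<Rightarrow> real) \<Rightarrow> bool" where
  "C2_closure U f \<longleftrightarrow> C_diff_upto 2 U (closure U) f"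

text \<open>\<open>C_0^\<infinity>(U)\<close>, its members being extended by zero to the whole plane.\<close>

definition test_function :: "(real \<times> real) set \<Rightarrow> (real \<times> real \<Rightarrow> real) \<Rightarrow> bool" where
  "test_function U \<phi> \<longleftrightarrow>
    (\<forall>k. C_diff_upto k UNIV UNIV \<phi>) \<and>
    compact (closure {p. \<phi> p \<noteq> 0}) \<and> closure {p. \<phi> p \<noteq> 0} \<subseteq> U"

definition partial_x :: "(real \<times> real \<Rightarrow> real) \<Rightarrow> real \<times> real \<Rightarrow> real" where
  "partial_x f = (\<lambda>(x, y). deriv (\<lambda>t. f (t, y)) x)"

definition partial_y :: "(real \<times> real \<Rightarrow> real) \<Rightarrow> real \<times> real \<Rightarrow> real" where
  "partial_y f = (\<lambda>(x, y). deriv (\<lambda>t. f (x, t)) y)"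

definition third_order_op :: "real \<Rightarrow> real \<Rightarrow> (real \<times> real \<Rightarrow> real) \<Rightarrow> real \<times> real \<Rightarrow> real" where
  "third_order_op m n \<phi> p =
    m * partial_x (partial_x (partial_y \<phi>)) p + n * partial_y (partial_x (partial_y \<phi>)) p"

definition Curve :: "(real \<Rightarrow> real) \<Rightarrow> (real \<Rightarrow> real) \<Rightarrow> (real \<times> real) set" where
  "Curve \<alpha>\<^sub>1 \<alpha>\<^sub>2 = (\<lambda>z. (\<alpha>\<^sub>1 z, \<alpha>\<^sub>2 z)) ` {-1..1}"

abbreviation param_deriv :: "(real \<Rightarrow> real) \<Rightarrow> real \<Rightarrow> real" where
  "param_deriv \<alpha> z \<equiv> vector_derivative \<alpha> (at z within {-1..1})"

text \<open>Regularity of the parametrization (the velocity never vanishes) expresses that the curve has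
  a tangent line at each of its points, the end points included.\<close>

definition admissible_curve :: "(real \<Rightarrow> real) \<Rightarrow> (real \<Rightarrow> real) \<Rightarrow> bool" where
  "admissible_curve \<alpha>\<^sub>1 \<alpha>\<^sub>2 \<longleftrightarrow>
    C_diff_on 2 {-1..1} \<alpha>\<^sub>1 \<and> C_diff_on 2 {-1..1} \<alpha>\<^sub>2 \<and>
    (\<forall>z\<in>{-1..1}. param_deriv \<alpha>\<^sub>1 z \<ge> 0 \<and> param_deriv \<alpha>\<^sub>2 z \<le> 0 \<and>
                  (param_deriv \<alpha>\<^sub>1 z, param_deriv \<alpha>\<^sub>2 z) \<noteq> (0, 0)) \<and>
    (\<alpha>\<^sub>1 (-1), \<alpha>\<^sub>2 (-1)) = (0, 1) \<and> (\<alpha>\<^sub>1 1, \<alpha>\<^sub>2 1) = (1, 0) \<and>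
    Curve \<alpha>\<^sub>1 \<alpha>\<^sub>2 \<inter> {(x, y). x = 0 \<or> y = 0} = {(1, 0), (0, 1)}"

definition tangent_space :: "(real \<Rightarrow> real) \<Rightarrow> (real \<Rightarrow> real) \<Rightarrow> real \<times> real \<Rightarrow> (real \<times> real) set" where
  "tangent_space \<alpha>\<^sub>1 \<alpha>\<^sub>2 q =
    span {(param_deriv \<alpha>\<^sub>1 z, param_deriv \<alpha>\<^sub>2 z) | z. z \<in> {-1..1} \<and> (\<alpha>\<^sub>1 z, \<alpha>\<^sub>2 z) = q}"

definition Domain_D :: "(real \<Rightarrow> real) \<Rightarrow> (real \<Rightarrow> real) \<Rightarrow> (real \<times> real) set" where
  "Domain_D \<alpha>\<^sub>1 \<alpha>\<^sub>2 =
    inside (closed_segment (0, 0) (1, 0) \<union> closed_segment (0, 0) (0, 1) \<union> Curve \<alpha>\<^sub>1 \<alpha>\<^sub>2)"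

definition C2_boundary :: "(real \<Rightarrow> real) \<Rightarrow> (real \<Rightarrow> real) \<Rightarrow> (real \<times> real \<Rightarrow> real) \<Rightarrow> bool" where
  "C2_boundary \<alpha>\<^sub>1 \<alpha>\<^sub>2 g \<longleftrightarrow>
    continuous_on (frontier (Domain_D \<alpha>\<^sub>1 \<alpha>\<^sub>2)) g \<and>
    C_diff_on 2 {0..1} (\<lambda>x. g (x, 0)) \<and>
    C_diff_on 2 {0..1} (\<lambda>y. g (0, y)) \<and>
    C_diff_on 2 {-1..1} (\<lambda>z. g (\<alpha>\<^sub>1 z, \<alpha>\<^sub>2 z))"

definition generalized_solution ::
  "real \<Rightarrow> real \<Rightarrow> (real \<times> real) set \<Rightarrow> (real \<times> real \<Rightarrow> real) \<Rightarrow> (real \<times> real \<Rightarrow> real) \<Rightarrow> bool" where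
  "generalized_solution m n D g u \<longleftrightarrow>
    continuous_on (closure D) u \<and>
    (\<forall>p\<in>frontier D. u p = g p) \<and>
    (\<forall>\<phi>. test_function D \<phi> \<longrightarrow> - (LINT p:D|lborel. u p * third_order_op m n \<phi> p) = 0)"

text \<open>A family of maps \<open>\<zeta> i\<close> of \<open>X\<close>, \<open>i \<in> I\<close>, with guiding sets \<open>\<Omega> i\<close>. Orbit sets only involve
  finite proper orbits, which are represented as nonempty lists.\<close>

definition proper_orbit ::
  "'a set \<Rightarrow> nat set \<Rightarrow> (nat \<Rightarrow> 'a \<Rightarrow> 'a) \<Rightarrow> (nat \<Rightarrow> 'a set) \<Rightarrow> 'a list \<Rightarrow> bool" where
  "proper_orbit X I \<zeta> \<Omega> ps \<longleftrightarrow>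
    ps \<noteq> [] \<and> set ps \<subseteq> X \<and>
    (\<forall>j. Suc j < length ps \<longrightarrow> (\<exists>i\<in>I. ps ! j \<notin> \<Omega> i \<and> ps ! Suc j = \<zeta> i (ps ! j)))"

definition orbit_set ::
  "'a set \<Rightarrow> nat set \<Rightarrow> (nat \<Rightarrow> 'a \<Rightarrow> 'a) \<Rightarrow> (nat \<Rightarrow> 'a set) \<Rightarrow> 'a \<Rightarrow> 'a set" where
  "orbit_set X I \<zeta> \<Omega> p = {q. \<exists>ps. proper_orbit X I \<zeta> \<Omega> ps \<and> hd ps = p \<and> last ps = q}"

definition Omega_minimal ::
  "'a::topological_space set \<Rightarrow> nat set \<Rightarrow> (nat \<Rightarrow> 'a \<Rightarrow> 'a) \<Rightarrow> (nat \<Rightarrow> 'a set) \<Rightarrow> bool" where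
  "Omega_minimal X I \<zeta> \<Omega> \<longleftrightarrow> (\<forall>p\<in>X. closure (orbit_set X I \<zeta> \<Omega> p) = X)"

definition proj_1 :: "real \<times> real \<Rightarrow> real \<times> real" where
  "proj_1 p = (fst p, 0)"

definition proj_2 :: "real \<times> real \<Rightarrow> real \<times> real" where
  "proj_2 p = (0, snd p)"

definition proj_3 ::
  "real \<Rightarrow> real \<Rightarrow> (real \<times> real) set \<Rightarrow> real \<times> real \<Rightarrow> real \<times> real" where
  "proj_3 m n \<Gamma> p = (THE q. q \<in> \<Gamma> \<and> (\<exists>t. q = p + (m * t, n * t)))"

text \<open>The index \<open>i\<close> ranges over \<open>{1, 2}\<close>.\<close>

definition zeta ::
  "real \<Rightarrow> real \<Rightarrow> (real \<times> real) set \<Rightarrow> nat \<Rightarrow> real \<times> real \<Rightarrow> real \<times> real" where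
  "zeta m n \<Gamma> i = proj_3 m n \<Gamma> \<circ> (if i = 1 then proj_1 else proj_2)"

text \<open>Note the crossing of indices: \<open>\<Omega>\<^sub>1\<close> is the set of vertical, \<open>\<Omega>\<^sub>2\<close> that of horizontal
  tangents.\<close>

definition guiding_set :: "(real \<Rightarrow> real) \<Rightarrow> (real \<Rightarrow> real) \<Rightarrow> nat \<Rightarrow> (real \<times> real) set" where
  "guiding_set \<alpha>\<^sub>1 \<alpha>\<^sub>2 i =
    {q \<in> Curve \<alpha>\<^sub>1 \<alpha>\<^sub>2. (if i = 1 then (0, 1) else (1, 0)) \<in> tangent_space \<alpha>\<^sub>1 \<alpha>\<^sub>2 q}"

end

theory Submission
  imports Defs "HOL-Complex_Analysis.Great_Picard"
begin

text \<open>
  Solutions have the form \<open>u(x,y) = f(x) + h(y) + k(n x - m y)\<close>. Take \<open>s = n x - m y \<in> [-m,n]\<close> as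
  coordinate on \<open>\<Gamma>\<close> and put \<open>\<delta>(s) = n x\<close>; then \<open>\<zeta>\<^sub>1\<close> and \<open>\<zeta>\<^sub>2\<close> become \<open>\<delta>\<close> and \<open>s - \<delta>(s)\<close>, the guiding
  sets become \<open>{d = 0}\<close> and \<open>{d = 1}\<close> for \<open>d = \<delta>'\<close>, and eliminating \<open>f, h\<close> through the boundary data on
  the axes leaves the functional equation \<open>k(s) - k(\<delta>(s)) - k(s - \<delta>(s)) = G(s)\<close>.

  For \<open>w = k'\<close> it reads \<open>w - d w(\<delta>) - (1 - d) w(s - \<delta>) = G'\<close>. The set where a homogeneous solution
  attains its maximum is closed and invariant, so minimality gives uniqueness. If a proper closed
  invariant set \<open>F\<close> exists, a right-hand side with \<open>G' = 1\<close> on \<open>F\<close> and \<open>G(-m) = G(n) = 0\<close> admits no solution: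
  look at the minimum of \<open>w\<close> on \<open>F\<close>. For existence, \<open>v = w'\<close> solves \<open>v - T v - K v = G''\<close> with
  \<open>T v = d\<^sup>2 v(\<delta>) + (1 - d)\<^sup>2 v(s - \<delta>)\<close>, a power of which is a contraction by minimality, and \<open>K\<close> compact;
  all \<open>I - \<lambda>(T + K)\<close>, \<open>0 \<le> \<lambda> \<le> 1\<close>, are injective, and the method of continuity applies.
\<close>

subsection \<open>Surjectivity from injectivity along a path\<close>

text \<open>After one differentiation the averaging w |-> d w(\<delta>) + (1 - d) w(s - \<delta>)
  still fixes the constants, so no power of it contracts. A second differentiation squares the
  weights, d^2 + (1 - d)^2 = 1 - 2 d (1 - d), which gains wherever 0 < d < 1. The price is the term
  in which d itself is differentiated; it involves only the primitive of v and is therefore compact.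
  The constants do no harm to uniqueness: a constant w makes k affine, and a linear profile cancels
  against its own contributions to f and h.

  The other obstacle is regularity: a C^2 function satisfies the third order equation only weakly.
  One integration by parts shows that V = m u_x + n u_y has vanishing weak mixed derivative; test
  functions adapted to rectangles turn this into V(x,y) = V(x,0) + V(0,y) - V(0,0), and integrating
  the two parts produces f and h. The profiles obtained in this way are C^1, which is why uniqueness
  and necessity argue with w = k', whereas existence constructs v.\<close>

lemma nonexpansive_power_contraction_bound:
  fixes T :: "'a::real_normed_vector \<Rightarrow> 'a"
  assumes T: "linear T" "\<And>v. norm (T v) \<le> norm v"
    and N: "\<And>v. norm ((T ^^ N) v) \<le> c * norm v" and c: "c < 1"
    and l: "0 \<le> l" "l \<le> 1"
  shows "norm v \<le> real N / (1 - c) * norm (v - l *\<^sub>R T v)"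
proof -
  define S where "S = (\<lambda>v. l *\<^sub>R T v)"
  have S: "norm (S v) \<le> norm v" for v
    unfolding S_def using T(2)[of v] l mult_mono[of l 1 "norm (T v)" "norm v"] by simp
  have Sdiff: "S (v - w) = S v - S w" for v w
    unfolding S_def by (simp add: linear_diff[OF T(1)] scaleR_diff_right)
  have Spow: "norm ((S ^^ j) v) \<le> norm v" for j v
    by (induction j) (auto intro: order_trans[OF S])
  have Spow_diff: "(S ^^ j) (v - w) = (S ^^ j) v - (S ^^ j) w" for j v w
    by (induction j) (auto simp: Sdiff)
  \<comment> \<open>v - S^j v is the sum of S^i (v - S v) over i < j, and no term is larger in norm
    than v - S v. With j = N this yields the factor N / (1 - c), the same for all l.\<close>
  have tele: "norm (v - (S ^^ j) v) \<le> real j * norm (v - S v)" for j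
  proof (induction j)
    case (Suc j)
    have "v - (S ^^ Suc j) v = (v - (S ^^ j) v) + (S ^^ j) (v - S v)"
      by (simp add: Spow_diff funpow_swap1)
    then have "norm (v - (S ^^ Suc j) v) \<le> norm (v - (S ^^ j) v) + norm ((S ^^ j) (v - S v))"
      by (metis norm_triangle_ineq)
    then show ?case
      using Suc Spow[of j "v - S v"] by (simp add: algebra_simps)
  qed simp
  have SN: "(S ^^ j) v = l ^ j *\<^sub>R (T ^^ j) v" for j
    by (induction j) (auto simp: S_def linear_cmul[OF T(1)])
  have "norm ((S ^^ N) v) \<le> c * norm v"
  proof -
    have "norm ((S ^^ N) v) = l ^ N * norm ((T ^^ N) v)"
      using l by (simp add: SN)
    also have "\<dots> \<le> 1 * norm ((T ^^ N) v)"
      by (rule mult_right_mono) (use l power_le_one in auto)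
    finally show ?thesis using N[of v] by simp
  qed
  then have "(1 - c) * norm v \<le> norm v - norm ((S ^^ N) v)"
    by (simp add: algebra_simps)
  also have "\<dots> \<le> norm (v - (S ^^ N) v)"
    by (rule norm_triangle_ineq2)
  also have "\<dots> \<le> real N * norm (v - S v)" by (rule tele)
  finally show ?thesis
    using c by (simp add: S_def field_simps)
qed

text \<open>The uniform bound limits the inverse of I - l A by C wherever it exists. Solvability
  therefore passes from l to every l' within the fixed distance 1 / (2 C M) by Banach's fixed point
  theorem, and finitely many steps lead from 0 to 1.\<close>

lemma method_of_continuity:
  fixes A :: "'a::{real_normed_vector,complete_space} \<Rightarrow> 'a"
  assumes A: "linear A" "\<And>v. norm (A v) \<le> M * norm v"
    and C: "\<And>l v. 0 \<le> l \<Longrightarrow> l \<le> 1 \<Longrightarrow> norm v \<le> C * norm (v - l *\<^sub>R A v)"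
  shows "\<exists>v. v - A v = f"
proof -
  define M' where "M' = max M 1"
  define C' where "C' = max C 1"
  have M': "norm (A v) \<le> M' * norm v" for v
    using A(2)[of v] mult_right_mono[of M M' "norm v"] unfolding M'_def by (auto intro: order_trans)
  have C': "norm v \<le> C' * norm (v - l *\<^sub>R A v)" if "0 \<le> l" "l \<le> 1" for l v
    using C[OF that, of v] mult_right_mono[of C C' "norm (v - l *\<^sub>R A v)"] unfolding C'_def
    by (auto intro: order_trans)
  have pos: "M' > 0" "C' > 0" by (auto simp: M'_def C'_def)
  have Adiff: "A (v - w) = A v - A w" for v w by (rule linear_diff[OF A(1)])
  define onto where "onto l \<longleftrightarrow> (\<forall>f. \<exists>v. v - l *\<^sub>R A v = f)" for l
  have step: "onto l'" if "onto l" "0 \<le> l" "l \<le> 1" "\<bar>l' - l\<bar> * (2 * C' * M') \<le> 1" for l l'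
    unfolding onto_def
  proof
    fix f
    obtain R where R: "\<And>f. R f - l *\<^sub>R A (R f) = f"
      using \<open>onto l\<close> unfolding onto_def by metis
    \<comment> \<open>A fixed point satisfies v - l A v = f + (l' - l) A v, which is the equation
      for l'.\<close>
    define \<Phi> where "\<Phi> v = R (f + (l' - l) *\<^sub>R A v)" for v
    have "dist (\<Phi> v) (\<Phi> w) \<le> 1/2 * dist v w" for v w
    proof -
      have "\<Phi> v - \<Phi> w - l *\<^sub>R A (\<Phi> v - \<Phi> w) = (l' - l) *\<^sub>R A (v - w)"
      proof -
        have "\<Phi> v - \<Phi> w - l *\<^sub>R A (\<Phi> v - \<Phi> w)
            = (\<Phi> v - l *\<^sub>R A (\<Phi> v)) - (\<Phi> w - l *\<^sub>R A (\<Phi> w))"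
          by (simp add: Adiff scaleR_diff_right)
        also have "\<dots> = (f + (l' - l) *\<^sub>R A v) - (f + (l' - l) *\<^sub>R A w)"
          unfolding \<Phi>_def R ..
        finally show ?thesis by (simp add: Adiff scaleR_diff_right)
      qed
      then have "norm (\<Phi> v - \<Phi> w) \<le> C' * (\<bar>l' - l\<bar> * norm (A (v - w)))"
        using C'[OF that(2,3), of "\<Phi> v - \<Phi> w"] by simp
      also have "\<dots> \<le> C' * (\<bar>l' - l\<bar> * (M' * norm (v - w)))"
        using pos by (intro mult_left_mono M') auto
      also have "\<dots> = \<bar>l' - l\<bar> * (2 * C' * M') * (norm (v - w) / 2)" by simp
      also have "\<dots> \<le> 1 * (norm (v - w) / 2)"
        by (rule mult_right_mono[OF that(4)]) simp
      finally show ?thesis by (simp add: dist_norm)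
    qed
    then have "\<exists>!v. \<Phi> v = v"
      by (intro banach_fix_type[of "1/2"]) auto
    then obtain v where "\<Phi> v = v" by blast
    then have "v - l *\<^sub>R A v = f + (l' - l) *\<^sub>R A v"
      using R[of "f + (l' - l) *\<^sub>R A v"] unfolding \<Phi>_def by simp
    then have "v - l' *\<^sub>R A v = f" by (simp add: algebra_simps)
    then show "\<exists>v. v - l' *\<^sub>R A v = f" by blast
  qed
  obtain n :: nat where n: "n > 0" "2 * C' * M' < real n"
    using reals_Archimedean2[of "2 * C' * M'"] pos by (metis gr_zeroI less_le_trans mult_pos_pos not_less of_nat_0 zero_less_numeral order.asym)
  have "j \<le> n \<Longrightarrow> onto (real j / real n)" for j
  proof (induction j)
    case 0
    show ?case by (simp add: onto_def)
  next
    case (Suc j)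
    show ?case
    proof (rule step)
      show "onto (real j / real n)" using Suc by simp
      have "real (Suc j) / real n - real j / real n = 1 / real n"
        by (simp add: diff_divide_distrib[symmetric])
      then show "\<bar>real (Suc j) / real n - real j / real n\<bar> * (2 * C' * M') \<le> 1"
        using n by (simp add: field_simps)
    qed (use Suc n in auto)
  qed
  from this[of n] have "onto 1" using n by simp
  then show ?thesis unfolding onto_def by simp
qed

text \<open>This takes the place of the Fredholm alternative. If the uniform bound required by
  \<open>method_of_continuity\<close> failed, there would be unit vectors almost annihilated by I -
  l (T + K); a subsequence of them converges to a unit vector in the kernel for some l, against
  injectivity.\<close>

lemma injective_family_imp_surjective:
  fixes T K :: "'a::{real_normed_vector,complete_space} \<Rightarrow> 'a"
  assumes T: "linear T" "\<And>v. norm (T v) \<le> norm v"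
    and N: "\<And>v. norm ((T ^^ N) v) \<le> c * norm v" and c: "c < 1"
    and K: "linear K" "\<And>v. norm (K v) \<le> M * norm v"
    and compact: "\<And>v :: nat \<Rightarrow> 'a. (\<And>j. norm (v j) \<le> 1) \<Longrightarrow>
        \<exists>r y. strict_mono (r :: nat \<Rightarrow> nat) \<and> (\<lambda>j. K (v (r j))) \<longlonglongrightarrow> y"
    and inj: "\<And>l v. 0 \<le> l \<Longrightarrow> l \<le> 1 \<Longrightarrow> v = l *\<^sub>R (T v + K v) \<Longrightarrow> v = 0"
  shows "\<exists>v. v - (T v + K v) = f"
proof -
  have blT: "bounded_linear T"
    using T by (intro bounded_linear_intro[where K=1]) (auto simp: linear_add linear_cmul)
  have blK: "bounded_linear K"
    using K by (intro bounded_linear_intro[where K=M]) (auto simp: linear_add linear_cmul mult.commute)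
  define A where "A v = T v + K v" for v
  have blA: "bounded_linear A" unfolding A_def by (intro bounded_linear_add blT blK)
  have "\<exists>C. \<forall>l v. 0 \<le> l \<longrightarrow> l \<le> 1 \<longrightarrow> norm v \<le> C * norm (v - l *\<^sub>R A v)"
  proof (rule ccontr)
    assume *: "\<not> ?thesis"
    have "\<exists>l v. 0 \<le> l \<and> l \<le> 1 \<and> norm v = 1 \<and> norm (v - l *\<^sub>R A v) < 1 / real (Suc j)" for j
    proof -
      obtain l v where lv: "0 \<le> l" "l \<le> 1" "norm v > real (Suc j) * norm (v - l *\<^sub>R A v)"
        using * by (metis not_le)
      then have v: "norm v > 0"
        by (metis mult_nonneg_nonneg norm_ge_zero of_nat_0_le_iff order_le_less_trans)
      define w where "w = v /\<^sub>R norm v"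
      have "w - l *\<^sub>R A w = (v - l *\<^sub>R A v) /\<^sub>R norm v"
        by (simp add: w_def linear_cmul[OF bounded_linear.linear[OF blA]] scaleR_diff_right)
      then have "norm (w - l *\<^sub>R A w) = norm (v - l *\<^sub>R A v) / norm v"
        by (simp add: divide_inverse_commute)
      also have "\<dots> < 1 / real (Suc j)"
        using lv v by (simp add: field_simps)
      finally show ?thesis using lv v by (intro exI[of _ l] exI[of _ w]) (auto simp: w_def)
    qed
    then obtain l v where lv: "\<And>j. 0 \<le> l j" "\<And>j. l j \<le> (1::real)" "\<And>j. norm (v j) = 1"
        "\<And>j. norm (v j - l j *\<^sub>R A (v j)) < 1 / real (Suc j)"
      by metis
    obtain r y where r: "strict_mono (r :: nat \<Rightarrow> nat)" "(\<lambda>j. K (v (r j))) \<longlonglongrightarrow> y"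
      using compact[of v] lv(3) by auto
    obtain l0 r' where r': "strict_mono (r' :: nat \<Rightarrow> nat)" "l0 \<in> {0..1}" "((\<lambda>j. l (r j)) \<circ> r') \<longlonglongrightarrow> l0"
      using compact_Icc[of 0 "1::real"] lv(1,2) unfolding compact_def
      by (metis atLeastAtMost_iff)
    define L where "L = (\<lambda>j. l (r (r' j)))"
    define V where "V = (\<lambda>j. v (r (r' j)))"
    have L: "L \<longlonglongrightarrow> l0" using r'(3) by (simp add: L_def o_def)
    have KV: "(\<lambda>j. K (V j)) \<longlonglongrightarrow> y"
      using LIMSEQ_subseq_LIMSEQ[OF r(2) r'(1)] by (simp add: V_def o_def)
    have V1: "norm (V j) = 1" for j by (simp add: V_def lv)
    have res: "(\<lambda>j. V j - L j *\<^sub>R A (V j)) \<longlonglongrightarrow> 0"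
    proof -
      have "(\<lambda>j. v j - l j *\<^sub>R A (v j)) \<longlonglongrightarrow> 0"
        by (rule Lim_null_comparison[OF always_eventually LIMSEQ_Suc[OF lim_1_over_n]])
           (rule allI, rule less_imp_le, rule lv(4))
      then show ?thesis
        using LIMSEQ_subseq_LIMSEQ[OF LIMSEQ_subseq_LIMSEQ[OF _ r(1)] r'(1)]
        by (force simp: V_def L_def o_def)
    qed
    have TV: "(\<lambda>j. (L j - l0) *\<^sub>R T (V j)) \<longlonglongrightarrow> 0"
    proof (rule Lim_null_comparison)
      show "\<forall>\<^sub>F j in sequentially. norm ((L j - l0) *\<^sub>R T (V j)) \<le> \<bar>L j - l0\<bar>"
      proof (rule always_eventually, rule allI)
        fix j
        have "\<bar>L j - l0\<bar> * norm (T (V j)) \<le> \<bar>L j - l0\<bar> * 1"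
          by (rule mult_left_mono) (use T(2)[of "V j"] V1 in auto)
        then show "norm ((L j - l0) *\<^sub>R T (V j)) \<le> \<bar>L j - l0\<bar>" by simp
      qed
      show "(\<lambda>j. \<bar>L j - l0\<bar>) \<longlonglongrightarrow> 0"
        using L by (simp add: LIM_zero tendsto_rabs_zero)
    qed
    have "(\<lambda>j. (V j - L j *\<^sub>R A (V j)) + L j *\<^sub>R K (V j) + (L j - l0) *\<^sub>R T (V j)) \<longlonglongrightarrow> 0 + l0 *\<^sub>R y + 0"
      by (intro tendsto_add res TV tendsto_scaleR L KV)
    then have lim: "(\<lambda>j. V j - l0 *\<^sub>R T (V j)) \<longlonglongrightarrow> l0 *\<^sub>R y"
      by (simp add: A_def algebra_simps)
    \<comment> \<open>T is not compact, so convergence of V has to come from the lower bound for I -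
      l0 T, which transfers the Cauchy property from \<open>V j - l0 *\<^sub>R T (V j)\<close> to
      \<open>V\<close>.\<close>
    have "Cauchy V"
    proof (rule metric_CauchyI)
      fix e :: real assume "e > 0"
      \<comment> \<open>The summand 1 keeps D positive even when N = 0.\<close>
      define D where "D = real N / (1 - c) + 1"
      have D: "D > 0" using c by (simp add: D_def add_nonneg_pos)
      obtain n0 where n0: "\<And>i j. i \<ge> n0 \<Longrightarrow> j \<ge> n0 \<Longrightarrow>
          dist (V i - l0 *\<^sub>R T (V i)) (V j - l0 *\<^sub>R T (V j)) < e / D"
        using metric_CauchyD[OF LIMSEQ_imp_Cauchy[OF lim], of "e / D"] \<open>e > 0\<close> D by auto
      have "dist (V i) (V j) < e" if "i \<ge> n0" "j \<ge> n0" for i j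
      proof -
        have "norm (V i - V j) \<le> real N / (1 - c) * norm ((V i - V j) - l0 *\<^sub>R T (V i - V j))"
          by (rule nonexpansive_power_contraction_bound[OF T N c]) (use r'(2) in auto)
        also have "\<dots> \<le> D * norm ((V i - V j) - l0 *\<^sub>R T (V i - V j))"
          by (rule mult_right_mono) (auto simp: D_def)
        also have "\<dots> = D * dist (V i - l0 *\<^sub>R T (V i)) (V j - l0 *\<^sub>R T (V j))"
          by (simp add: dist_norm linear_diff[OF T(1)] algebra_simps)
        also have "\<dots> < e" using n0[OF that] D by (simp add: field_simps)
        finally show ?thesis by (simp add: dist_norm)
      qed
      then show "\<exists>M. \<forall>m\<ge>M. \<forall>n\<ge>M. dist (V m) (V n) < e" by blast
    qed
    then obtain w where w: "V \<longlonglongrightarrow> w" using Cauchy_convergent_iff convergent_def by blast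
    have "(\<lambda>j. V j - L j *\<^sub>R A (V j)) \<longlonglongrightarrow> w - l0 *\<^sub>R A w"
      by (intro tendsto_intros w L bounded_linear.tendsto[OF blA])
    then have "w - l0 *\<^sub>R A w = 0" using res LIMSEQ_unique by blast
    then have "w = 0" using inj[of l0 w] r'(2) by (simp add: A_def)
    moreover have "norm w = 1"
      using tendsto_norm[OF w] V1 by (simp add: LIMSEQ_const_iff)
    ultimately show False by simp
  qed
  then obtain C where C: "\<And>l v. 0 \<le> l \<Longrightarrow> l \<le> 1 \<Longrightarrow> norm v \<le> C * norm (v - l *\<^sub>R A v)"
    by blast
  obtain M' where M': "\<And>v. norm (A v) \<le> norm v * M'"
    using bounded_linear.bounded[OF blA] by blast
  have "\<exists>v. v - A v = f"
    by (rule method_of_continuity[where M=M', OF bounded_linear.linear[OF blA] _ C])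
       (use M' in \<open>simp_all add: mult.commute\<close>)
  then show ?thesis by (simp add: A_def)
qed

subsection \<open>The functional equation\<close>

lemma DERIV_compose_within:
  fixes f g :: "real \<Rightarrow> real"
  assumes "(g has_real_derivative g') (at s within S)"
    and "(f has_real_derivative f') (at (g s) within T)" and "g ` S \<subseteq> T"
  shows "((\<lambda>s. f (g s)) has_real_derivative f' * g') (at s within S)"
  using DERIV_image_chain[OF has_field_derivative_subset[OF assms(2,3)] assms(1)]
  by (simp add: o_def)

lemma mvt_within_interval:
  fixes f :: "real \<Rightarrow> real"
  assumes f: "\<And>s. s \<in> {a..b} \<Longrightarrow> (f has_real_derivative f' s) (at s within {a..b})"
    and "a \<le> x" "x < y" "y \<le> b"
  shows "\<exists>z\<in>{x<..<y}. f y - f x = f' z * (y - x)"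
proof -
  have "(f has_derivative (\<lambda>h. f' s * h)) (at s within {x..y})" if "x \<le> s" "s \<le> y" for s
    using has_field_derivative_subset[OF f[of s], of "{x..y}"] assms that
    by (auto simp: has_field_derivative_def)
  from mvt_simple[OF \<open>x < y\<close> this] show ?thesis by auto
qed

lemma DERIV_zero_interval_const:
  fixes f :: "real \<Rightarrow> real"
  assumes f: "\<And>s. s \<in> {a..b} \<Longrightarrow> (f has_real_derivative 0) (at s within {a..b})"
    and "s \<in> {a..b}"
  shows "f s = f a"
proof (cases "s = a")
  case False
  then show ?thesis using mvt_within_interval[of a b f "\<lambda>_. 0" a s] assms by auto
qed simp

lemma DERIV_integral_Icc:
  fixes f :: "real \<Rightarrow> real"
  assumes "continuous_on {a..b} f" "s \<in> {a..b}"
  shows "((\<lambda>s. integral {a..s} f) has_real_derivative f s) (at s within {a..b})"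
  using integral_has_vector_derivative[OF assms]
  by (simp add: has_real_derivative_iff_has_vector_derivative)

lemma DERIV_within_Icc_unique:
  fixes f :: "real \<Rightarrow> real"
  assumes "(f has_real_derivative D) (at x within {a..b})" "(f has_real_derivative E) (at x within {a..b})"
    and "a < b" "x \<in> {a..b}"
  shows "D = E"
  using vector_derivative_unique_within_closed_interval[of a b x f D E] assms
  by (simp add: has_real_derivative_iff_has_vector_derivative)

text \<open>Here \<open>a\<close> and \<open>b\<close> stand for -m and n, and \<open>e\<close> is
  the second derivative of \<delta>. Since \<delta> = n x and s - \<delta> = - m y on the curve,
  \<open>d_range\<close> says that x increases and y decreases along it, in the weak sense.\<close>

locale curve_map =
  fixes a b :: real and \<delta> d e :: "real \<Rightarrow> real"
  assumes ab: "a < 0" "0 < b"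
    and \<delta>_ends: "\<delta> a = 0" "\<delta> b = b"
    and \<delta>_deriv: "s \<in> {a..b} \<Longrightarrow> (\<delta> has_real_derivative d s) (at s within {a..b})"
    and d_deriv: "s \<in> {a..b} \<Longrightarrow> (d has_real_derivative e s) (at s within {a..b})"
    and e_cont: "continuous_on {a..b} e"
    and d_range: "s \<in> {a..b} \<Longrightarrow> 0 \<le> d s \<and> d s \<le> 1"
begin

lemma \<delta>_increments:
  assumes "a \<le> x" "x \<le> y" "y \<le> b"
  shows "\<delta> x \<le> \<delta> y" "\<delta> y - \<delta> x \<le> y - x"
proof -
  have "\<delta> x \<le> \<delta> y \<and> \<delta> y - \<delta> x \<le> y - x"
  proof (cases "x = y")
    case False
    then obtain z where z: "z \<in> {x<..<y}" "\<delta> y - \<delta> x = d z * (y - x)"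
      using mvt_within_interval[of a b \<delta> d x y] \<delta>_deriv assms by auto
    moreover have "0 \<le> d z * (y - x)" "d z * (y - x) \<le> 1 * (y - x)"
      using d_range[of z] z assms by (auto intro!: mult_nonneg_nonneg mult_right_mono)
    ultimately show ?thesis by simp
  qed simp
  then show "\<delta> x \<le> \<delta> y" "\<delta> y - \<delta> x \<le> y - x" by auto
qed

lemma \<delta>_bounds:
  assumes "s \<in> {a..b}"
  shows "0 \<le> \<delta> s" "\<delta> s \<le> b" "a \<le> s - \<delta> s" "s - \<delta> s \<le> 0"
  using \<delta>_increments[of a s] \<delta>_increments[of s b] assms \<delta>_ends by auto

lemma \<delta>_in: "s \<in> {a..b} \<Longrightarrow> \<delta> s \<in> {a..b}"
  using \<delta>_bounds[of s] ab by auto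

lemma co\<delta>_in: "s \<in> {a..b} \<Longrightarrow> s - \<delta> s \<in> {a..b}"
  using \<delta>_bounds[of s] ab by auto

lemma \<delta>_image: "\<delta> ` {a..b} \<subseteq> {a..b}" and co\<delta>_image: "(\<lambda>s. s - \<delta> s) ` {a..b} \<subseteq> {a..b}"
  using \<delta>_in co\<delta>_in by auto

lemma \<delta>_cont: "continuous_on {a..b} \<delta>" and d_cont: "continuous_on {a..b} d"
  by (rule DERIV_continuous_on, erule \<delta>_deriv) (rule DERIV_continuous_on, erule d_deriv)

lemma co\<delta>_cont: "continuous_on {a..b} (\<lambda>s. s - \<delta> s)"
  by (intro continuous_intros \<delta>_cont)

lemma comp_cont:
  assumes "continuous_on {a..b} f"
  shows "continuous_on {a..b} (\<lambda>s. f (\<delta> s))" "continuous_on {a..b} (\<lambda>s. f (s - \<delta> s))"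
  using continuous_on_compose2[OF assms \<delta>_cont \<delta>_image]
    continuous_on_compose2[OF assms co\<delta>_cont co\<delta>_image] by auto

lemma comp_deriv:
  assumes "\<And>s. s \<in> {a..b} \<Longrightarrow> (f has_real_derivative f' s) (at s within {a..b})" "s \<in> {a..b}"
  shows "((\<lambda>s. f (\<delta> s)) has_real_derivative f' (\<delta> s) * d s) (at s within {a..b})"
    "((\<lambda>s. f (s - \<delta> s)) has_real_derivative f' (s - \<delta> s) * (1 - d s)) (at s within {a..b})"
proof -
  show "((\<lambda>s. f (\<delta> s)) has_real_derivative f' (\<delta> s) * d s) (at s within {a..b})"
    by (rule DERIV_compose_within[OF \<delta>_deriv[OF assms(2)] assms(1)[OF \<delta>_in[OF assms(2)]] \<delta>_image])
  have "((\<lambda>s. s - \<delta> s) has_real_derivative 1 - d s) (at s within {a..b})"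
    by (intro derivative_intros \<delta>_deriv assms)
  from DERIV_compose_within[OF this assms(1)[OF co\<delta>_in[OF assms(2)]] co\<delta>_image]
  show "((\<lambda>s. f (s - \<delta> s)) has_real_derivative f' (s - \<delta> s) * (1 - d s)) (at s within {a..b})" .
qed

lemma functional_deriv:
  assumes k: "\<And>s. s \<in> {a..b} \<Longrightarrow> (k has_real_derivative w s) (at s within {a..b})"
    and s: "s \<in> {a..b}"
  shows "((\<lambda>s. k s - k (\<delta> s) - k (s - \<delta> s)) has_real_derivative
      w s - (d s * w (\<delta> s) + (1 - d s) * w (s - \<delta> s))) (at s within {a..b})"
  using DERIV_diff[OF DERIV_diff[OF k[OF s] comp_deriv(1)[OF k s]] comp_deriv(2)[OF k s]]
  by (simp add: algebra_simps)

text \<open>The factor \<open>l\<close> is the homotopy parameter; l = 1 is the equation itself.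
  Differentiating the weights produces the \<open>e\<close> term, the only one that contains w
  instead of v and thus the source of K.\<close>

lemma functional_deriv2:
  assumes w: "\<And>s. s \<in> {a..b} \<Longrightarrow> (w has_real_derivative v s) (at s within {a..b})"
    and s: "s \<in> {a..b}"
  shows "((\<lambda>s. w s - l * (d s * w (\<delta> s) + (1 - d s) * w (s - \<delta> s))) has_real_derivative
      v s - l * ((d s)\<^sup>2 * v (\<delta> s) + (1 - d s)\<^sup>2 * v (s - \<delta> s) + e s * (w (\<delta> s) - w (s - \<delta> s))))
      (at s within {a..b})"
proof -
  note W = comp_deriv[OF w s]
  have "((\<lambda>s. 1 - d s) has_real_derivative - e s) (at s within {a..b})"
    using DERIV_diff[OF DERIV_const d_deriv[OF s], of 1] by simp
  note D = DERIV_add[OF DERIV_mult[OF d_deriv[OF s] W(1)] DERIV_mult[OF this W(2)]]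
  show ?thesis
    by (rule DERIV_cong[OF DERIV_diff[OF w[OF s] DERIV_cmult[OF D]]], assumption, assumption)
       (rule arg_cong[where f="\<lambda>z. v s - l * z"], algebra)
qed

definition invariant :: "real set \<Rightarrow> bool" where
  "invariant F \<longleftrightarrow> F \<subseteq> {a..b} \<and>
    (\<forall>s\<in>F. (d s \<noteq> 0 \<longrightarrow> \<delta> s \<in> F) \<and> (d s \<noteq> 1 \<longrightarrow> s - \<delta> s \<in> F))"

text \<open>Closed invariant sets replace orbit closures because the extremum arguments deliver such
  sets directly; \<open>Omega_minimal_iff\<close> supplies the equivalence.\<close>

definition minimal :: bool where
  "minimal \<longleftrightarrow> (\<forall>F. closed F \<and> F \<noteq> {} \<and> invariant F \<longrightarrow> F = {a..b})"

lemma closed_level_set: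
  assumes "continuous_on {a..b} f"
  shows "closed {s \<in> {a..b}. f s = (c :: real)}"
  using continuous_closed_preimage_constant[OF assms closed_real_atLeastAtMost]
  by (simp add: vimage_def Int_def conj_commute)

text \<open>At a maximum point w is a convex combination of two values that cannot exceed it, so a
  value with positive weight is again the maximum. Positive weight is exactly the condition under
  which \<open>invariant\<close> follows a move.\<close>

lemma maximum_principle:
  assumes minimal and w: "continuous_on {a..b} w"
    and eq: "\<And>s. s \<in> {a..b} \<Longrightarrow> w s = d s * w (\<delta> s) + (1 - d s) * w (s - \<delta> s)"
  shows "\<exists>c. \<forall>s\<in>{a..b}. w s = c"
proof -
  obtain s0 where s0: "s0 \<in> {a..b}" "\<And>s. s \<in> {a..b} \<Longrightarrow> w s \<le> w s0"
    using continuous_attains_sup[OF compact_Icc _ w] ab by auto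
  define F where "F = {s \<in> {a..b}. w s = w s0}"
  have "invariant F"
    unfolding invariant_def
  proof (intro conjI ballI)
    show "F \<subseteq> {a..b}" by (auto simp: F_def)
    fix s assume "s \<in> F"
    then have s: "s \<in> {a..b}" "w s = w s0" by (auto simp: F_def)
    have le: "w (\<delta> s) \<le> w s0" "w (s - \<delta> s) \<le> w s0"
      using s0(2)[OF \<delta>_in[OF s(1)]] s0(2)[OF co\<delta>_in[OF s(1)]] by auto
    have sum: "d s * (w s0 - w (\<delta> s)) + (1 - d s) * (w s0 - w (s - \<delta> s)) = 0"
      using eq[OF s(1)] s(2) by (simp add: algebra_simps)
    have "0 \<le> d s * (w s0 - w (\<delta> s))" "0 \<le> (1 - d s) * (w s0 - w (s - \<delta> s))"
      using d_range[OF s(1)] le by auto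
    with sum have "d s * (w s0 - w (\<delta> s)) = 0" "(1 - d s) * (w s0 - w (s - \<delta> s)) = 0"
      by linarith+
    then show "d s \<noteq> 0 \<longrightarrow> \<delta> s \<in> F" "d s \<noteq> 1 \<longrightarrow> s - \<delta> s \<in> F"
      using \<delta>_in[OF s(1)] co\<delta>_in[OF s(1)] by (auto simp: F_def)
  qed
  moreover have "closed F" unfolding F_def by (rule closed_level_set[OF w])
  moreover have "F \<noteq> {}" using s0 by (auto simp: F_def)
  ultimately have "F = {a..b}" using \<open>minimal\<close> unfolding minimal_def by blast
  then show ?thesis by (auto simp: F_def)
qed

text \<open>At a minimum point of w over F the average is at least w: a move that leaves F carries
  weight zero, and all others end at points of F.\<close>

lemma unsolvable_positive_rhs:
  assumes F: "closed F" "F \<noteq> {}" "invariant F" and w: "continuous_on {a..b} w"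
    and eq: "\<And>s. s \<in> F \<Longrightarrow> w s - (d s * w (\<delta> s) + (1 - d s) * w (s - \<delta> s)) > 0"
  shows False
proof -
  have sub: "F \<subseteq> {a..b}" using F by (auto simp: invariant_def)
  then have "compact F" using F by (metis bounded_closed_interval bounded_subset compact_eq_bounded_closed)
  then obtain s where s: "s \<in> F" "\<And>t. t \<in> F \<Longrightarrow> w s \<le> w t"
    using continuous_attains_inf[OF _ F(2) continuous_on_subset[OF w sub]] by blast
  have d: "0 \<le> d s" "d s \<le> 1" using d_range s sub by auto
  have "d s * w s \<le> d s * w (\<delta> s)"
    using F(3) s d by (cases "d s = 0") (auto simp: invariant_def intro: mult_left_mono)
  moreover have "(1 - d s) * w s \<le> (1 - d s) * w (s - \<delta> s)"
    using F(3) s d by (cases "d s = 1") (auto simp: invariant_def intro!: mult_left_mono)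
  ultimately show False using eq[OF s(1)] by (simp add: algebra_simps)
qed

text \<open>\<open>weight j\<close> is T^j applied to the constant 1. As T has nonnegative
  coefficients, it is the pointwise factor by which T^j bounds functions; see
  \<open>T_power_bound\<close>.\<close>

primrec weight :: "nat \<Rightarrow> real \<Rightarrow> real" where
  "weight 0 s = 1"
| "weight (Suc j) s = (d s)\<^sup>2 * weight j (\<delta> s) + (1 - d s)\<^sup>2 * weight j (s - \<delta> s)"

lemma weight_cont: "continuous_on {a..b} (weight j)"
proof (induction j)
  case (Suc j)
  then have "continuous_on {a..b} (\<lambda>s. (d s)\<^sup>2 * weight j (\<delta> s) + (1 - d s)\<^sup>2 * weight j (s - \<delta> s))"
    by (intro continuous_intros d_cont comp_cont)
  then show ?case by simp
qed simp

lemma d_squares: "s \<in> {a..b} \<Longrightarrow> (d s)\<^sup>2 + (1 - d s)\<^sup>2 \<le> 1"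
  using d_range[of s] mult_nonneg_nonneg[of "d s" "1 - d s"]
  by (auto simp: power2_eq_square algebra_simps)

lemma weight_nonneg: "0 \<le> weight j s"
  by (induction j arbitrary: s) auto

lemma weight_decreasing: "s \<in> {a..b} \<Longrightarrow> weight (Suc j) s \<le> weight j s"
proof (induction j arbitrary: s)
  case 0
  then show ?case using d_squares by simp
next
  case (Suc j)
  show ?case unfolding weight.simps(2)[of "Suc j"] weight.simps(2)[of j s]
    by (intro add_mono mult_left_mono Suc.IH \<delta>_in co\<delta>_in Suc.prems) auto
qed

lemma weight_le_1: "s \<in> {a..b} \<Longrightarrow> weight j s \<le> 1"
proof (induction j)
  case (Suc j)
  then show ?case using weight_decreasing[of s j] by linarith
qed simp

lemma weight_antimono: "i \<le> j \<Longrightarrow> s \<in> {a..b} \<Longrightarrow> weight j s \<le> weight i s"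
proof (induction rule: dec_induct)
  case (step j)
  then show ?case using weight_decreasing[of s j] by linarith
qed simp

text \<open>Full weight forces d^2 + (1 - d)^2 >= 1, that is d (1 - d) = 0. The only nonzero
  coefficient is then 1, and its move must lead to a point of full weight.\<close>

lemma weight_step_1:
  assumes s: "s \<in> {a..b}" and one: "weight (Suc j) s = 1"
  shows "d s \<noteq> 0 \<Longrightarrow> d s = 1 \<and> weight j (\<delta> s) = 1"
    "d s \<noteq> 1 \<Longrightarrow> d s = 0 \<and> weight j (s - \<delta> s) = 1"
proof -
  have le: "weight j (\<delta> s) \<le> 1" "weight j (s - \<delta> s) \<le> 1"
    using weight_le_1[OF \<delta>_in[OF s]] weight_le_1[OF co\<delta>_in[OF s]] by auto
  have "(d s)\<^sup>2 * weight j (\<delta> s) \<le> (d s)\<^sup>2 * 1" "(1 - d s)\<^sup>2 * weight j (s - \<delta> s) \<le> (1 - d s)\<^sup>2 * 1"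
    using le by (intro mult_left_mono; simp)+
  then have "(d s)\<^sup>2 + (1 - d s)\<^sup>2 \<ge> 1" using one by simp
  then have "d s * (1 - d s) \<le> 0" by (simp add: power2_eq_square algebra_simps)
  moreover have "0 \<le> d s * (1 - d s)" using d_range[OF s] by simp
  ultimately have "d s * (1 - d s) = 0" by (rule order.antisym)
  then have "d s = 0 \<or> d s = 1" by auto
  then show "d s \<noteq> 0 \<Longrightarrow> d s = 1 \<and> weight j (\<delta> s) = 1"
    "d s \<noteq> 1 \<Longrightarrow> d s = 0 \<and> weight j (s - \<delta> s) = 1"
    using one by auto
qed

text \<open>If all weights reached 1, the points where they do so would form a closed invariant set, so
  \<open>d\<close> would only take the values 0 and 1.\<close>

lemma weight_contraction:
  assumes minimal
  shows "\<exists>N c. 0 \<le> c \<and> c < 1 \<and> (\<forall>s\<in>{a..b}. weight N s \<le> c)"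
proof -
  define Z where "Z j = {s \<in> {a..b}. weight j s = 1}" for j
  have "\<exists>j. Z j = {}"
  proof (rule ccontr)
    assume ne: "\<nexists>j. Z j = {}"
    have closedZ: "closed (Z j)" for j
      unfolding Z_def by (rule closed_level_set[OF weight_cont])
    have compactZ: "compact (Z j)" for j
      unfolding compact_eq_bounded_closed
      by (intro conjI closedZ bounded_subset[OF bounded_closed_interval[of a b]]) (auto simp: Z_def)
    have mono: "Z j \<subseteq> Z i" if "i \<le> j" for i j
    proof
      fix s assume "s \<in> Z j"
      then have s: "s \<in> {a..b}" "weight j s = 1" by (auto simp: Z_def)
      then show "s \<in> Z i"
        using weight_antimono[OF that s(1)] weight_le_1[OF s(1), of i] by (simp add: Z_def)
    qed
    define F where "F = (\<Inter>j. Z j)"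
    have "F \<noteq> {}" unfolding F_def
      by (rule compact_nest[OF compactZ _ mono]) (use ne in auto)
    moreover have "closed F" unfolding F_def using closedZ by auto
    moreover have step: "(d s \<noteq> 0 \<longrightarrow> d s = 1 \<and> \<delta> s \<in> F) \<and> (d s \<noteq> 1 \<longrightarrow> d s = 0 \<and> s - \<delta> s \<in> F)"
      if "s \<in> F" for s
    proof -
      have s: "s \<in> {a..b}" "\<And>j. weight (Suc j) s = 1" using that by (auto simp: F_def Z_def)
      show ?thesis using weight_step_1[OF s] \<delta>_in[OF s(1)] co\<delta>_in[OF s(1)]
        unfolding F_def Z_def by blast
    qed
    moreover have "F \<subseteq> {a..b}" by (auto simp: F_def Z_def)
    ultimately have "F = {a..b}" using \<open>minimal\<close> unfolding minimal_def invariant_def by blast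
    then have d01: "d s = 0 \<or> d s = 1" if "s \<in> {a..b}" for s using step that by blast
    \<comment> \<open>The mean slope of \<delta> over the whole interval is b / (b - a), strictly
      between 0 and 1.\<close>
    obtain z where z: "z \<in> {a<..<b}" "b = d z * (b - a)"
      using mvt_within_interval[of a b \<delta> d a b] \<delta>_deriv ab \<delta>_ends by auto
    then show False using d01[of z] ab by auto
  qed
  then obtain N where N: "Z N = {}" by blast
  obtain s0 where s0: "s0 \<in> {a..b}" "\<And>s. s \<in> {a..b} \<Longrightarrow> weight N s \<le> weight N s0"
    using continuous_attains_sup[OF compact_Icc _ weight_cont[of N]] ab by auto
  have "weight N s0 < 1"
    using N weight_le_1[OF s0(1), of N] s0(1) unfolding Z_def by fastforce
  then show ?thesis using s0(2) weight_nonneg[of N s0] by blast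
qed

end

section \<open>The twice differentiated equation in a Banach space\<close>

context curve_map
begin

definition clamp_ab :: "real \<Rightarrow> real" where
  "clamp_ab s = max a (min b s)"

lemma clamp_ab_bounds [simp]: "a \<le> clamp_ab s" "clamp_ab s \<le> b"
  using ab by (auto simp: clamp_ab_def)

lemma clamp_ab_in: "clamp_ab s \<in> {a..b}"
  by simp

lemma clamp_ab_id: "s \<in> {a..b} \<Longrightarrow> clamp_ab s = s"
  by (auto simp: clamp_ab_def)

lemma clamp_ab_cont: "continuous_on UNIV clamp_ab"
  unfolding clamp_ab_def[abs_def] by (intro continuous_intros)

text \<open>\<open>C[a,b]\<close> is realized inside the Banach space of bounded continuous functions on the line, by
  extending functions constantly beyond the end points.\<close>

definition ext :: "(real \<Rightarrow> real) \<Rightarrow> (real \<Rightarrow>\<^sub>C real)" where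
  "ext f = Bcontfun (\<lambda>s. f (clamp_ab s))"

lemma apply_ext:
  assumes "continuous_on {a..b} f"
  shows "apply_bcontfun (ext f) s = f (clamp_ab s)"
proof -
  have "continuous_on UNIV (\<lambda>s. f (clamp_ab s))"
    by (rule continuous_on_compose2[OF assms clamp_ab_cont]) (rule image_subsetI, simp)
  moreover have "bounded (range (\<lambda>s. f (clamp_ab s)))"
    using compact_imp_bounded[OF compact_continuous_image[OF assms compact_Icc]]
    by (rule bounded_subset) (use clamp_ab_in in blast)
  ultimately show ?thesis
    unfolding ext_def by (subst Bcontfun_inverse) (auto simp: bcontfun_def)
qed

lemma norm_ext_le:
  assumes "continuous_on {a..b} f" "\<And>s. s \<in> {a..b} \<Longrightarrow> \<bar>f s\<bar> \<le> M"
  shows "norm (ext f) \<le> M"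
  by (rule norm_bound) (simp add: apply_ext assms)

lemma bcontfun_abs_le: "\<bar>apply_bcontfun v s\<bar> \<le> norm v"
  using norm_bounded[of v s] by simp

definition prim :: "(real \<Rightarrow> real) \<Rightarrow> real \<Rightarrow> real" where
  "prim f s = integral {a..s} f"

lemma prim_deriv:
  "continuous_on {a..b} f \<Longrightarrow> s \<in> {a..b} \<Longrightarrow> (prim f has_real_derivative f s) (at s within {a..b})"
  unfolding prim_def by (rule DERIV_integral_Icc)

lemma prim_cont: "continuous_on {a..b} f \<Longrightarrow> continuous_on {a..b} (prim f)"
  by (rule DERIV_continuous_on, erule prim_deriv)

lemma prim_at_a [simp]: "prim f a = 0"
  by (simp add: prim_def)

definition transferT :: "(real \<Rightarrow>\<^sub>C real) \<Rightarrow> (real \<Rightarrow>\<^sub>C real)" where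
  "transferT v = ext (\<lambda>s. (d s)\<^sup>2 * v (\<delta> s) + (1 - d s)\<^sup>2 * v (s - \<delta> s))"

text \<open>Only a difference of values of the primitive enters, so the constant of integration in w
  is immaterial and K depends on v alone.\<close>

definition transferK :: "(real \<Rightarrow>\<^sub>C real) \<Rightarrow> (real \<Rightarrow>\<^sub>C real)" where
  "transferK v = ext (\<lambda>s. e s * (prim v (\<delta> s) - prim v (s - \<delta> s)))"

lemma apply_T: "transferT v s = (d (clamp_ab s))\<^sup>2 * v (\<delta> (clamp_ab s)) +
    (1 - d (clamp_ab s))\<^sup>2 * v (clamp_ab s - \<delta> (clamp_ab s))"
  unfolding transferT_def by (rule apply_ext) (intro continuous_intros d_cont comp_cont continuous_on_apply_bcontfun)

lemma K_cont: "continuous_on {a..b} g \<Longrightarrow> continuous_on {a..b} (\<lambda>s. e s * (g (\<delta> s) - g (s - \<delta> s)))"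
  by (intro continuous_intros e_cont comp_cont)

lemma apply_K: "transferK v s = e (clamp_ab s) *
    (prim v (\<delta> (clamp_ab s)) - prim v (clamp_ab s - \<delta> (clamp_ab s)))"
  unfolding transferK_def by (rule apply_ext[OF K_cont]) (intro prim_cont continuous_on_apply_bcontfun)

lemma prim_linear:
  assumes "continuous_on {a..b} f" "continuous_on {a..b} g" "s \<in> {a..b}"
  shows "prim (\<lambda>x. f x + g x) s = prim f s + prim g s" "prim (\<lambda>x. c * f x) s = c * prim f s"
proof -
  have "continuous_on {a..s} f" "continuous_on {a..s} g"
    using assms by (auto intro: continuous_on_subset)
  then show "prim (\<lambda>x. f x + g x) s = prim f s + prim g s" "prim (\<lambda>x. c * f x) s = c * prim f s"
    unfolding prim_def by (simp_all add: integral_add integrable_continuous_real)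
qed

lemma linear_T: "linear transferT"
  by (rule linearI) (auto intro!: bcontfun_eqI simp: apply_T algebra_simps)

lemma linear_K: "linear transferK"
proof (rule linearI)
  fix v w :: "real \<Rightarrow>\<^sub>C real" and r :: real
  have sum: "prim (\<lambda>x. v x + w x) s = prim v s + prim w s" if "s \<in> {a..b}" for s
    using that by (intro prim_linear(1) continuous_on_apply_bcontfun)
  show "transferK (v + w) = transferK v + transferK w"
    by (intro bcontfun_eqI)
      (simp add: apply_K sum[OF \<delta>_in[OF clamp_ab_in]] sum[OF co\<delta>_in[OF clamp_ab_in]] algebra_simps)
  have scale: "prim (\<lambda>x. r * v x) s = r * prim v s" if "s \<in> {a..b}" for s
    by (rule prim_linear(2)[OF continuous_on_apply_bcontfun continuous_on_apply_bcontfun that])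
  show "transferK (r *\<^sub>R v) = r *\<^sub>R transferK v"
    by (intro bcontfun_eqI)
      (simp add: apply_K scale[OF \<delta>_in[OF clamp_ab_in]] scale[OF co\<delta>_in[OF clamp_ab_in]] algebra_simps)
qed

lemma T_power_bound:
  "s \<in> {a..b} \<Longrightarrow> \<bar>(transferT ^^ j) v s\<bar> \<le> weight j s * norm v"
proof (induction j arbitrary: s)
  case 0
  then show ?case by (simp add: bcontfun_abs_le)
next
  case (Suc j)
  have "\<bar>(transferT ^^ Suc j) v s\<bar>
      \<le> (d s)\<^sup>2 * \<bar>(transferT ^^ j) v (\<delta> s)\<bar> + (1 - d s)\<^sup>2 * \<bar>(transferT ^^ j) v (s - \<delta> s)\<bar>"
    using abs_triangle_ineq[of "(d s)\<^sup>2 * (transferT ^^ j) v (\<delta> s)"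
        "(1 - d s)\<^sup>2 * (transferT ^^ j) v (s - \<delta> s)"]
    by (simp add: apply_T clamp_ab_id[OF Suc.prems] abs_mult)
  also have "\<dots> \<le> (d s)\<^sup>2 * (weight j (\<delta> s) * norm v) + (1 - d s)\<^sup>2 * (weight j (s - \<delta> s) * norm v)"
    by (intro add_mono mult_left_mono Suc.IH \<delta>_in co\<delta>_in Suc.prems) auto
  finally show ?case by (simp add: algebra_simps)
qed

text \<open>The argument of T may be any bounded continuous function, but its value is constant
  beyond the end points; this turns estimates on the interval into norm estimates.\<close>

lemma T_outside: "transferT v s = transferT v (clamp_ab s)"
  by (simp add: apply_T clamp_ab_id)

lemma norm_T_le: "norm (transferT v) \<le> norm v"
proof (rule norm_bound)
  fix s
  have "\<bar>transferT v (clamp_ab s)\<bar> \<le> weight 1 (clamp_ab s) * norm v"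
    using T_power_bound[of "clamp_ab s" 1 v] by simp
  also have "\<dots> \<le> 1 * norm v"
    by (rule mult_right_mono[OF weight_le_1]) auto
  finally show "norm (transferT v s) \<le> norm v" by (simp add: T_outside[of v s])
qed

lemma prim_lipschitz:
  assumes "x \<in> {a..b}" "y \<in> {a..b}" "\<And>s. s \<in> {a..b} \<Longrightarrow> \<bar>f s\<bar> \<le> M" "continuous_on {a..b} f"
  shows "\<bar>prim f x - prim f y\<bar> \<le> M * \<bar>x - y\<bar>"
proof -
  have "norm (prim f x - prim f y) \<le> M * norm (x - y)"
    by (rule field_differentiable_bound[of "{a..b}" "prim f" f])
      (use assms prim_deriv in auto)
  then show ?thesis by simp
qed

lemma e_bounded: "\<exists>E>0. \<forall>s\<in>{a..b}. \<bar>e s\<bar> \<le> E"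
proof -
  obtain E where "\<forall>s\<in>{a..b}. norm (e s) \<le> E"
    using compact_imp_bounded[OF compact_continuous_image[OF e_cont compact_Icc]]
    unfolding bounded_iff by auto
  then show ?thesis by (intro exI[of _ "max E 1"]) auto
qed

lemma K_bounded: "\<exists>M. \<forall>v. norm (transferK v) \<le> M * norm v"
proof -
  obtain E where E: "E > 0" "\<And>s. s \<in> {a..b} \<Longrightarrow> \<bar>e s\<bar> \<le> E" using e_bounded by blast
  have "norm (transferK v) \<le> (E * (b - a)) * norm v" for v
    unfolding transferK_def
  proof (rule norm_ext_le[OF K_cont[OF prim_cont[OF continuous_on_apply_bcontfun]]])
    fix s assume s: "s \<in> {a..b}"
    have "\<bar>prim v (\<delta> s) - prim v (s - \<delta> s)\<bar> \<le> norm v * \<bar>\<delta> s - (s - \<delta> s)\<bar>"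
      by (rule prim_lipschitz[OF \<delta>_in[OF s] co\<delta>_in[OF s]]) (auto simp: bcontfun_abs_le)
    also have "\<dots> \<le> norm v * (b - a)"
      using \<delta>_in[OF s] co\<delta>_in[OF s] by (intro mult_left_mono) auto
    finally have "\<bar>e s\<bar> * \<bar>prim v (\<delta> s) - prim v (s - \<delta> s)\<bar> \<le> E * (norm v * (b - a))"
      using E(1) by (intro mult_mono E(2) s) auto
    then show "\<bar>e s * (prim v (\<delta> s) - prim v (s - \<delta> s))\<bar> \<le> (E * (b - a)) * norm v"
      by (simp add: abs_mult mult_ac)
  qed
  then show ?thesis by blast
qed

text \<open>Primitives of functions bounded by 1 are 1-Lipschitz and vanish at \<open>a\<close>, so
  Arzela-Ascoli gives a uniformly convergent subsequence. Composition with \<delta> and s - \<delta>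
  and multiplication by the bounded \<open>e\<close> preserve uniform convergence.\<close>

lemma K_compact:
  fixes v :: "nat \<Rightarrow> (real \<Rightarrow>\<^sub>C real)"
  assumes v: "\<And>j. norm (v j) \<le> 1"
  shows "\<exists>r y. strict_mono (r :: nat \<Rightarrow> nat) \<and> (\<lambda>j. transferK (v (r j))) \<longlonglongrightarrow> y"
proof -
  have lip: "\<bar>prim (v j) x - prim (v j) y\<bar> \<le> 1 * \<bar>x - y\<bar>" if "x \<in> {a..b}" "y \<in> {a..b}" for j x y
    by (rule prim_lipschitz[OF that]) (auto intro: order_trans[OF bcontfun_abs_le v])
  obtain g r where g: "continuous_on {a..b} g" "strict_mono (r :: nat \<Rightarrow> nat)"
    "\<And>\<epsilon>. 0 < \<epsilon> \<Longrightarrow> \<exists>N. \<forall>n x. n \<ge> N \<and> x \<in> {a..b} \<longrightarrow> norm (prim (v (r n)) x - g x) < \<epsilon>"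
  proof (rule Arzela_Ascoli[of "{a..b}" "\<lambda>j. prim (v j)" "b - a"])
    show "norm (prim (v n) x) \<le> b - a" if "x \<in> {a..b}" for n x
      using lip[of x a n] that ab by auto
    show "\<exists>d>0. \<forall>n y. y \<in> {a..b} \<and> norm (x - y) < d \<longrightarrow> norm (prim (v n) x - prim (v n) y) < \<epsilon>"
      if "x \<in> {a..b}" "0 < \<epsilon>" for x \<epsilon>
      using lip[OF that(1)] that(2) by (intro exI[of _ \<epsilon>]) (auto intro: order.strict_trans1)
  qed (use that in auto)
  obtain E where E: "E > 0" "\<And>s. s \<in> {a..b} \<Longrightarrow> \<bar>e s\<bar> \<le> E" using e_bounded by blast
  define y where "y = ext (\<lambda>s. e s * (g (\<delta> s) - g (s - \<delta> s)))"
  have "(\<lambda>j. transferK (v (r j))) \<longlonglongrightarrow> y"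
  proof (rule metric_LIMSEQ_I)
    fix \<epsilon> :: real assume "\<epsilon> > 0"
    \<comment> \<open>Two values of the primitive, each with error below \<eta> and multiplied by at
      most E, add up to \<epsilon> / 2.\<close>
    define \<eta> where "\<eta> = \<epsilon> / (4 * E)"
    have "\<eta> > 0" using \<open>\<epsilon> > 0\<close> E by (simp add: \<eta>_def)
    then obtain N where N: "\<And>n x. n \<ge> N \<Longrightarrow> x \<in> {a..b} \<Longrightarrow> \<bar>prim (v (r n)) x - g x\<bar> < \<eta>"
      using g(3)[of \<eta>] by auto
    have "dist (transferK (v (r n))) y < \<epsilon>" if "n \<ge> N" for n
    proof -
      have "norm (transferK (v (r n)) - y) \<le> \<epsilon> / 2"
      proof (rule norm_bound)
        fix s
        let ?s = "clamp_ab s" and ?p = "prim (v (r n))"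
        have "(transferK (v (r n)) - y) s = e ?s * ((?p (\<delta> ?s) - g (\<delta> ?s)) - (?p (?s - \<delta> ?s) - g (?s - \<delta> ?s)))"
          by (simp only: minus_bcontfun.rep_eq apply_K y_def apply_ext[OF K_cont[OF g(1)]])
             (simp add: algebra_simps)
        moreover have "\<bar>(?p (\<delta> ?s) - g (\<delta> ?s)) - (?p (?s - \<delta> ?s) - g (?s - \<delta> ?s))\<bar> \<le> 2 * \<eta>"
          using N[OF that \<delta>_in[of ?s]] N[OF that co\<delta>_in[of ?s]] by auto
        ultimately have "\<bar>(transferK (v (r n)) - y) s\<bar> \<le> E * (2 * \<eta>)"
          using E(1) by (auto simp: abs_mult intro!: mult_mono E(2))
        then show "norm ((transferK (v (r n)) - y) s) \<le> \<epsilon> / 2"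
          using E(1) by (simp add: \<eta>_def)
      qed
      then show ?thesis using \<open>\<epsilon> > 0\<close> by (simp add: dist_norm)
    qed
    then show "\<exists>N. \<forall>n\<ge>N. dist (transferK (v (r n))) y < \<epsilon>" by blast
  qed
  then show ?thesis using g(2) by blast
qed

text \<open>The right-hand side \<open>r\<close> below has to vanish: integrating once more gives a function that
  takes the same value at both ends.\<close>

lemma homogeneous_up_to_const:
  assumes minimal and w: "continuous_on {a..b} w"
    and eq: "\<And>s. s \<in> {a..b} \<Longrightarrow> w s - (d s * w (\<delta> s) + (1 - d s) * w (s - \<delta> s)) = r"
  shows "\<exists>c. \<forall>s\<in>{a..b}. w s = c"
proof -
  define g where "g s = prim w s - prim w (\<delta> s) - prim w (s - \<delta> s)" for s
  have "((\<lambda>s. g s - r * s) has_real_derivative 0) (at s within {a..b})" if s: "s \<in> {a..b}" for s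
    unfolding g_def
    by (rule DERIV_cong[OF DERIV_diff[OF functional_deriv[OF prim_deriv[OF w] s] DERIV_cmult_Id]])
       (use eq[OF s] in auto)
  from DERIV_zero_interval_const[OF this, of b] have "g b - r * b = g a - r * a"
    using ab by auto
  then have "r * (b - a) = 0" by (auto simp: g_def \<delta>_ends algebra_simps)
  then have "r = 0" using ab by auto
  then show ?thesis using maximum_principle[OF \<open>minimal\<close> w] eq by auto
qed

text \<open>An average cannot exceed the maximum of the modulus of w, so at a point where that
  maximum is attained the factor l < 1 forces it to vanish.\<close>

lemma strict_contraction_zero:
  assumes w: "continuous_on {a..b} w" and l: "0 \<le> l" "l < 1"
    and eq: "\<And>s. s \<in> {a..b} \<Longrightarrow> w s = l * (d s * w (\<delta> s) + (1 - d s) * w (s - \<delta> s))"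
    and s: "s \<in> {a..b}"
  shows "w s = 0"
proof -
  obtain s0 where s0: "s0 \<in> {a..b}" "\<And>s. s \<in> {a..b} \<Longrightarrow> \<bar>w s\<bar> \<le> \<bar>w s0\<bar>"
    using continuous_attains_sup[OF compact_Icc _ continuous_on_rabs[OF w]] ab by auto
  let ?p = "d s0 * w (\<delta> s0)" and ?q = "(1 - d s0) * w (s0 - \<delta> s0)"
  have d: "0 \<le> d s0" "d s0 \<le> 1" using d_range[OF s0(1)] by auto
  have "\<bar>?p\<bar> \<le> d s0 * \<bar>w s0\<bar>"
    using mult_left_mono[OF s0(2)[OF \<delta>_in[OF s0(1)]] d(1)] d by (simp add: abs_mult)
  moreover have "\<bar>?q\<bar> \<le> (1 - d s0) * \<bar>w s0\<bar>"
    using mult_left_mono[OF s0(2)[OF co\<delta>_in[OF s0(1)]], of "1 - d s0"] d by (simp add: abs_mult)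
  ultimately have "\<bar>?p + ?q\<bar> \<le> \<bar>w s0\<bar>"
    using abs_triangle_ineq[of ?p ?q] by (simp add: algebra_simps)
  then have "\<bar>w s0\<bar> \<le> l * \<bar>w s0\<bar>"
    using eq[OF s0(1)] mult_left_mono[of "\<bar>?p + ?q\<bar>" "\<bar>w s0\<bar>" l] l by (simp add: abs_mult)
  then have "(1 - l) * \<bar>w s0\<bar> \<le> 0" by (simp add: algebra_simps)
  then have "\<bar>w s0\<bar> \<le> 0" using l by (simp add: mult_le_0_iff)
  then show ?thesis using s0(2)[OF s] by simp
qed

text \<open>Undoing one differentiation gives the averaged equation for w up to a constant r. The
  averaging principles then show that w is constant, and so v = w' = 0.\<close>

lemma transfer_injective:
  assumes minimal and l: "0 \<le> l" "l \<le> 1" and v: "v = l *\<^sub>R (transferT v + transferK v)"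
  shows "v = 0"
proof -
  define w where "w = prim v"
  have wd: "(w has_real_derivative v s) (at s within {a..b})" if "s \<in> {a..b}" for s
    unfolding w_def by (rule prim_deriv[OF continuous_on_apply_bcontfun that])
  have wc: "continuous_on {a..b} w" unfolding w_def by (intro prim_cont continuous_on_apply_bcontfun)
  have vs: "v s = l * (transferT v s + transferK v s)" for s
    using arg_cong[OF v, of "\<lambda>v. apply_bcontfun v s"] by simp
  define r where "r = w a - l * (d a * w (\<delta> a) + (1 - d a) * w (a - \<delta> a))"
  have r: "w s - l * (d s * w (\<delta> s) + (1 - d s) * w (s - \<delta> s)) = r" if s: "s \<in> {a..b}" for s
    unfolding r_def
  proof (rule DERIV_zero_interval_const[OF _ s])
    fix s assume s: "s \<in> {a..b}"
    show "((\<lambda>s. w s - l * (d s * w (\<delta> s) + (1 - d s) * w (s - \<delta> s))) has_real_derivative 0) (at s within {a..b})"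
      by (rule DERIV_cong[OF functional_deriv2[OF wd s]])
         (use vs[of s] s in \<open>auto simp: apply_T apply_K clamp_ab_id w_def\<close>)
  qed
  have "\<exists>c. \<forall>s\<in>{a..b}. w s = c"
  proof (cases "l = 1")
    case True
    then show ?thesis using homogeneous_up_to_const[OF \<open>minimal\<close> wc] r by auto
  next
    case False
    then have l1: "l < 1" using l by auto
    \<comment> \<open>The constant function c solves the equation with right-hand side r, because
      averages of c are c. Subtracting it leaves the homogeneous equation.\<close>
    define c where "c = r / (1 - l)"
    have "c * (1 - l) = r" using l1 by (simp add: c_def)
    then have c: "r = c - l * c" by (simp add: algebra_simps)
    have "w s - c = 0" if "s \<in> {a..b}" for s
    proof (rule strict_contraction_zero[OF _ l(1) l1 _ that])
      show "continuous_on {a..b} (\<lambda>s. w s - c)" by (intro continuous_intros wc)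
      show "w s - c = l * (d s * (w (\<delta> s) - c) + (1 - d s) * (w (s - \<delta> s) - c))"
        if "s \<in> {a..b}" for s
        using r[OF that] c by (simp add: algebra_simps)
    qed
    then show ?thesis by auto
  qed
  then obtain c where c: "\<And>s. s \<in> {a..b} \<Longrightarrow> w s = c" by blast
  have v0: "v s = 0" if s: "s \<in> {a..b}" for s
  proof -
    have "(w has_real_derivative 0) (at s within {a..b})"
      by (rule has_field_derivative_transform_within[OF DERIV_const[of c] zero_less_one s]) (use c in auto)
    then show ?thesis
      using DERIV_within_Icc_unique[OF wd[OF s]] s ab by simp
  qed
  \<comment> \<open>As a multiple of a value of T + K, v is constant beyond the end points, so
    vanishing on the interval is enough.\<close>
  have "v s = v (clamp_ab s)" for s
    using vs[of s] vs[of "clamp_ab s"] by (simp add: apply_T apply_K clamp_ab_id)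
  then show "v = 0" by (intro bcontfun_eqI) (simp add: v0)
qed

lemma transfer_solvable:
  assumes minimal and H: "continuous_on {a..b} H"
  shows "\<exists>v. continuous_on {a..b} v \<and> (\<forall>s\<in>{a..b}.
    v s - ((d s)\<^sup>2 * v (\<delta> s) + (1 - d s)\<^sup>2 * v (s - \<delta> s) + e s * (prim v (\<delta> s) - prim v (s - \<delta> s))) = H s)"
proof -
  obtain N c where N: "c \<ge> 0" "c < 1" "\<And>s. s \<in> {a..b} \<Longrightarrow> weight N s \<le> c"
    using weight_contraction[OF \<open>minimal\<close>] by blast
  have TN: "norm ((transferT ^^ N) v) \<le> c * norm v" for v
  proof (cases N)
    \<comment> \<open>This case is void: \<open>weight 0\<close> is 1, while c < 1. For positive N
      the outermost factor T permits passing to the clamped point.\<close>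
    case 0
    then show ?thesis using N(2) N(3)[of a] ab by simp
  next
    case (Suc j)
    show ?thesis
    proof (rule norm_bound)
      fix s
      have "\<bar>(transferT ^^ N) v s\<bar> = \<bar>(transferT ^^ N) v (clamp_ab s)\<bar>"
        unfolding Suc using T_outside[of "(transferT ^^ j) v" s] by simp
      also have "\<dots> \<le> weight N (clamp_ab s) * norm v"
        by (rule T_power_bound) simp
      also have "\<dots> \<le> c * norm v" by (rule mult_right_mono[OF N(3)]) auto
      finally show "norm ((transferT ^^ N) v s) \<le> c * norm v" by simp
    qed
  qed
  obtain M where M: "\<And>v. norm (transferK v) \<le> M * norm v" using K_bounded by blast
  have "\<exists>v. v - (transferT v + transferK v) = ext H"
    by (rule injective_family_imp_surjective[where T=transferT and K=transferK and N=N and c=c and M=M])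
      (use linear_T norm_T_le TN N(2) linear_K M K_compact transfer_injective[OF \<open>minimal\<close>] in auto)
  then obtain v where v: "v - (transferT v + transferK v) = ext H" by blast
  have "v s - (transferT v s + transferK v s) = H s" if "s \<in> {a..b}" for s
    using arg_cong[OF v, of "\<lambda>v. apply_bcontfun v s"] apply_ext[OF H, of s] clamp_ab_id[OF that]
    by simp
  then show ?thesis
    by (intro exI[of _ "apply_bcontfun v"]) (auto simp: apply_T apply_K clamp_ab_id)
qed

text \<open>Each of the two integrations leaves a constant. At both s = a and s = b the left side of
  the functional equation collapses to - k 0; hence \<open>ends\<close> forces the slope r of the
  error to vanish, and the normalization of k 0 removes the remaining constant.\<close>

theorem functional_equation_solvable:
  assumes minimal
    and G: "\<And>s. s \<in> {a..b} \<Longrightarrow> (G has_real_derivative G' s) (at s within {a..b})"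
    and G': "\<And>s. s \<in> {a..b} \<Longrightarrow> (G' has_real_derivative G'' s) (at s within {a..b})"
    and G'': "continuous_on {a..b} G''" and ends: "G a = G b"
  obtains k w v where
    "\<And>s. s \<in> {a..b} \<Longrightarrow> (k has_real_derivative w s) (at s within {a..b})"
    "\<And>s. s \<in> {a..b} \<Longrightarrow> (w has_real_derivative v s) (at s within {a..b})"
    "continuous_on {a..b} v" "k 0 = - G a"
    "\<And>s. s \<in> {a..b} \<Longrightarrow> k s - k (\<delta> s) - k (s - \<delta> s) = G s"
proof -
  obtain v where v: "continuous_on {a..b} v" "\<And>s. s \<in> {a..b} \<Longrightarrow>
    v s - ((d s)\<^sup>2 * v (\<delta> s) + (1 - d s)\<^sup>2 * v (s - \<delta> s) + e s * (prim v (\<delta> s) - prim v (s - \<delta> s))) = G'' s"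
    using transfer_solvable[OF \<open>minimal\<close> G''] by blast
  define w where "w = prim v"
  have wd: "(w has_real_derivative v s) (at s within {a..b})" if "s \<in> {a..b}" for s
    unfolding w_def by (rule prim_deriv[OF v(1) that])
  have wc: "continuous_on {a..b} w" by (rule DERIV_continuous_on[OF wd])
  define k where "k s = prim w s - prim w 0 - G a" for s
  have kd: "(k has_real_derivative w s) (at s within {a..b})" if "s \<in> {a..b}" for s
    unfolding k_def[abs_def]
    using DERIV_diff[OF DERIV_diff[OF prim_deriv[OF wc that] DERIV_const] DERIV_const] by simp
  define r where "r = w a - 1 * (d a * w (\<delta> a) + (1 - d a) * w (a - \<delta> a)) - G' a"
  have r: "w s - 1 * (d s * w (\<delta> s) + (1 - d s) * w (s - \<delta> s)) - G' s = r" if s: "s \<in> {a..b}" for s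
    unfolding r_def
  proof (rule DERIV_zero_interval_const[OF _ s])
    fix s assume s: "s \<in> {a..b}"
    show "((\<lambda>s. w s - 1 * (d s * w (\<delta> s) + (1 - d s) * w (s - \<delta> s)) - G' s) has_real_derivative 0)
        (at s within {a..b})"
      by (rule DERIV_cong[OF DERIV_diff[OF functional_deriv2[OF wd s] G'[OF s]]])
         (use v(2)[OF s] in \<open>auto simp: w_def\<close>)
  qed
  define g where "g s = k s - k (\<delta> s) - k (s - \<delta> s) - G s - r * s" for s
  have gd: "(g has_real_derivative 0) (at s within {a..b})" if s: "s \<in> {a..b}" for s
    unfolding g_def[abs_def]
    by (rule DERIV_cong[OF DERIV_diff[OF DERIV_diff[OF functional_deriv[OF kd s] G[OF s]] DERIV_cmult_Id]])
       (use r[OF s] in auto)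
  have gc: "g s = g a" if "s \<in> {a..b}" for s
    by (rule DERIV_zero_interval_const[OF gd that])
  have "g b = g a" using gc[of b] ab by auto
  then have "r * (b - a) = 0" using ends by (auto simp: g_def \<delta>_ends algebra_simps)
  then have "r = 0" using ab by auto
  moreover have k0: "k 0 = - G a" by (simp add: k_def)
  ultimately have "k s - k (\<delta> s) - k (s - \<delta> s) = G s" if "s \<in> {a..b}" for s
    using gc[OF that] by (simp add: g_def \<delta>_ends)
  then show thesis using that[OF kd wd v(1) k0] by blast
qed

end

subsection \<open>Integration by parts against compactly supported functions\<close>

text \<open>\<open>U\<close> and the complement of \<open>K\<close> form an open cover, and on the
  latter the function is identically 0. The behaviour of \<open>r\<close> near the frontier of
  \<open>U\<close> thus never matters.\<close>

lemma zero_extension_continuous: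
  fixes r \<psi> :: "'a::t2_space \<Rightarrow> real"
  assumes "open U" "compact K" "K \<subseteq> U" "continuous_on U r" "continuous_on UNIV \<psi>"
    and "\<And>p. p \<notin> K \<Longrightarrow> \<psi> p = 0"
  shows "continuous_on UNIV (\<lambda>p. if p \<in> U then r p * \<psi> p else 0)"
proof -
  have "continuous_on (U \<union> - K) (\<lambda>p. if p \<in> U then r p * \<psi> p else 0)"
  proof (rule continuous_on_open_Un)
    show "open U" "open (- K)" using assms by (auto simp: compact_imp_closed)
    have "continuous_on U (\<lambda>p. r p * \<psi> p)"
      by (intro continuous_intros assms continuous_on_subset[OF assms(5)]) auto
    then show "continuous_on U (\<lambda>p. if p \<in> U then r p * \<psi> p else 0)"
      by (rule continuous_on_eq) auto
    show "continuous_on (- K) (\<lambda>p. if p \<in> U then r p * \<psi> p else 0)"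
      by (rule continuous_on_eq[OF continuous_on_const[of _ 0]]) (use assms(6) in auto)
  qed
  moreover have "U \<union> - K = UNIV" using assms(3) by auto
  ultimately show ?thesis by simp
qed

text \<open>A passage from Lebesgue integrals over \<open>U\<close> to gauge integrals over a box,
  where the Fubini rules for continuous integrands and the fundamental theorem of calculus can be
  applied.\<close>

lemma set_lebesgue_integral_box:
  fixes f :: "'a::euclidean_space \<Rightarrow> real"
  assumes f: "continuous_on UNIV (\<lambda>p. if p \<in> U then f p else 0)"
    and box: "\<And>p. p \<in> U \<Longrightarrow> p \<notin> cbox l u \<Longrightarrow> f p = 0"
  shows "set_integrable lborel U f"
    and "(LINT p:U|lborel. f p) = integral (cbox l u) (\<lambda>p. if p \<in> U then f p else 0)"
proof -
  let ?Q = "\<lambda>p. if p \<in> U then f p else 0"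
  have Q: "set_integrable lborel (cbox l u) ?Q"
    unfolding set_integrable_def
    by (rule borel_integrable_compact[OF compact_cbox]) (rule continuous_on_subset[OF f subset_UNIV])
  have eq: "(\<lambda>p. indicator (cbox l u) p *\<^sub>R ?Q p) = (\<lambda>p. indicator U p *\<^sub>R f p)"
    using box by (auto simp: fun_eq_iff indicator_def)
  show "set_integrable lborel U f"
    using Q unfolding set_integrable_def eq .
  show "(LINT p:U|lborel. f p) = integral (cbox l u) ?Q"
    using set_borel_integral_eq_integral(2)[OF Q] unfolding set_lebesgue_integral_def eq .
qed

lemma test_product_integrable:
  fixes r \<psi> :: "'a::euclidean_space \<Rightarrow> real"
  assumes "open U" "compact K" "K \<subseteq> U" "continuous_on U r" "continuous_on UNIV \<psi>"
    and "\<And>p. p \<notin> K \<Longrightarrow> \<psi> p = 0"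
  shows "set_integrable lborel U (\<lambda>p. r p * \<psi> p)"
proof -
  obtain l u where "K \<subseteq> cbox l u"
    using bounded_subset_cbox_symmetric[OF compact_imp_bounded[OF assms(2)]] by blast
  then show ?thesis
    by (intro set_lebesgue_integral_box(1)[OF zero_extension_continuous[OF assms]]) (use assms(6) in auto)
qed

lemma DERIV_zero_off_closed:
  fixes f :: "real \<Rightarrow> real"
  assumes "open S" "x \<in> S" "\<And>t. t \<in> S \<Longrightarrow> f t = 0"
  shows "(f has_real_derivative 0) (at x)"
  by (rule has_field_derivative_transform_within_open[OF DERIV_const[of 0] assms(1,2)]) (use assms(3) in auto)

lemma open_slices:
  fixes S :: "(real \<times> real) set"
  assumes "open S"
  shows "open {t. (t, y) \<in> S}" "open {t. (x, t) \<in> S}"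
  using continuous_open_vimage[OF assms, of "\<lambda>t. (t, y)"] continuous_open_vimage[OF assms, of "\<lambda>t. (x, t)"]
  by (auto simp: vimage_def intro!: continuous_intros)

lemma partial_zero_off_closed:
  fixes \<psi> :: "real \<times> real \<Rightarrow> real"
  assumes "closed K" "\<And>p. p \<notin> K \<Longrightarrow> \<psi> p = 0" "(x, y) \<notin> K"
  shows "((\<lambda>t. \<psi> (t, y)) has_real_derivative 0) (at x)" "((\<lambda>t. \<psi> (x, t)) has_real_derivative 0) (at y)"
proof -
  have "open (- K)" using assms(1) by auto
  from open_slices[OF this]
  show "((\<lambda>t. \<psi> (t, y)) has_real_derivative 0) (at x)" "((\<lambda>t. \<psi> (x, t)) has_real_derivative 0) (at y)"
    using assms
    by (auto intro: DERIV_zero_off_closed[where S="{t. (t, y) \<in> - K}"]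
        DERIV_zero_off_closed[where S="{t. (x, t) \<in> - K}"])
qed

lemma integral_derivative_zero:
  fixes f :: "real \<Rightarrow> real"
  assumes "\<And>t. (f has_real_derivative f' t) (at t)" "f (- c) = 0" "f c = 0" "c \<ge> 0"
  shows "integral {- c..c} f' = 0"
  using fundamental_theorem_of_calculus[of "- c" c f f'] assms
  by (auto simp: has_real_derivative_iff_has_vector_derivative intro: has_vector_derivative_at_within)

text \<open>The product extended by zero is differentiable in the chosen direction on the whole
  plane, and its derivative integrates to 0 along each line of a large box. The disjunction covers
  the two coordinate directions.\<close>

lemma integration_by_parts:
  fixes r r' \<psi> \<psi>' :: "real \<times> real \<Rightarrow> real"
  assumes U: "open U" "compact K" "K \<subseteq> U" "continuous_on U r" "continuous_on UNIV \<psi>"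
    and z: "\<And>p. p \<notin> K \<Longrightarrow> \<psi> p = 0"
    and c: "continuous_on U r'" "continuous_on UNIV \<psi>'"
    and d: "(\<forall>x y. (x, y) \<in> U \<longrightarrow> ((\<lambda>t. r (t, y)) has_real_derivative r' (x, y)) (at x)) \<and>
        (\<forall>x y. ((\<lambda>t. \<psi> (t, y)) has_real_derivative \<psi>' (x, y)) (at x)) \<or>
      (\<forall>x y. (x, y) \<in> U \<longrightarrow> ((\<lambda>t. r (x, t)) has_real_derivative r' (x, y)) (at y)) \<and>
        (\<forall>x y. ((\<lambda>t. \<psi> (x, t)) has_real_derivative \<psi>' (x, y)) (at y))"
  shows "(LINT p:U|lborel. r p * \<psi>' p) = - (LINT p:U|lborel. r' p * \<psi> p)"
proof -
  note K = compact_imp_closed[OF U(2)]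
  have z': "\<psi>' p = 0" if "p \<notin> K" for p
  proof -
    obtain x y where p: "p = (x, y)" by (cases p)
    note 0 = partial_zero_off_closed[where \<psi>=\<psi>, OF K z that[unfolded p]]
    from d show ?thesis
    proof (elim disjE conjE)
      assume "\<forall>x y. ((\<lambda>t. \<psi> (t, y)) has_real_derivative \<psi>' (x, y)) (at x)"
      then show ?thesis using DERIV_unique[OF _ 0(1)] p by blast
    next
      assume "\<forall>x y. ((\<lambda>t. \<psi> (x, t)) has_real_derivative \<psi>' (x, y)) (at y)"
      then show ?thesis using DERIV_unique[OF _ 0(2)] p by blast
    qed
  qed
  define P where "P p = (if p \<in> U then r p * \<psi> p else 0)" for p
  define Q where "Q p = (if p \<in> U then r p * \<psi>' p + r' p * \<psi> p else 0)" for p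
  have Qc: "continuous_on UNIV Q"
  proof -
    have "continuous_on UNIV (\<lambda>p. (if p \<in> U then r p * \<psi>' p else 0) + (if p \<in> U then r' p * \<psi> p else 0))"
      by (intro continuous_on_add zero_extension_continuous[OF U(1-3)] U c z z')
    then show ?thesis unfolding Q_def by (rule continuous_on_eq) auto
  qed
  \<comment> \<open>All norms in \<open>K\<close> are strictly below B, so the product vanishes on
    the faces of the box, where the fundamental theorem is evaluated.\<close>
  obtain B where B: "\<And>p. p \<in> K \<Longrightarrow> norm p < B" "B > 0"
    using compact_imp_bounded[OF U(2)] unfolding bounded_pos_less by blast
  have off: "p \<notin> K" if "\<bar>fst p\<bar> \<ge> B \<or> \<bar>snd p\<bar> \<ge> B" for p
    using B(1)[of p] norm_fst_le[of "fst p" "snd p"] norm_snd_le[of "snd p" "fst p"] that by auto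
  let ?box = "cbox (- B, - B) (B, B)"
  have box: "(x, y) \<in> ?box \<longleftrightarrow> \<bar>x\<bar> \<le> B \<and> \<bar>y\<bar> \<le> B" for x y
    by (auto simp: cbox_Pair_eq)
  have "integral ?box Q = 0"
    using d
  proof (elim disjE conjE)
    assume d: "\<forall>x y. (x, y) \<in> U \<longrightarrow> ((\<lambda>t. r (t, y)) has_real_derivative r' (x, y)) (at x)"
      "\<forall>x y. ((\<lambda>t. \<psi> (t, y)) has_real_derivative \<psi>' (x, y)) (at x)"
    have P: "((\<lambda>t. P (t, y)) has_real_derivative Q (x, y)) (at x)" for x y
    proof (cases "(x, y) \<in> U")
      case True
      have "((\<lambda>t. r (t, y) * \<psi> (t, y)) has_real_derivative Q (x, y)) (at x)"
        using DERIV_mult[OF d(1)[rule_format, OF True] d(2)[rule_format, of y x]] True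
        by (simp add: Q_def algebra_simps)
      then show ?thesis
        by (rule has_field_derivative_transform_within_open[OF _ open_slices(1)[OF U(1), of y]])
           (use True in \<open>auto simp: P_def\<close>)
    next
      case False
      then have "(x, y) \<notin> K" using U by auto
      then have "((\<lambda>t. P (t, y)) has_real_derivative 0) (at x)"
        by (intro partial_zero_off_closed(1)[OF K]) (auto simp: P_def z)
      then show ?thesis using False by (simp add: Q_def)
    qed
    have "integral ?box Q = integral (cbox (- B) B) (\<lambda>x. integral (cbox (- B) B) (\<lambda>y. Q (x, y)))"
      by (rule integral_prod_continuous) (rule continuous_on_subset[OF Qc subset_UNIV])
    \<comment> \<open>The order is exchanged so that the inner integral runs in the direction of
      differentiation.\<close>
    also have "\<dots> = integral (cbox (- B) B) (\<lambda>y. integral (cbox (- B) B) (\<lambda>x. Q (x, y)))"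
      by (rule integral_swap_continuous) (simp add: continuous_on_subset[OF Qc subset_UNIV])
    also have "\<dots> = integral (cbox (- B) B) (\<lambda>y. 0)"
      by (rule arg_cong[where f="integral _"], rule ext, unfold box_real,
          rule integral_derivative_zero[OF P]) (use off B in \<open>auto simp: P_def z\<close>)
    finally show ?thesis by simp
  next
    assume d: "\<forall>x y. (x, y) \<in> U \<longrightarrow> ((\<lambda>t. r (x, t)) has_real_derivative r' (x, y)) (at y)"
      "\<forall>x y. ((\<lambda>t. \<psi> (x, t)) has_real_derivative \<psi>' (x, y)) (at y)"
    have P: "((\<lambda>t. P (x, t)) has_real_derivative Q (x, y)) (at y)" for x y
    proof (cases "(x, y) \<in> U")
      case True
      have "((\<lambda>t. r (x, t) * \<psi> (x, t)) has_real_derivative Q (x, y)) (at y)"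
        using DERIV_mult[OF d(1)[rule_format, OF True] d(2)[rule_format, of x y]] True
        by (simp add: Q_def algebra_simps)
      then show ?thesis
        by (rule has_field_derivative_transform_within_open[OF _ open_slices(2)[OF U(1), of x]])
           (use True in \<open>auto simp: P_def\<close>)
    next
      case False
      then have "(x, y) \<notin> K" using U by auto
      then have "((\<lambda>t. P (x, t)) has_real_derivative 0) (at y)"
        by (intro partial_zero_off_closed(2)[OF K]) (auto simp: P_def z)
      then show ?thesis using False by (simp add: Q_def)
    qed
    have "integral ?box Q = integral (cbox (- B) B) (\<lambda>x. integral (cbox (- B) B) (\<lambda>y. Q (x, y)))"
      by (rule integral_prod_continuous) (rule continuous_on_subset[OF Qc subset_UNIV])
    also have "\<dots> = integral (cbox (- B) B) (\<lambda>y. 0)"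
      by (rule arg_cong[where f="integral _"], rule ext, unfold box_real,
          rule integral_derivative_zero[OF P]) (use off B in \<open>auto simp: P_def z\<close>)
    finally show ?thesis by simp
  qed
  moreover have "(LINT p:U|lborel. r p * \<psi>' p + r' p * \<psi> p) = integral ?box Q"
    unfolding Q_def
  proof (rule set_lebesgue_integral_box(2)[OF Qc[unfolded Q_def]])
    fix p assume "p \<notin> ?box"
    then have "p \<notin> K" using off[of p] box[of "fst p" "snd p"] by force
    then show "r p * \<psi>' p + r' p * \<psi> p = 0" using z z' by simp
  qed
  moreover have "(LINT p:U|lborel. r p * \<psi>' p + r' p * \<psi> p)
      = (LINT p:U|lborel. r p * \<psi>' p) + (LINT p:U|lborel. r' p * \<psi> p)"
    by (intro set_integral_add(2) test_product_integrable[OF U(1-3)] U c z z')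
  ultimately show ?thesis by simp
qed

section \<open>Test functions and the weak equation\<close>

lemma smooth_partials:
  assumes "\<And>k. C_diff_upto k UNIV UNIV \<phi>"
  shows "\<And>k. C_diff_upto k UNIV UNIV (partial_x \<phi>)" "\<And>k. C_diff_upto k UNIV UNIV (partial_y \<phi>)"
    "((\<lambda>t. \<phi> (t, y)) has_real_derivative partial_x \<phi> (x, y)) (at x)"
    "((\<lambda>t. \<phi> (x, t)) has_real_derivative partial_y \<phi> (x, y)) (at y)"
    "continuous_on UNIV \<phi>"
proof -
  have *: "C_diff_upto k UNIV UNIV (partial_x \<phi>) \<and> C_diff_upto k UNIV UNIV (partial_y \<phi>) \<and>
    (\<forall>x y. ((\<lambda>t. \<phi> (t, y)) has_real_derivative partial_x \<phi> (x, y)) (at x) \<and>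
      ((\<lambda>t. \<phi> (x, t)) has_real_derivative partial_y \<phi> (x, y)) (at y))" for k
  proof -
    obtain f1 f2 where f: "\<And>x y. ((\<lambda>t. \<phi> (t, y)) has_real_derivative f1 (x, y)) (at x)"
      "\<And>x y. ((\<lambda>t. \<phi> (x, t)) has_real_derivative f2 (x, y)) (at y)"
      "C_diff_upto k UNIV UNIV f1" "C_diff_upto k UNIV UNIV f2"
      using assms[of "Suc k"] by auto
    have "partial_x \<phi> = f1" "partial_y \<phi> = f2"
      using DERIV_imp_deriv[OF f(1)] DERIV_imp_deriv[OF f(2)]
      by (auto simp: partial_x_def partial_y_def fun_eq_iff)
    then show ?thesis using f by simp
  qed
  then show "\<And>k. C_diff_upto k UNIV UNIV (partial_x \<phi>)" "\<And>k. C_diff_upto k UNIV UNIV (partial_y \<phi>)"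
    "((\<lambda>t. \<phi> (t, y)) has_real_derivative partial_x \<phi> (x, y)) (at x)"
    "((\<lambda>t. \<phi> (x, t)) has_real_derivative partial_y \<phi> (x, y)) (at y)" by blast+
  show "continuous_on UNIV \<phi>" using assms[of 0] by simp
qed

lemma partials_zero_off_closed:
  assumes "closed K" "\<And>p. p \<notin> K \<Longrightarrow> \<phi> p = 0" "p \<notin> K"
  shows "partial_x \<phi> p = 0" "partial_y \<phi> p = 0"
  using partial_zero_off_closed[where \<psi>=\<phi> and x="fst p" and y="snd p", OF assms(1,2)] assms(3)
  by (auto simp: partial_x_def partial_y_def case_prod_beta dest: DERIV_imp_deriv)

lemma test_function_support:
  assumes "test_function U \<phi>"
  obtains K where "compact K" "K \<subseteq> U" "\<And>p. p \<notin> K \<Longrightarrow> \<phi> p = 0"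
proof (rule that)
  show "compact (closure {p. \<phi> p \<noteq> 0})" "closure {p. \<phi> p \<noteq> 0} \<subseteq> U"
    using assms by (auto simp: test_function_def)
  show "p \<notin> closure {p. \<phi> p \<noteq> 0} \<Longrightarrow> \<phi> p = 0" for p
    using closure_subset[of "{p. \<phi> p \<noteq> 0}"] by auto
qed

text \<open>Only the factor m d/dx + n d/dy is moved onto u. The result serves both directions: it
  isolates V for a given solution, and it verifies the weak equation for sums of plane
  waves.\<close>

lemma weak_form_first_order:
  assumes U: "open U" and \<phi>: "test_function U \<phi>"
    and u: "continuous_on U u" "continuous_on U u1" "continuous_on U u2"
    and d: "\<And>x y. (x, y) \<in> U \<Longrightarrow> ((\<lambda>t. u (t, y)) has_real_derivative u1 (x, y)) (at x)"
      "\<And>x y. (x, y) \<in> U \<Longrightarrow> ((\<lambda>t. u (x, t)) has_real_derivative u2 (x, y)) (at y)"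
  shows "- (LINT p:U|lborel. u p * third_order_op m n \<phi> p) =
    (LINT p:U|lborel. (m * u1 p + n * u2 p) * partial_x (partial_y \<phi>) p)"
proof -
  obtain K where K: "compact K" "K \<subseteq> U" "\<And>p. p \<notin> K \<Longrightarrow> \<phi> p = 0"
    using test_function_support[OF \<phi>] by metis
  note cl = compact_imp_closed[OF K(1)]
  define \<theta> where "\<theta> = partial_x (partial_y \<phi>)"
  have \<theta>0: "\<theta> p = 0" if "p \<notin> K" for p
    unfolding \<theta>_def by (intro partials_zero_off_closed[OF cl] K that)
  have \<phi>s: "\<And>k. C_diff_upto k UNIV UNIV \<phi>" using \<phi> by (simp add: test_function_def)
  have \<theta>s: "\<And>k. C_diff_upto k UNIV UNIV \<theta>"
    unfolding \<theta>_def by (intro smooth_partials(1,2) \<phi>s)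
  note s = smooth_partials[OF \<theta>s]
  note c = smooth_partials(5)[OF s(1)] smooth_partials(5)[OF s(2)]
  have 0: "partial_x \<theta> p = 0" "partial_y \<theta> p = 0" if "p \<notin> K" for p
    by (rule partials_zero_off_closed[OF cl \<theta>0 that]; assumption)+
  have ix: "(LINT p:U|lborel. u p * partial_x \<theta> p) = - (LINT p:U|lborel. u1 p * \<theta> p)"
    by (rule integration_by_parts[OF U K(1,2) u(1) s(5) \<theta>0 u(2) c(1)]) (use d s in auto)
  have iy: "(LINT p:U|lborel. u p * partial_y \<theta> p) = - (LINT p:U|lborel. u2 p * \<theta> p)"
    by (rule integration_by_parts[OF U K(1,2) u(1) s(5) \<theta>0 u(3) c(2)]) (use d s in auto)
  note int = test_product_integrable[OF U K(1,2)]
  have I: "set_integrable lborel U (\<lambda>p. u p * partial_x \<theta> p)" "set_integrable lborel U (\<lambda>p. u p * partial_y \<theta> p)"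
    "set_integrable lborel U (\<lambda>p. u1 p * \<theta> p)" "set_integrable lborel U (\<lambda>p. u2 p * \<theta> p)"
    using int[OF u(1) c(1) 0(1)] int[OF u(1) c(2) 0(2)] int[OF u(2) s(5) \<theta>0] int[OF u(3) s(5) \<theta>0]
    by blast+
  have "(LINT p:U|lborel. u p * third_order_op m n \<phi> p) =
    (LINT p:U|lborel. m * (u p * partial_x \<theta> p) + n * (u p * partial_y \<theta> p))"
    by (simp add: third_order_op_def \<theta>_def algebra_simps)
  also have "\<dots> = m * (LINT p:U|lborel. u p * partial_x \<theta> p) + n * (LINT p:U|lborel. u p * partial_y \<theta> p)"
    using I by simp
  also have "\<dots> = - (m * (LINT p:U|lborel. u1 p * \<theta> p) + n * (LINT p:U|lborel. u2 p * \<theta> p))"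
    by (simp add: ix iy)
  also have "m * (LINT p:U|lborel. u1 p * \<theta> p) + n * (LINT p:U|lborel. u2 p * \<theta> p) =
    (LINT p:U|lborel. m * (u1 p * \<theta> p) + n * (u2 p * \<theta> p))"
    using I by simp
  finally show ?thesis by (simp add: \<theta>_def algebra_simps)
qed

text \<open>The x-derivative is outermost in \<open>partial_x (partial_y \<phi>)\<close>. It
  annihilates B(y) at once, but for A(x) it has to be moved first, which produces A'(x), before the
  y-derivative can be integrated away.\<close>

lemma separated_weak_mixed_derivative_zero:
  assumes U: "open U" and \<phi>: "test_function U \<phi>"
    and c: "continuous_on U (\<lambda>(x, y). A x)" "continuous_on U (\<lambda>(x, y). A' x)" "continuous_on U (\<lambda>(x, y). B y)"
    and d: "\<And>x y. (x, y) \<in> U \<Longrightarrow> (A has_real_derivative A' x) (at x)"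
  shows "(LINT p:U|lborel. (A (fst p) + B (snd p)) * partial_x (partial_y \<phi>) p) = 0"
proof -
  obtain K where K: "compact K" "K \<subseteq> U" "\<And>p. p \<notin> K \<Longrightarrow> \<phi> p = 0"
    using test_function_support[OF \<phi>] by metis
  note cl = compact_imp_closed[OF K(1)]
  have \<phi>s: "\<And>k. C_diff_upto k UNIV UNIV \<phi>" using \<phi> by (simp add: test_function_def)
  note s = smooth_partials[OF \<phi>s]
  note sy = smooth_partials[OF s(2)]
  note sxy = smooth_partials[OF sy(1)]
  have 0: "partial_y \<phi> p = 0" if "p \<notin> K" for p
    by (intro partials_zero_off_closed[OF cl] K that)
  have 00: "partial_x (partial_y \<phi>) p = 0" if "p \<notin> K" for p
    by (intro partials_zero_off_closed[OF cl] 0 that)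
  have cA: "continuous_on U (\<lambda>p. A (fst p))" and cA': "continuous_on U (\<lambda>p. A' (fst p))"
    and cB: "continuous_on U (\<lambda>p. B (snd p))" using c by (simp_all add: case_prod_beta')
  have "(LINT p:U|lborel. B (snd p) * partial_x (partial_y \<phi>) p) = - (LINT p:U|lborel. 0 * partial_y \<phi> p)"
    by (rule integration_by_parts[OF U K(1,2) cB sy(5) 0 continuous_on_const sxy(5)]) (use sy in auto)
  then have IB: "(LINT p:U|lborel. B (snd p) * partial_x (partial_y \<phi>) p) = 0" by simp
  have "(LINT p:U|lborel. A' (fst p) * partial_y \<phi> p) = - (LINT p:U|lborel. 0 * \<phi> p)"
    by (rule integration_by_parts[OF U K(1,2) cA' s(5) K(3) continuous_on_const sy(5)]) (use s in auto)
  moreover have "(LINT p:U|lborel. A (fst p) * partial_x (partial_y \<phi>) p) = - (LINT p:U|lborel. A' (fst p) * partial_y \<phi> p)"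
    by (rule integration_by_parts[OF U K(1,2) cA sy(5) 0 cA' sxy(5)]) (use sy d in auto)
  ultimately have IA: "(LINT p:U|lborel. A (fst p) * partial_x (partial_y \<phi>) p) = 0" by simp
  have "(LINT p:U|lborel. A (fst p) * partial_x (partial_y \<phi>) p + B (snd p) * partial_x (partial_y \<phi>) p) = 0"
    by (subst set_integral_add) (auto simp: IA IB intro!: test_product_integrable[OF U K(1,2)] cA cB sxy(5) 00)
  then show ?thesis by (simp add: algebra_simps)
qed

subsection \<open>Smooth bump functions and the rectangle identity\<close>

text \<open>The derivative of x^(-k) exp(-1/x) is a combination of functions of the same form. The
  whole family is carried along so that smoothness at 0 needs only first derivatives.\<close>

definition flat :: "nat \<Rightarrow> real \<Rightarrow> real" where
  "flat k x = (if x > 0 then (1 / x) ^ k * exp (- 1 / x) else 0)"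

lemma flat_tendsto_0: "(flat k \<longlongrightarrow> 0) (at_right 0)"
proof -
  have "((\<lambda>x. (inverse x) ^ k / exp (inverse x)) \<longlongrightarrow> (0 :: real)) (at_right 0)"
    by (rule filterlim_compose[OF tendsto_power_div_exp_0 filterlim_inverse_at_top_right])
  then show ?thesis
    by (rule Lim_transform_eventually)
       (auto simp: flat_def eventually_at_filter exp_minus divide_inverse)
qed

lemma flat_deriv: "(flat k has_real_derivative flat (k + 2) x - real k * flat (Suc k) x) (at x)"
proof (cases x "0 :: real" rule: linorder_cases)
  case less
  have "(flat k has_real_derivative 0) (at x)"
    by (rule DERIV_zero_off_closed[of "{..<0}"]) (use less in \<open>auto simp: flat_def\<close>)
  then show ?thesis using less by (simp add: flat_def)
next
  case equal
  \<comment> \<open>On the right of 0 the difference quotient of \<open>flat k\<close> is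
    \<open>flat (Suc k)\<close>, which tends to 0.\<close>
  have "((\<lambda>h. flat k h / h) \<longlongrightarrow> 0) (at_right 0)"
    by (rule Lim_transform_eventually[OF flat_tendsto_0[of "Suc k"]])
       (auto simp: flat_def eventually_at_filter)
  moreover have "((\<lambda>h. flat k h / h) \<longlongrightarrow> 0) (at_left 0)"
    by (rule Lim_transform_eventually[OF tendsto_const[of 0]])
       (auto simp: flat_def eventually_at_filter)
  ultimately have "((\<lambda>h. flat k h / h) \<longlongrightarrow> 0) (at 0)"
    by (simp add: filterlim_split_at)
  then show ?thesis
    using equal by (simp add: DERIV_def flat_def)
next
  case greater
  have "((\<lambda>x. (1 / x) ^ k * exp (- 1 / x)) has_real_derivative flat (k + 2) x - real k * flat (Suc k) x) (at x)"
  proof -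
    have inv: "((\<lambda>x. 1 / x) has_real_derivative - (1 / x)\<^sup>2) (at x)"
      using greater by (auto intro!: derivative_eq_intros simp: power2_eq_square)
    have e: "((\<lambda>x. exp (- 1 / x)) has_real_derivative exp (- 1 / x) * (1 / x)\<^sup>2) (at x)"
      using greater by (auto intro!: derivative_eq_intros simp: power2_eq_square)
    show ?thesis
    proof (cases k)
      case 0
      then show ?thesis using e greater by (simp add: flat_def power2_eq_square)
    next
      case (Suc j)
      show ?thesis
        unfolding Suc using greater
        by (intro DERIV_cong[OF DERIV_mult[OF DERIV_power_Suc[OF inv] e]])
           (simp add: flat_def power2_eq_square algebra_simps)
    qed
  qed
  then show ?thesis
    by (rule has_field_derivative_transform_within_open[of _ _ _ "{0<..}"])
       (use greater in \<open>auto simp: flat_def\<close>)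
qed

text \<open>A class closed under differentiation: membership certifies derivatives of every order,
  with only one derivative treated at a time.\<close>

inductive elem_smooth :: "(real \<Rightarrow> real) \<Rightarrow> bool" where
  flat: "elem_smooth (flat k)"
| const: "elem_smooth (\<lambda>_. c)"
| add: "elem_smooth f \<Longrightarrow> elem_smooth g \<Longrightarrow> elem_smooth (\<lambda>x. f x + g x)"
| mult: "elem_smooth f \<Longrightarrow> elem_smooth g \<Longrightarrow> elem_smooth (\<lambda>x. f x * g x)"
| affine: "elem_smooth f \<Longrightarrow> elem_smooth (\<lambda>x. f (c * x + e))"
| antideriv: "elem_smooth f \<Longrightarrow> (\<And>x. (F has_real_derivative f x) (at x)) \<Longrightarrow> elem_smooth F"

lemma elem_smooth_deriv:
  assumes "elem_smooth f"
  shows "\<exists>f'. elem_smooth f' \<and> (\<forall>x. (f has_real_derivative f' x) (at x))"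
  using assms
proof induction
  case (flat k)
  have "elem_smooth (\<lambda>x. flat (k + 2) x + (- real k) * flat (Suc k) x)"
    by (intro elem_smooth.add elem_smooth.mult elem_smooth.flat elem_smooth.const)
  then show ?case
    by (rule exI[of _ "\<lambda>x. flat (k + 2) x + (- real k) * flat (Suc k) x", OF conjI])
       (use flat_deriv[of k] in simp)
next
  case (const c)
  show ?case by (intro exI[of _ "\<lambda>_. 0"]) (auto intro: elem_smooth.const)
next
  case (add f g)
  then obtain f' g' where "elem_smooth f'" "elem_smooth g'"
    "\<forall>x. (f has_real_derivative f' x) (at x)" "\<forall>x. (g has_real_derivative g' x) (at x)" by blast
  then show ?case
    by (intro exI[of _ "\<lambda>x. f' x + g' x"]) (auto intro: elem_smooth.add DERIV_add)
next
  case (mult f g)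
  then obtain f' g' where *: "elem_smooth f'" "elem_smooth g'"
    "\<forall>x. (f has_real_derivative f' x) (at x)" "\<forall>x. (g has_real_derivative g' x) (at x)" by blast
  have "elem_smooth (\<lambda>x. f' x * g x + g' x * f x)"
    by (intro elem_smooth.add elem_smooth.mult * mult.hyps)
  then show ?case
    using DERIV_mult[OF *(3)[rule_format] *(4)[rule_format]] by blast
next
  case (affine f c e)
  then obtain f' where *: "elem_smooth f'" "\<And>x. (f has_real_derivative f' x) (at x)" by blast
  have "((\<lambda>x. f (c * x + e)) has_real_derivative f' (c * x + e) * c) (at x)" for x
    by (rule DERIV_chain2[OF *(2)]) (auto intro!: derivative_eq_intros)
  moreover have "elem_smooth (\<lambda>x. f' (c * x + e) * c)"
    by (rule elem_smooth.mult[OF elem_smooth.affine[OF *(1)] elem_smooth.const])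
  ultimately show ?case by blast
qed blast

lemma elem_smooth_cont: "elem_smooth f \<Longrightarrow> continuous_on A f"
  using elem_smooth_deriv[of f] by (meson DERIV_continuous_on has_field_derivative_at_within)

lemma tensor_cont:
  assumes "elem_smooth f" "elem_smooth g"
  shows "continuous_on A (\<lambda>p :: real \<times> real. f (fst p) * g (snd p))"
  by (rule continuous_on_mult[OF continuous_on_compose2[OF elem_smooth_cont[OF assms(1), of UNIV]]
        continuous_on_compose2[OF elem_smooth_cont[OF assms(2), of UNIV]]]) (auto intro: continuous_intros)

lemma C_diff_upto_tensor:
  assumes "elem_smooth f" "elem_smooth g"
  shows "C_diff_upto k UNIV UNIV (\<lambda>p. f (fst p) * g (snd p))"
  using assms
proof (induction k arbitrary: f g)
  case (0 f g)
  then show ?case using tensor_cont by simp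
next
  case (Suc k f g)
  obtain f' g' where *: "elem_smooth f'" "elem_smooth g'"
    "\<And>x. (f has_real_derivative f' x) (at x)" "\<And>x. (g has_real_derivative g' x) (at x)"
    using elem_smooth_deriv[OF Suc.prems(1)] elem_smooth_deriv[OF Suc.prems(2)] by blast
  have "continuous_on UNIV (\<lambda>p :: real \<times> real. f (fst p) * g (snd p))"
    by (rule tensor_cont[OF Suc.prems])
  moreover have "\<exists>f1 f2. (\<forall>x y. ((\<lambda>t. f t * g y) has_real_derivative f1 (x, y)) (at x) \<and>
      ((\<lambda>t. f x * g t) has_real_derivative f2 (x, y)) (at y)) \<and>
      C_diff_upto k UNIV UNIV f1 \<and> C_diff_upto k UNIV UNIV f2"
  proof (intro exI conjI allI)
    show "C_diff_upto k UNIV UNIV (\<lambda>p. f' (fst p) * g (snd p))"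
      "C_diff_upto k UNIV UNIV (\<lambda>p. f (fst p) * g' (snd p))"
      using Suc * by blast+
  qed (use * in \<open>auto intro!: derivative_eq_intros\<close>)
  ultimately show ?case by simp
qed

section \<open>Bumps, steps and plateaus\<close>

definition bump :: "real \<Rightarrow> real" where
  "bump x = flat 0 x * flat 0 (1 - x)"

text \<open>For negative x the integral over the empty interval is 0, which agrees with the
  primitive because the bump vanishes there. The height reached at 1 is positive but not normalized
  to 1.\<close>

definition smooth_step :: "real \<Rightarrow> real" where
  "smooth_step x = integral {0..x} bump"

lemma bump_smooth: "elem_smooth bump"
  using elem_smooth.mult[OF elem_smooth.flat[of 0] elem_smooth.affine[OF elem_smooth.flat[of 0], of "-1" 1]]
  by (simp add: bump_def[abs_def])

lemma bump_nonneg: "bump x \<ge> 0" and bump_pos: "0 < x \<Longrightarrow> x < 1 \<Longrightarrow> bump x > 0"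
  and bump_zero: "x \<le> 0 \<or> x \<ge> 1 \<Longrightarrow> bump x = 0"
  by (auto simp: bump_def flat_def)

lemma smooth_step_deriv: "(smooth_step has_real_derivative bump x) (at x)"
proof -
  \<comment> \<open>A base point below both 0 and x makes x an interior point of the interval of
    integration.\<close>
  define l where "l = min 0 x - 1"
  have l: "l < x" "l < 0" by (auto simp: l_def)
  note c = elem_smooth_cont[OF bump_smooth]
  have eq: "integral {l..t} bump = smooth_step t" if "l < t" for t
  proof (cases "t \<ge> 0")
    case True
    have "integral {l..0} bump = integral {l..0} (\<lambda>_. 0)"
      by (rule integral_cong) (auto simp: bump_zero)
    then show ?thesis
      using Henstock_Kurzweil_Integration.integral_combine[of l 0 t bump] True l
        integrable_continuous_interval[OF c, of l t]
      by (simp add: smooth_step_def)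
  next
    case False
    have "integral {l..t} bump = integral {l..t} (\<lambda>_. 0)"
      by (rule integral_cong) (use False in \<open>auto simp: bump_zero\<close>)
    then show ?thesis using False by (simp add: smooth_step_def)
  qed
  have "((\<lambda>t. integral {l..t} bump) has_real_derivative bump x) (at x within {l..x + 1})"
    using l by (intro DERIV_integral_Icc c) auto
  then have "((\<lambda>t. integral {l..t} bump) has_real_derivative bump x) (at x)"
    using l by (simp add: at_within_Icc_at)
  then show ?thesis
    by (rule has_field_derivative_transform_within_open[of _ _ _ "{l<..}"]) (use l eq in auto)
qed

lemma smooth_step_smooth: "elem_smooth smooth_step"
  by (rule elem_smooth.antideriv[OF bump_smooth smooth_step_deriv])

lemma smooth_step_left: "x \<le> 0 \<Longrightarrow> smooth_step x = 0"
  by (cases "x = 0") (auto simp: smooth_step_def)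

lemma smooth_step_right:
  assumes "x \<ge> 1"
  shows "smooth_step x = smooth_step 1"
proof -
  have "integral {1..x} bump = integral {1..x} (\<lambda>_. 0)"
    by (rule integral_cong) (auto simp: bump_zero)
  then show ?thesis
    using Henstock_Kurzweil_Integration.integral_combine[of 0 1 x bump] assms
      integrable_continuous_interval[OF elem_smooth_cont[OF bump_smooth], of 0 x]
    by (simp add: smooth_step_def)
qed

lemma smooth_step_1_pos: "smooth_step 1 > 0"
proof -
  have "smooth_step 1 \<ge> 0"
    unfolding smooth_step_def by (rule integral_nonneg)
      (auto intro: integrable_continuous_interval elem_smooth_cont[OF bump_smooth] bump_nonneg)
  moreover have "smooth_step 1 \<noteq> 0"
  proof
    assume "smooth_step 1 = 0"
    then have "\<forall>x\<in>{0..1}. bump x = 0"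
      using integral_eq_0_iff[OF elem_smooth_cont[OF bump_smooth], of 0 1]
      by (auto simp: smooth_step_def bump_nonneg)
    then show False using bump_pos[of "1/2"] by auto
  qed
  ultimately show ?thesis by simp
qed

text \<open>Its purpose is the derivative: a scaled bump starting at x0 minus the same bump starting
  at x1, a smoothed difference of two point masses.\<close>

definition plateau :: "real \<Rightarrow> real \<Rightarrow> real \<Rightarrow> real \<Rightarrow> real" where
  "plateau \<epsilon> x0 x1 x = smooth_step ((x - x0) / \<epsilon>) - smooth_step ((x - x1) / \<epsilon>)"

lemma plateau_smooth: "elem_smooth (plateau \<epsilon> x0 x1)"
proof -
  have s: "elem_smooth (\<lambda>x. smooth_step ((x - z) / \<epsilon>))" for z
    using elem_smooth.affine[OF smooth_step_smooth, of "1 / \<epsilon>" "- z / \<epsilon>"]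
    by (simp add: diff_divide_distrib)
  have "elem_smooth (\<lambda>x. smooth_step ((x - x0) / \<epsilon>) + (- 1) * smooth_step ((x - x1) / \<epsilon>))"
    by (intro elem_smooth.add elem_smooth.mult elem_smooth.const s)
  then show ?thesis by (simp add: plateau_def[abs_def])
qed

lemma plateau_deriv:
  assumes "\<epsilon> > 0"
  shows "(plateau \<epsilon> x0 x1 has_real_derivative
    (bump ((x - x0) / \<epsilon>) - bump ((x - x1) / \<epsilon>)) / \<epsilon>) (at x)"
proof -
  have s: "((\<lambda>x. smooth_step ((x - z) / \<epsilon>)) has_real_derivative bump ((x - z) / \<epsilon>) * (1 / \<epsilon>)) (at x)" for z
    by (rule DERIV_chain2[OF smooth_step_deriv]) (use assms in \<open>auto intro!: derivative_eq_intros\<close>)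
  show ?thesis
    unfolding plateau_def[abs_def]
    using DERIV_diff[OF s[of x0] s[of x1]] by (simp add: diff_divide_distrib)
qed

lemma plateau_zero:
  assumes "\<epsilon> > 0" "x0 < x1" "x \<notin> {x0..x1 + \<epsilon>}"
  shows "plateau \<epsilon> x0 x1 x = 0"
proof (cases "x < x0")
  case True
  then show ?thesis using assms by (simp add: plateau_def smooth_step_left divide_nonpos_pos)
next
  case False
  then have "(x - x0) / \<epsilon> \<ge> 1" "(x - x1) / \<epsilon> \<ge> 1" using assms by (auto simp: field_simps)
  from this[THEN smooth_step_right] show ?thesis unfolding plateau_def by linarith
qed

lemma test_function_plateau:
  assumes "\<epsilon> > 0" "x0 < x1" "y0 < y1" "cbox (x0, y0) (x1 + \<epsilon>, y1 + \<epsilon>) \<subseteq> U"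
  shows "test_function U (\<lambda>p. plateau \<epsilon> x0 x1 (fst p) * plateau \<epsilon> y0 y1 (snd p))"
    (is "test_function U ?\<phi>")
proof -
  have sub: "{p. ?\<phi> p \<noteq> 0} \<subseteq> cbox (x0, y0) (x1 + \<epsilon>, y1 + \<epsilon>)"
  proof
    fix p assume "p \<in> {p. ?\<phi> p \<noteq> 0}"
    then have "fst p \<in> {x0..x1 + \<epsilon>}" "snd p \<in> {y0..y1 + \<epsilon>}"
      using plateau_zero[OF assms(1,2), of "fst p"] plateau_zero[OF assms(1,3), of "snd p"] by auto
    then show "p \<in> cbox (x0, y0) (x1 + \<epsilon>, y1 + \<epsilon>)" by (cases p) (auto simp: cbox_Pair_eq)
  qed
  then have "closure {p. ?\<phi> p \<noteq> 0} \<subseteq> cbox (x0, y0) (x1 + \<epsilon>, y1 + \<epsilon>)"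
    by (rule closure_minimal) (rule closed_cbox)
  moreover have "compact (closure {p. ?\<phi> p \<noteq> 0})"
    unfolding compact_closure by (rule bounded_subset[OF bounded_cbox sub])
  ultimately show ?thesis
    unfolding test_function_def
    by (intro conjI allI C_diff_upto_tensor plateau_smooth subset_trans[OF _ assms(4)])
qed

lemma partial_xy_tensor:
  assumes "\<And>x. (f has_real_derivative f' x) (at x)" "\<And>x. (g has_real_derivative g' x) (at x)"
  shows "partial_x (partial_y (\<lambda>p. f (fst p) * g (snd p))) = (\<lambda>p. f' (fst p) * g' (snd p))"
proof -
  have "partial_y (\<lambda>p. f (fst p) * g (snd p)) = (\<lambda>p. f (fst p) * g' (snd p))"
    unfolding partial_y_def by (auto simp: fun_eq_iff intro!: DERIV_imp_deriv DERIV_cmult assms)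
  then show ?thesis
    unfolding partial_x_def by (auto simp: fun_eq_iff intro!: DERIV_imp_deriv DERIV_cmult_right assms)
qed

text \<open>The mixed derivative of a product of two plateaus is a signed sum of four translates of one
  bump, so the weak equation says that an average of the mixed second difference of \<open>V\<close> vanishes.\<close>

lemma rectangle_inequality:
  assumes U: "open U" and V: "continuous_on U V" and "\<epsilon>0 > 0" "x0 < x1" "y0 < y1"
    and box: "cbox (x0, y0) (x1 + \<epsilon>0, y1 + \<epsilon>0) \<subseteq> U"
    and weak: "\<And>\<phi>. test_function U \<phi> \<Longrightarrow> (LINT p:U|lborel. V p * partial_x (partial_y \<phi>) p) = 0"
  shows "V (x1, y1) - V (x1, y0) - V (x0, y1) + V (x0, y0) \<le> 0"
proof (rule ccontr)
  define \<Theta> where "\<Theta> p = V (p + (x1, y1)) - V (p + (x1, y0)) - V (p + (x0, y1)) + V (p + (x0, y0))" for p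
  assume "\<not> ?thesis"
  then have pos: "\<Theta> 0 > 0" by (simp add: \<Theta>_def)
  let ?B = "\<lambda>\<epsilon>. cbox (0, 0) (\<epsilon>, \<epsilon> :: real)"
  have in_box: "p + (x, y) \<in> U" if "p \<in> ?B \<epsilon>0" "x \<in> {x0, x1}" "y \<in> {y0, y1}" for p x y
    using that box assms by (cases p) (auto simp: cbox_Pair_eq intro!: subsetD[OF box])
  have \<Theta>c: "continuous_on (?B \<epsilon>0) \<Theta>"
    unfolding \<Theta>_def[abs_def]
    by (intro continuous_intros continuous_on_compose2[OF V] image_subsetI in_box) auto
  obtain d where d: "d > 0" "\<And>p. p \<in> ?B \<epsilon>0 \<Longrightarrow> dist p 0 < d \<Longrightarrow> dist (\<Theta> p) (\<Theta> 0) < \<Theta> 0"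
  proof -
    have "(0 :: real \<times> real) \<in> ?B \<epsilon>0" using \<open>\<epsilon>0 > 0\<close> by (simp add: zero_prod_def cbox_Pair_eq)
    then show ?thesis using that \<Theta>c pos unfolding continuous_on_iff by metis
  qed
  \<comment> \<open>Points of the square of side \<epsilon> have norm at most 2 \<epsilon> <= d / 2
    < d, so \<Theta> stays positive on it.\<close>
  define \<epsilon> where "\<epsilon> = min \<epsilon>0 (d / 4)"
  have \<epsilon>: "\<epsilon> > 0" "\<epsilon> \<le> \<epsilon>0" "\<epsilon> \<le> d / 4" using d \<open>\<epsilon>0 > 0\<close> by (auto simp: \<epsilon>_def)
  have sub: "?B \<epsilon> \<subseteq> ?B \<epsilon>0" using \<epsilon> by (auto simp: cbox_Pair_eq)
  have \<Theta>pos: "\<Theta> p > 0" if "p \<in> ?B \<epsilon>" for p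
  proof -
    have "norm p \<le> \<bar>fst p\<bar> + \<bar>snd p\<bar>"
      using norm_Pair_le[of "fst p" "snd p"] by simp
    also have "\<dots> \<le> \<epsilon> + \<epsilon>" using that by (cases p) (auto simp: cbox_Pair_eq)
    also have "\<dots> < d" using \<epsilon> d by simp
    finally have "dist p 0 < d" by simp
    then have "dist (\<Theta> p) (\<Theta> 0) < \<Theta> 0" using d(2) that sub by blast
    then show ?thesis by (simp add: dist_real_def)
  qed
  define \<beta> where "\<beta> p = bump (fst p / \<epsilon>) * bump (snd p / \<epsilon>)" for p
  have bc: "continuous_on A (\<lambda>p :: real \<times> real. bump ((fst p - x) / \<epsilon>))"
    "continuous_on A (\<lambda>p :: real \<times> real. bump ((snd p - x) / \<epsilon>))" for x A
    using \<epsilon>(1)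
    by (auto intro!: continuous_on_compose2[OF elem_smooth_cont[OF bump_smooth, of UNIV]] continuous_on_divide
        continuous_on_diff continuous_on_fst continuous_on_snd continuous_on_id continuous_on_const)
  have \<beta>c: "continuous_on A \<beta>" for A
    using continuous_on_mult[OF bc(1)[of A 0] bc(2)[of A 0]] by (simp add: \<beta>_def[abs_def])
  have \<beta>0: "\<beta> (p - (x, y)) = 0" if "p \<notin> cbox (x, y) (x + \<epsilon>, y + \<epsilon>)" for p x y
  proof -
    have "(fst p - x) / \<epsilon> \<le> 0 \<or> (fst p - x) / \<epsilon> \<ge> 1 \<or> (snd p - y) / \<epsilon> \<le> 0 \<or> (snd p - y) / \<epsilon> \<ge> 1"
      using that \<epsilon>(1) by (cases p) (auto simp: cbox_Pair_eq field_simps)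
    then have "bump ((fst p - x) / \<epsilon>) = 0 \<or> bump ((snd p - y) / \<epsilon>) = 0"
      using bump_zero by blast
    then show ?thesis by (auto simp: \<beta>_def)
  qed
  \<comment> \<open>Each of the four bumps is translated to the origin, so that the four terms share
    one domain and one weight and combine into \<Theta>.\<close>
  have piece: "set_integrable lborel U (\<lambda>p. V p * \<beta> (p - (x, y))) \<and>
      (LINT p:U|lborel. V p * \<beta> (p - (x, y))) = integral (?B \<epsilon>) (\<lambda>p. V (p + (x, y)) * \<beta> p)"
    if xy: "x \<in> {x0, x1}" "y \<in> {y0, y1}" for x y
  proof -
    let ?K = "cbox (x, y) (x + \<epsilon>, y + \<epsilon>)"
    have KU: "?K \<subseteq> U"
      using box xy assms \<epsilon> by (auto simp: cbox_Pair_eq intro!: subsetD[OF box])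
    have c: "continuous_on UNIV (\<lambda>p. \<beta> (p - (x, y)))"
      by (intro continuous_on_compose2[OF \<beta>c[of UNIV]] continuous_intros) auto
    note z = zero_extension_continuous[OF U compact_cbox KU V c \<beta>0]
    have "set_integrable lborel U (\<lambda>p. V p * \<beta> (p - (x, y)))"
      by (rule set_lebesgue_integral_box(1)[where l="(x, y)" and u="(x + \<epsilon>, y + \<epsilon>)", OF z]) (auto simp: \<beta>0)
    moreover have "(LINT p:U|lborel. V p * \<beta> (p - (x, y))) =
        integral ?K (\<lambda>p. if p \<in> U then V p * \<beta> (p - (x, y)) else 0)"
      by (rule set_lebesgue_integral_box(2)[OF z]) (auto simp: \<beta>0)
    moreover have "\<dots> = integral ?K (\<lambda>p. V p * \<beta> (p - (x, y)))"
      by (rule integral_cong) (use KU in auto)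
    moreover have "\<dots> = integral (?B \<epsilon>) (\<lambda>p. V (p + (x, y)) * \<beta> p)"
      using integral_shift_cbox[of "(x, y)" "(x, y)" "(x + \<epsilon>, y + \<epsilon>)" "\<lambda>p. V p * \<beta> (p - (x, y))"]
      by (simp add: zero_prod_def)
    ultimately show ?thesis by simp
  qed
  let ?\<phi> = "\<lambda>p. plateau \<epsilon> x0 x1 (fst p) * plateau \<epsilon> y0 y1 (snd p)"
  have "cbox (x0, y0) (x1 + \<epsilon>, y1 + \<epsilon>) \<subseteq> U"
    using box \<epsilon> by (force simp: cbox_Pair_eq)
  then have "0 = (LINT p:U|lborel. V p * partial_x (partial_y ?\<phi>) p)"
    using weak[OF test_function_plateau[OF \<epsilon>(1) assms(4,5)]] by simp
  also have "\<dots> = (LINT p:U|lborel. (1 / \<epsilon>\<^sup>2) * (V p * \<beta> (p - (x0, y0)) - V p * \<beta> (p - (x0, y1))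
      - V p * \<beta> (p - (x1, y0)) + V p * \<beta> (p - (x1, y1))))"
    unfolding partial_xy_tensor[OF plateau_deriv[OF \<epsilon>(1)] plateau_deriv[OF \<epsilon>(1)]]
    using \<epsilon>(1) by (simp add: \<beta>_def field_simps power2_eq_square)
  also have "\<dots> = (1 / \<epsilon>\<^sup>2) * (integral (?B \<epsilon>) (\<lambda>p. V (p + (x0, y0)) * \<beta> p)
      - integral (?B \<epsilon>) (\<lambda>p. V (p + (x0, y1)) * \<beta> p) - integral (?B \<epsilon>) (\<lambda>p. V (p + (x1, y0)) * \<beta> p)
      + integral (?B \<epsilon>) (\<lambda>p. V (p + (x1, y1)) * \<beta> p))"
    using piece by (simp add: set_integral_add set_integral_diff)
  finally have sum0: "integral (?B \<epsilon>) (\<lambda>p. V (p + (x0, y0)) * \<beta> p)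
      - integral (?B \<epsilon>) (\<lambda>p. V (p + (x0, y1)) * \<beta> p) - integral (?B \<epsilon>) (\<lambda>p. V (p + (x1, y0)) * \<beta> p)
      + integral (?B \<epsilon>) (\<lambda>p. V (p + (x1, y1)) * \<beta> p) = 0"
    using \<epsilon>(1) by simp
  have int: "(\<lambda>p. V (p + (x, y)) * \<beta> p) integrable_on ?B \<epsilon>" if "x \<in> {x0, x1}" "y \<in> {y0, y1}" for x y
  proof (rule integrable_continuous)
    show "continuous_on (?B \<epsilon>) (\<lambda>p. V (p + (x, y)) * \<beta> p)"
      by (intro continuous_on_mult \<beta>c continuous_on_compose2[OF V] continuous_intros image_subsetI)
         (use in_box[OF _ that] sub in blast)
  qed
  have "integral (?B \<epsilon>) (\<lambda>p. \<Theta> p * \<beta> p) = integral (?B \<epsilon>) (\<lambda>p. V (p + (x0, y0)) * \<beta> p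
      - V (p + (x0, y1)) * \<beta> p - V (p + (x1, y0)) * \<beta> p + V (p + (x1, y1)) * \<beta> p)"
    by (rule integral_cong) (simp add: \<Theta>_def algebra_simps)
  also have "\<dots> = 0"
    using sum0 int by (simp add: integral_add integral_diff integrable_add integrable_diff)
  finally have "integral (?B \<epsilon>) (\<lambda>p. \<Theta> p * \<beta> p) = 0" .
  moreover have "continuous_on (?B \<epsilon>) (\<lambda>p. \<Theta> p * \<beta> p)"
    by (intro continuous_on_mult \<beta>c continuous_on_subset[OF \<Theta>c sub])
  moreover have "box (0, 0) (\<epsilon>, \<epsilon>) \<noteq> {}"
    using \<epsilon>(1) by (auto simp: box_ne_empty Basis_prod_def)
  moreover have "\<Theta> p * \<beta> p \<ge> 0" if "p \<in> ?B \<epsilon>" for p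
    using \<Theta>pos[OF that] by (simp add: \<beta>_def bump_nonneg)
  ultimately have "\<forall>p\<in>?B \<epsilon>. \<Theta> p * \<beta> p = 0"
    using integral_cbox_eq_0_iff by blast
  moreover have "(\<epsilon> / 2, \<epsilon> / 2) \<in> ?B \<epsilon>" using \<epsilon>(1) by (simp add: cbox_Pair_eq)
  moreover have "\<beta> (\<epsilon> / 2, \<epsilon> / 2) > 0" using \<epsilon>(1) bump_pos[of "1/2"] by (simp add: \<beta>_def)
  ultimately show False using \<Theta>pos by (metis less_irrefl mult_pos_pos)
qed

text \<open>The weak equation is linear, so the inequality applies to V and to - V.\<close>

lemma rectangle_identity:
  assumes U: "open U" and V: "continuous_on U V" and "\<epsilon> > 0" "x0 < x1" "y0 < y1"
    and box: "cbox (x0, y0) (x1 + \<epsilon>, y1 + \<epsilon>) \<subseteq> U"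
    and weak: "\<And>\<phi>. test_function U \<phi> \<Longrightarrow> (LINT p:U|lborel. V p * partial_x (partial_y \<phi>) p) = 0"
  shows "V (x1, y1) - V (x1, y0) - V (x0, y1) + V (x0, y0) = 0"
proof (rule order.antisym)
  show "V (x1, y1) - V (x1, y0) - V (x0, y1) + V (x0, y0) \<le> 0"
    by (rule rectangle_inequality[OF assms])
  have "(LINT p:U|lborel. - V p * partial_x (partial_y \<phi>) p) = 0" if "test_function U \<phi>" for \<phi>
    using weak[OF that] by (simp add: set_integral_uminus[symmetric] set_lebesgue_integral_def)
  then show "0 \<le> V (x1, y1) - V (x1, y0) - V (x0, y1) + V (x0, y0)"
    using rectangle_inequality[OF U continuous_on_minus[OF V] assms(3-6)] by simp
qed

subsection \<open>The curvilinear triangle\<close>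

lemma unbounded_ray:
  fixes p v :: "'a::real_normed_vector"
  assumes "v \<noteq> 0"
  shows "\<not> bounded ((\<lambda>t. p + t *\<^sub>R v) ` {0..})"
proof
  assume "bounded ((\<lambda>t. p + t *\<^sub>R v) ` {0..})"
  then obtain B where B: "\<And>t. t \<ge> 0 \<Longrightarrow> norm (p + t *\<^sub>R v) \<le> B"
    unfolding bounded_iff by auto
  define t where "t = (B + norm p + 1) / norm v"
  have "B \<ge> 0" using order_trans[OF norm_ge_zero B[of 0]] by simp
  then have t: "t \<ge> 0" "t * norm v = B + norm p + 1" using assms by (auto simp: t_def)
  have "norm (t *\<^sub>R v) \<le> norm (p + t *\<^sub>R v) + norm p"
    using norm_triangle_ineq4[of "p + t *\<^sub>R v" p] by simp
  then show False using B[OF t(1)] t by simp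
qed

lemma ray_imp_not_inside:
  fixes p v :: "'a::real_normed_vector"
  assumes "v \<noteq> 0" "\<And>t. t \<ge> 0 \<Longrightarrow> p + t *\<^sub>R v \<notin> S"
  shows "p \<notin> inside S"
proof
  assume "p \<in> inside S"
  then have b: "bounded (connected_component_set (- S) p)" by (simp add: inside_def)
  have "connected ((\<lambda>t. p + t *\<^sub>R v) ` {0..})"
    by (intro connected_continuous_image continuous_intros connected_Ici)
  then have "(\<lambda>t. p + t *\<^sub>R v) ` {0..} \<subseteq> connected_component_set (- S) p"
    by (intro connected_component_maximal) (use assms(2) in \<open>auto intro!: image_eqI[of _ _ 0]\<close>)
  then show False using bounded_subset[OF b] unbounded_ray[OF assms(1)] by blast
qed

text \<open>\<open>strict\<close> says that the interior of the curve stays off the axes, since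
  there n x = \<delta> and m y = \<delta> - s. The constant extension of \<delta> beyond the
  interval lets \<open>gap\<close> be a continuous function on the whole plane.\<close>

locale curve_domain = curve_map "- m" n \<delta> d e for m n :: real and \<delta> d e +
  assumes strict: "- m < s \<Longrightarrow> s < n \<Longrightarrow> 0 < \<delta> s \<and> s < \<delta> s"
    and \<delta>_left: "s \<le> - m \<Longrightarrow> \<delta> s = 0" and \<delta>_right: "s \<ge> n \<Longrightarrow> \<delta> s = n"
begin

lemma mn: "m > 0" "n > 0"
  using ab by auto

lemma \<delta>_clamp: "\<delta> (clamp_ab s) = \<delta> s"
proof -
  consider "s \<le> - m" | "s \<ge> n" | "s \<in> {- m..n}" by fastforce
  then show ?thesis
  proof cases
    case 1
    then have "clamp_ab s = - m" using ab by (simp add: clamp_ab_def)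
    then show ?thesis using \<delta>_left[OF 1] \<delta>_ends by simp
  next
    case 2
    then have "clamp_ab s = n" using ab by (simp add: clamp_ab_def)
    then show ?thesis using \<delta>_right[OF 2] \<delta>_ends by simp
  qed (simp only: clamp_ab_id)
qed

lemma \<delta>_cont_UNIV: "continuous_on A \<delta>"
proof -
  have "continuous_on UNIV (\<lambda>s. \<delta> (clamp_ab s))"
    by (rule continuous_on_compose2[OF \<delta>_cont clamp_ab_cont]) (use clamp_ab_in in blast)
  then show ?thesis using continuous_on_subset by (auto simp: \<delta>_clamp)
qed

lemma \<delta>_increments_UNIV:
  assumes "x \<le> y"
  shows "\<delta> x \<le> \<delta> y" "\<delta> y - \<delta> x \<le> y - x"
proof -
  have c: "clamp_ab x \<le> clamp_ab y" "clamp_ab y - clamp_ab x \<le> y - x"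
    using assms ab by (auto simp: clamp_ab_def min_def max_def)
  show "\<delta> x \<le> \<delta> y" "\<delta> y - \<delta> x \<le> y - x"
    using \<delta>_increments[OF clamp_ab_bounds(1) c(1) clamp_ab_bounds(2)] c by (auto simp: \<delta>_clamp)
qed

lemma \<delta>_bounds_UNIV: "0 \<le> \<delta> s" "\<delta> s \<le> n"
  using \<delta>_bounds[OF clamp_ab_in, of s] by (auto simp: \<delta>_clamp)

lemma \<delta>_ge_id: "s \<le> n \<Longrightarrow> s \<le> \<delta> s"
  using \<delta>_bounds(4)[of s] \<delta>_bounds_UNIV(1)[of s] mn by (cases "s \<ge> - m") auto

lemma \<delta>_pos_imp: "\<delta> s > 0 \<Longrightarrow> s > - m"
  using \<delta>_left[of s] by force

text \<open>The curve in the characteristic coordinate: solve n x = \<delta> s and n x - m y = s for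
  x and y.\<close>

definition point :: "real \<Rightarrow> real \<times> real" where
  "point s = (\<delta> s / n, (\<delta> s - s) / m)"

definition height :: "real \<times> real \<Rightarrow> real" where
  "height p = n * fst p - m * snd p"

lemma height_point [simp]: "height (point s) = s"
  using mn by (simp add: height_def point_def)

lemma height_line [simp]: "height (p + t *\<^sub>R (m, n)) = height p"
  by (simp add: height_def algebra_simps)

lemma height_cont: "continuous_on A height"
  unfolding height_def[abs_def] by (intro continuous_intros)

lemma point_cont: "continuous_on A point"
  unfolding point_def[abs_def] using mn by (intro continuous_intros \<delta>_cont_UNIV) auto

text \<open>The characteristic line through p meets the curve at height \<open>height p\<close>.
  \<open>gap p\<close> is n times the increase of the abscissa needed to reach that point, hence
  positive before the curve and negative beyond it.\<close>

definition gap :: "real \<times> real \<Rightarrow> real" where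
  "gap p = \<delta> (height p) - n * fst p"

lemma gap_cont: "continuous_on A gap"
  unfolding gap_def[abs_def]
  by (intro continuous_intros continuous_on_compose2[OF \<delta>_cont_UNIV[of UNIV] height_cont]) auto

lemma gap_line [simp]: "gap (p + t *\<^sub>R (m, n)) = gap p - t * (m * n)"
  unfolding gap_def height_line by (simp add: algebra_simps)

lemma gap_point [simp]: "gap (point s) = 0"
  using mn by (simp add: gap_def) (simp add: point_def)

lemma point_height: "p + (gap p / (m * n)) *\<^sub>R (m, n) = point (height p)"
  using mn by (cases p) (simp add: gap_def point_def height_def field_simps)

definition region :: "(real \<times> real) set" where
  "region = {p. 0 < fst p \<and> 0 < snd p \<and> 0 < gap p}"

text \<open>The bound on \<open>height\<close> is essential: on the y-axis above the end point (0,
  1) the extended \<delta> is 0 and so is \<open>gap\<close>, and the other conditions would admit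
  that whole ray.\<close>

definition closed_region :: "(real \<times> real) set" where
  "closed_region = {p. 0 \<le> fst p \<and> 0 \<le> snd p \<and> - m \<le> height p \<and> 0 \<le> gap p}"

abbreviation boundary :: "(real \<times> real) set" where
  "boundary \<equiv> closed_segment (0, 0) (1, 0) \<union> closed_segment (0, 0) (0, 1) \<union> point ` {- m..n}"

lemma region_open: "open region"
  unfolding region_def
  by (intro open_Collect_conj open_Collect_less continuous_intros gap_cont)

lemma closed_region_closed: "closed closed_region"
  unfolding closed_region_def
  by (intro closed_Collect_conj closed_Collect_le continuous_intros gap_cont height_cont)

lemma region_height: "p \<in> region \<Longrightarrow> - m < height p \<and> height p < n"
proof -
  assume "p \<in> region"
  then have p: "0 < fst p" "0 < snd p" "n * fst p < \<delta> (height p)" by (auto simp: region_def gap_def)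
  have "0 < n * fst p" "0 < m * snd p" using p mn by auto
  then have "0 < \<delta> (height p)" using p by linarith
  moreover have "height p < n * fst p" using \<open>0 < m * snd p\<close> by (simp add: height_def)
  ultimately show ?thesis using \<delta>_pos_imp p(3) \<delta>_bounds_UNIV(2)[of "height p"] by fastforce
qed

lemma closed_region_height:
  assumes "p \<in> closed_region"
  shows "height p \<in> {- m..n}"
proof -
  have "0 \<le> m * snd p" using assms mn by (simp add: closed_region_def)
  then have "height p \<le> n * fst p" by (simp add: height_def)
  then show ?thesis
    using assms \<delta>_bounds_UNIV(2)[of "height p"] by (simp add: closed_region_def gap_def)
qed

lemma region_subset: "region \<subseteq> closed_region"
  using region_height by (auto simp: region_def closed_region_def less_imp_le)

lemma axis1: "closed_segment (0, 0) (1, 0) = {0 :: real..1} \<times> {0 :: real}"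
  and axis2: "closed_segment (0, 0) (0, 1) = {0 :: real} \<times> {0 :: real..1}"
  by (auto simp: closed_segment_def)

lemma boundary_subset: "boundary \<subseteq> closed_region"
proof -
  have "(x, 0) \<in> closed_region" if "0 \<le> x" "x \<le> 1" for x
  proof -
    have "0 \<le> n * x" "n * x \<le> n * 1" using mn that by (auto intro: mult_left_mono)
    moreover from this have "- m \<le> n * x" using mn by linarith
    ultimately show ?thesis using \<delta>_ge_id[of "n * x"] mn that by (simp add: closed_region_def gap_def height_def)
  qed
  moreover have "(0, y) \<in> closed_region" if "0 \<le> y" "y \<le> 1" for y
    using \<delta>_bounds_UNIV(1)[of "- (m * y)"] mn that mult_left_mono[of y 1 m]
    by (simp add: closed_region_def gap_def height_def)
  moreover have "point s \<in> closed_region" if "s \<in> {- m..n}" for s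
  proof -
    have "0 \<le> fst (point s)" "0 \<le> snd (point s)"
      using \<delta>_bounds[OF that] mn by (simp_all add: point_def)
    then show ?thesis using that by (simp add: closed_region_def)
  qed
  ultimately show ?thesis by (auto simp: axis1 axis2)
qed

lemma closed_region_subset: "closed_region \<subseteq> region \<union> boundary"
proof
  fix p assume p: "p \<in> closed_region"
  obtain x y where xy: "p = (x, y)" by (cases p)
  have "x = 0 \<or> y = 0 \<or> gap p = 0 \<or> p \<in> region"
    using p xy by (auto simp: closed_region_def region_def less_le)
  then show "p \<in> region \<union> boundary"
  proof (elim disjE)
    assume "x = 0"
    moreover from this have "m * y \<le> m * 1" using p xy by (simp add: closed_region_def height_def)
    ultimately have "x = 0" "y \<le> 1" "0 \<le> y"
      using p xy mn mult_le_cancel_left_pos[of m y 1] by (auto simp: closed_region_def)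
    then show ?thesis by (auto simp: xy axis2)
  next
    assume "y = 0"
    moreover from this have "n * x \<le> n * 1"
      using p xy \<delta>_bounds_UNIV(2)[of "height p"] by (simp add: closed_region_def gap_def)
    ultimately have "y = 0" "x \<le> 1" "0 \<le> x"
      using p xy mn mult_le_cancel_left_pos[of n x 1] by (auto simp: closed_region_def)
    then show ?thesis by (auto simp: xy axis1)
  next
    assume "gap p = 0"
    then have "p = point (height p)" using point_height[of p] by (simp flip: zero_prod_def)
    then show ?thesis using closed_region_height[OF p] by blast
  qed simp
qed

lemma region_boundary_disjoint: "region \<inter> boundary = {}"
  by (auto simp: region_def axis1 axis2)

lemma closed_region_eq: "closed_region = region \<union> boundary"
  using closed_region_subset boundary_subset region_subset by auto

lemma region_limit:
  assumes "\<forall>\<^sub>F t in at_right 0. f t \<in> region" "(f \<longlongrightarrow> p) (at_right (0 :: real))"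
  shows "p \<in> closure region"
proof (rule Lim_in_closed_set[OF closed_closure _ _ assms(2)])
  show "\<forall>\<^sub>F t in at_right 0. f t \<in> closure region"
    using assms(1) by eventually_elim (use closure_subset in blast)
qed simp

lemma point_in_closure: 
  assumes "- m < s" "s < n"
  shows "point s \<in> closure region"
proof (rule region_limit[where f="\<lambda>t. point s + (- t) *\<^sub>R (m, n)"])
  have pos: "0 < fst (point s)" "0 < snd (point s)" using strict[OF assms] mn by (auto simp: point_def)
  have "((\<lambda>t. fst (point s) - t * m) \<longlongrightarrow> fst (point s) - 0 * m) (at_right 0)"
    "((\<lambda>t. snd (point s) - t * n) \<longlongrightarrow> snd (point s) - 0 * n) (at_right 0)"
    by (intro tendsto_intros)+
  then have "\<forall>\<^sub>F t in at_right 0. 0 < fst (point s) - t * m" "\<forall>\<^sub>F t in at_right 0. 0 < snd (point s) - t * n"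
    using pos order_tendstoD(1) by fastforce+
  moreover have "\<forall>\<^sub>F t in at_right 0. 0 < (t :: real)"
    by (simp add: eventually_at_right_less)
  ultimately show "\<forall>\<^sub>F t in at_right 0. point s + (- t) *\<^sub>R (m, n) \<in> region"
  proof eventually_elim
    case (elim t)
    have "gap (point s + (- t) *\<^sub>R (m, n)) = t * (m * n)" by (simp only: gap_line gap_point)
    then show ?case using elim mn by (simp add: region_def)
  qed
  have "((\<lambda>t. point s + (- t) *\<^sub>R (m, n)) \<longlongrightarrow> point s + (- 0) *\<^sub>R (m, n)) (at_right 0)"
    by (intro tendsto_intros)
  then show "((\<lambda>t. point s + (- t) *\<^sub>R (m, n)) \<longlongrightarrow> point s) (at_right 0)" by (simp flip: zero_prod_def)
qed

lemma closure_image_Icc: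
  fixes f :: "real \<Rightarrow> real \<times> real"
  assumes "continuous_on {a..b} f" "a < b" "\<And>s. a < s \<Longrightarrow> s < b \<Longrightarrow> f s \<in> closure S" "s \<in> {a..b}"
  shows "f s \<in> closure S"
proof -
  have "f ` closure {a<..<b} \<subseteq> closure S"
    by (rule image_closure_subset) (use assms in auto)
  then show ?thesis using assms by auto
qed

text \<open>Interior points of the axis sides are approached perpendicularly to the side, those of
  the curve along characteristics; the three corners follow by continuity.\<close>

lemma boundary_in_closure: "boundary \<subseteq> closure region"
proof -
  have gap_lim: "\<forall>\<^sub>F t in at_right 0. 0 < gap (f t)"
    if f: "(f \<longlongrightarrow> p) (at_right 0)" and "0 < gap p" for f :: "real \<Rightarrow> _" and p
  proof -
    have "isCont gap p" using gap_cont[of UNIV] unfolding continuous_on_eq_continuous_at[OF open_UNIV] by blast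
    from isCont_tendsto_compose[OF this f] show ?thesis using that(2) order_tendstoD(1) by blast
  qed
  have pos: "\<forall>\<^sub>F t in at_right 0. 0 < (t :: real)" by (simp add: eventually_at_right_less)
  have x: "(x, 0) \<in> closure region" if "0 < x" "x < 1" for x
  proof (rule region_limit)
    show lim: "((\<lambda>t. (x, t)) \<longlongrightarrow> (x, 0)) (at_right 0)" by (intro tendsto_intros)
    have "0 < gap (x, 0)"
    proof -
      have "0 < n * x" "n * x < n * 1" using mn that by (auto intro: mult_strict_left_mono)
      moreover from this have "- m < n * x" using mn by linarith
      ultimately show ?thesis using strict[of "n * x"] by (simp add: gap_def height_def)
    qed
    from gap_lim[OF lim this] pos show "\<forall>\<^sub>F t in at_right 0. (x, t) \<in> region"
      by eventually_elim (use that in \<open>auto simp: region_def\<close>)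
  qed
  have y: "(0, y) \<in> closure region" if "0 < y" "y < 1" for y
  proof (rule region_limit)
    show lim: "((\<lambda>t. (t, y)) \<longlongrightarrow> (0, y)) (at_right 0)" by (intro tendsto_intros)
    have "0 < gap (0, y)"
    proof -
      have "0 < m * y" "m * y < m * 1" using mn that by (auto intro: mult_strict_left_mono)
      moreover from this have "- (m * y) < n" using mn by linarith
      ultimately show ?thesis using strict[of "- (m * y)"] by (simp add: gap_def height_def)
    qed
    from gap_lim[OF lim this] pos show "\<forall>\<^sub>F t in at_right 0. (t, y) \<in> region"
      by eventually_elim (use that in \<open>auto simp: region_def\<close>)
  qed
  have "(x, 0) \<in> closure region" if "x \<in> {0..1}" for x
    by (rule closure_image_Icc[of 0 1 "\<lambda>x. (x, 0)"]) (use x that in \<open>auto intro!: continuous_intros\<close>)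
  moreover have "(0, y) \<in> closure region" if "y \<in> {0..1}" for y
    by (rule closure_image_Icc[of 0 1 "\<lambda>y. (0, y)"]) (use y that in \<open>auto intro!: continuous_intros\<close>)
  moreover have "point s \<in> closure region" if "s \<in> {- m..n}" for s
    by (rule closure_image_Icc[OF point_cont _ point_in_closure that]) (use mn in auto)
  ultimately show ?thesis by (auto simp: axis1 axis2)
qed

lemma closure_region: "closure region = closed_region"
proof
  show "closure region \<subseteq> closed_region"
    by (rule closure_minimal[OF region_subset closed_region_closed])
  show "closed_region \<subseteq> closure region"
    using boundary_in_closure closure_subset unfolding closed_region_eq by blast
qed

lemma frontier_region: "frontier region = boundary"
  using region_boundary_disjoint
  by (auto simp: frontier_def closure_region closed_region_eq interior_open[OF region_open])

lemma region_bounded: "bounded region"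
proof (rule bounded_subset)
  show "bounded (({0..1} :: real set) \<times> {0..(n + m) / m})" by (intro bounded_Times bounded_closed_interval)
  show "region \<subseteq> {0..1} \<times> {0..(n + m) / m}"
  proof
    fix p assume p: "p \<in> region"
    then have "n * fst p \<le> n * 1" using \<delta>_bounds_UNIV(2)[of "height p"] by (simp add: region_def gap_def)
    then have "fst p \<le> 1" using mn by simp
    moreover have "m * snd p \<le> n + m"
      using region_height[OF p] \<open>n * fst p \<le> n * 1\<close> by (simp add: height_def)
    then have "snd p \<le> (n + m) / m" using mn by (simp add: field_simps)
    ultimately show "p \<in> {0..1} \<times> {0..(n + m) / m}" using p by (cases p) (auto simp: region_def)
  qed
qed

text \<open>A component of the complement of the boundary that starts in the bounded region cannot
  cross its frontier and is bounded. Conversely, from every point off the closed region some ray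
  escapes to infinity without meeting it.\<close>

lemma inside_boundary: "inside boundary = region"
proof
  show "region \<subseteq> inside boundary"
  proof
    fix p assume p: "p \<in> region"
    let ?C = "connected_component_set (- boundary) p"
    have pb: "p \<notin> boundary" using p region_boundary_disjoint by blast
    have "?C \<subseteq> region"
    proof (rule ccontr)
      assume "\<not> ?C \<subseteq> region"
      moreover have "p \<in> ?C" unfolding mem_Collect_eq by (rule connected_component_refl) (use pb in blast)
      then have "?C \<inter> region \<noteq> {}" using p by blast
      ultimately have "?C \<inter> frontier region \<noteq> {}"
        by (intro connected_Int_frontier connected_connected_component) auto
      then show False
        unfolding frontier_region using connected_component_subset[of "- boundary" p] by blast
    qed
    then show "p \<in> inside boundary"
      using pb bounded_subset[OF region_bounded] by (simp add: inside_def)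
  qed
  show "inside boundary \<subseteq> region"
  proof
    fix p assume p: "p \<in> inside boundary"
    show "p \<in> region"
    proof (rule ccontr)
      assume "p \<notin> region"
      then have "p \<notin> closed_region" using p inside_no_overlap[of boundary] unfolding closed_region_eq by blast
      then consider "fst p < 0" | "snd p < 0" | "height p < - m" | "gap p < 0"
        by (auto simp: closed_region_def)
      \<comment> \<open>One direction for each violated inequality, chosen such that the violation
        persists: left, down, up, and along the characteristic.\<close>
      then have "\<exists>v. v \<noteq> 0 \<and> (\<forall>t\<ge>0. p + t *\<^sub>R v \<notin> closed_region)"
      proof cases
        case 1
        then show ?thesis
          by (intro exI[of _ "(- 1, 0)"]) (auto simp: closed_region_def zero_prod_def)
      next
        case 2
        then show ?thesis
          by (intro exI[of _ "(0, - 1)"]) (auto simp: closed_region_def zero_prod_def)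
      next
        case 3
        have "height (p + t *\<^sub>R (0, 1)) < - m" if "t \<ge> 0" for t
        proof -
          have "0 \<le> m * t" using mn that by simp
          with 3 show ?thesis by (simp add: height_def algebra_simps)
        qed
        then show ?thesis
          by (intro exI[of _ "(0, 1)"]) (auto simp: closed_region_def zero_prod_def not_le)
      next
        case 4
        have "gap (p + t *\<^sub>R (m, n)) < 0" if "t \<ge> 0" for t
        proof -
          have "0 \<le> t * (m * n)" using mn that by simp
          with 4 show ?thesis unfolding gap_line by linarith
        qed
        then show ?thesis
          using mn by (intro exI[of _ "(m, n)"]) (auto simp: closed_region_def zero_prod_def not_le)
      qed
      then show False using ray_imp_not_inside[of _ p boundary] boundary_subset p by blast
    qed
  qed
qed

text \<open>Moving left lowers \<delta> by no more than the decrease of n x, as \<delta> is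
  1-Lipschitz, and moving down raises the height and with it \<delta>. Hence rectangles reaching
  from near the axes to a point of the region stay inside it.\<close>

lemma region_downward:
  assumes "(x, y) \<in> region" "0 < x'" "x' \<le> x" "0 < y'" "y' \<le> y"
  shows "(x', y') \<in> region"
proof -
  have m: "m * y' \<le> m * y" "n * x' \<le> n * x" using assms mn by auto
  have "n * x < \<delta> (n * x - m * y)" using assms by (simp add: region_def gap_def height_def)
  also have "\<dots> \<le> \<delta> (n * x' - m * y) + (n * x - n * x')"
    using \<delta>_increments_UNIV(2)[of "n * x' - m * y" "n * x - m * y"] m by simp
  also have "\<dots> \<le> \<delta> (n * x' - m * y') + (n * x - n * x')"
    using \<delta>_increments_UNIV(1)[of "n * x' - m * y" "n * x' - m * y'"] m by simp
  finally show ?thesis using assms by (simp add: region_def gap_def height_def)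
qed

lemma line_in_region:
  assumes p: "p \<in> closed_region" and t: "0 < t" "t * (m * n) < gap p"
  shows "p + t *\<^sub>R (m, n) \<in> region"
proof -
  have "gap (p + t *\<^sub>R (m, n)) > 0" using t unfolding gap_line by simp
  then show ?thesis using p t mn by (auto simp: region_def closed_region_def add_nonneg_pos)
qed

end

subsection \<open>Solutions are sums of plane waves\<close>

text \<open>The characteristic direction mixes the variables, while \<open>C_diff_upto\<close>
  speaks of partial derivatives. These, with continuity of \<open>f2\<close>, give a total
  derivative, to which the chain rule applies.\<close>

lemma DERIV_along_line:
  fixes f f1 f2 :: "real \<times> real \<Rightarrow> real"
  assumes U: "open U" and c: "continuous_on U f2"
    and d: "\<And>x y. (x, y) \<in> U \<Longrightarrow> ((\<lambda>t. f (t, y)) has_real_derivative f1 (x, y)) (at x)"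
      "\<And>x y. (x, y) \<in> U \<Longrightarrow> ((\<lambda>t. f (x, t)) has_real_derivative f2 (x, y)) (at y)"
    and q: "p + t0 *\<^sub>R (v1, v2) \<in> U" (is "?q \<in> U")
  shows "((\<lambda>t. f (p + t *\<^sub>R (v1, v2))) has_real_derivative f1 ?q * v1 + f2 ?q * v2) (at t0)"
proof -
  obtain x0 y0 where xy: "?q = (x0, y0)" by (cases ?q)
  obtain A B where AB': "open A" "open B" "?q \<in> A \<times> B" "A \<times> B \<subseteq> U"
    by (rule open_prod_elim[OF U q])
  then have AB: "open A" "open B" "x0 \<in> A" "y0 \<in> B" "A \<times> B \<subseteq> U"
    unfolding xy by (simp_all only: mem_Sigma_iff)
  \<comment> \<open>A ball supplies the convex set of second coordinates that
    \<open>has_derivative_partialsI\<close> asks for.\<close>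
  obtain r where r: "r > 0" "ball y0 r \<subseteq> B" using AB openE by blast
  let ?Y = "ball y0 r"
  have sub: "A \<times> ?Y \<subseteq> U" using AB r by auto
  have "((\<lambda>(x, y). f (x, y)) has_derivative
      (\<lambda>(tx, ty). f1 (x0, y0) * tx + blinfun_scaleR_right (f2 (x0, y0)) ty)) (at (x0, y0) within A \<times> ?Y)"
  proof (rule has_derivative_partialsI)
    show "((\<lambda>x. f (x, y0)) has_derivative (\<lambda>tx. f1 (x0, y0) * tx)) (at x0 within A)"
      using d(1)[OF q[unfolded xy]] unfolding has_field_derivative_def by (rule has_derivative_at_withinI)
    show "((\<lambda>y. f (x, y)) has_derivative blinfun_scaleR_right (f2 (x, y))) (at y within ?Y)"
      if "x \<in> A" "y \<in> ?Y" for x y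
    proof -
      have "blinfun_apply (blinfun_scaleR_right (f2 (x, y))) = (*) (f2 (x, y))" by (simp add: fun_eq_iff)
      moreover have "(x, y) \<in> U" using sub that by blast
      ultimately show ?thesis
        using d(2)[of x y] unfolding has_field_derivative_def by (auto intro: has_derivative_at_withinI)
    qed
    have "continuous (at (x0, y0) within A \<times> ?Y) f2"
      using continuous_on_subset[OF c sub] AB r by (simp add: continuous_on_eq_continuous_within)
    then show "continuous (at (x0, y0) within A \<times> ?Y) (\<lambda>(x, y). blinfun_scaleR_right (f2 (x, y)))"
      by (simp add: case_prod_beta' bounded_linear.continuous[OF bounded_linear_blinfun_scaleR_right])
  qed (use r in auto)
  then have D: "(f has_derivative (\<lambda>(tx, ty). f1 (x0, y0) * tx + f2 (x0, y0) * ty)) (at ?q)"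
    using AB r at_within_open[of "(x0, y0)" "A \<times> ?Y"] xy by (simp add: open_Times)
  have L: "((\<lambda>t. p + t *\<^sub>R (v1, v2)) has_derivative (\<lambda>h. h *\<^sub>R (v1, v2))) (at t0)"
    by (auto intro!: derivative_eq_intros)
  show ?thesis
    unfolding has_field_derivative_def
    by (rule has_derivative_eq_rhs[OF has_derivative_compose[OF L D]])
       (unfold xy, simp add: fun_eq_iff algebra_simps)
qed

lemma DERIV_glue:
  fixes f :: "real \<Rightarrow> real"
  assumes "\<And>s. s \<in> {a..c} \<Longrightarrow> (f has_real_derivative l s) (at s within {a..c})"
    and "\<And>s. s \<in> {c..b} \<Longrightarrow> (f has_real_derivative r s) (at s within {c..b})"
    and "l c = r c" "a \<le> c" "c \<le> b" "s \<in> {a..b}"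
  shows "(f has_real_derivative (if s \<le> c then l s else r s)) (at s within {a..b})"
proof -
  consider "s < c" | "s = c" | "s > c" by fastforce
  then show ?thesis
  proof cases
    case 1
    have "at s within {a..b} = at s within {a..c}"
      by (rule at_within_nhd[of _ "{..<c}"]) (use 1 assms in auto)
    then show ?thesis using 1 assms by simp
  next
    case 2
    have "{a..c} \<union> {c..b} = {a..b}" using assms by auto
    moreover have "(f has_real_derivative l c) (at c within {a..c})" "(f has_real_derivative l c) (at c within {c..b})"
      using assms(1)[of c] assms(2)[of c] assms by auto
    then have "(f has_real_derivative l c) (at c within {a..c} \<union> {c..b})"
      by (simp only: has_field_derivative_iff) (simp only: at_within_union filterlim_sup)
    ultimately show ?thesis using 2 by simp
  next
    case 3
    have "at s within {a..b} = at s within {c..b}"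
      by (rule at_within_nhd[of _ "{c<..}"]) (use 3 assms in auto)
    then show ?thesis using 3 assms by simp
  qed
qed

context curve_domain
begin

text \<open>The sum f + h + k after elimination of f(x) = g(x, 0) - k(n x) and h(y) = g(0, y) - k(-
  m y). The value k 0 = g(0, 0) is what makes the sum agree with g on the axes.\<close>

definition decomposes :: "(real \<times> real \<Rightarrow> real) \<Rightarrow> (real \<times> real \<Rightarrow> real) \<Rightarrow> (real \<Rightarrow> real) \<Rightarrow> bool" where
  "decomposes u g k \<longleftrightarrow> k 0 = g (0, 0) \<and> (\<forall>p\<in>closed_region. u p =
    g (fst p, 0) + g (0, snd p) + k (height p) - k (n * fst p) - k (- (m * snd p)))"

lemma closed_region_coords: "p \<in> closed_region \<Longrightarrow> fst p \<in> {0..1} \<and> snd p \<in> {0..1}"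
proof -
  assume p: "p \<in> closed_region"
  then have "n * fst p \<le> \<delta> (height p)" by (simp add: closed_region_def gap_def)
  moreover have "\<delta> (height p) \<le> n" "\<delta> (height p) - height p \<le> m"
    using \<delta>_bounds(2,3)[OF closed_region_height[OF p]] by auto
  ultimately have "n * fst p \<le> n * 1" "m * snd p \<le> m * 1" by (auto simp: height_def)
  then show ?thesis using p mn by (auto simp: closed_region_def)
qed

lemma region_coords:
  assumes "(x, y) \<in> region"
  shows "0 < x" "x < 1" "0 < y" "y < 1"
proof -
  have xy: "(x, y) \<in> closed_region" "0 < x" "0 < y" "n * x < \<delta> (height (x, y))"
    using assms region_subset by (auto simp: region_def gap_def)
  have "n * x < n * 1" "m * y < m * 1"
    using xy \<delta>_bounds(2,3)[OF closed_region_height[OF xy(1)]] by (auto simp: height_def)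
  then show "0 < x" "x < 1" "0 < y" "y < 1" using xy mn by auto
qed

lemma axis_in_closed_region:
  "x \<in> {0..1} \<Longrightarrow> (x, 0) \<in> closed_region" "y \<in> {0..1} \<Longrightarrow> (0, y) \<in> closed_region"
  using boundary_subset by (auto simp: axis1 axis2)

lemma point_in_closed_region: "s \<in> {- m..n} \<Longrightarrow> point s \<in> closed_region"
  using boundary_subset by auto

lemma eventually_point_near_axis:
  assumes "p \<in> region"
  shows "\<forall>\<^sub>F \<epsilon> in at_right 0. 0 < \<epsilon> \<and> \<epsilon> < fst p \<and> \<epsilon> < snd p"
proof -
  have "0 < fst p" "0 < snd p" using assms by (auto simp: region_def)
  then show ?thesis
    by (intro eventually_conj) (auto simp: eventually_at_right_less intro: order_tendstoD(2)[OF tendsto_ident_at])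
qed

text \<open>The rectangle identity with lower left corner (\<epsilon>, \<epsilon>), followed by
  \<epsilon> -> 0; continuity of V up to the boundary supplies the limits.\<close>

lemma mixed_difference_zero:
  assumes V: "continuous_on closed_region V"
    and weak: "\<And>\<phi>. test_function region \<phi> \<Longrightarrow> (LINT p:region|lborel. V p * partial_x (partial_y \<phi>) p) = 0"
    and p: "(x, y) \<in> region"
  shows "V (x, y) = V (x, 0) + V (0, y) - V (0, 0)"
proof -
  have Vr: "continuous_on region V" by (rule continuous_on_subset[OF V region_subset])
  have rect: "V (x, y) - V (x, \<epsilon>) - V (\<epsilon>, y) + V (\<epsilon>, \<epsilon>) = 0" if \<epsilon>: "0 < \<epsilon>" "\<epsilon> < x" "\<epsilon> < y" for \<epsilon>
  proof -
    \<comment> \<open>\<open>rectangle_identity\<close> needs a margin beyond the upper right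
      corner, which openness of the region provides.\<close>
    have "\<forall>\<^sub>F t in at_right 0. (x + t, y + t) \<in> region"
    proof (rule topological_tendstoD[OF _ region_open p])
      have "((\<lambda>t. (x + t, y + t)) \<longlongrightarrow> (x + 0, y + 0)) (at_right 0)" by (intro tendsto_intros)
      then show "((\<lambda>t. (x + t, y + t)) \<longlongrightarrow> (x, y)) (at_right 0)" by simp
    qed
    moreover have "\<forall>\<^sub>F t in at_right 0. 0 < (t :: real)" by (simp add: eventually_at_right_less)
    ultimately have "\<forall>\<^sub>F t in at_right (0 :: real). (x + t, y + t) \<in> region \<and> 0 < t"
      by (rule eventually_conj)
    then obtain t where t: "(x + t, y + t) \<in> region" "0 < t"
      using eventually_happens trivial_limit_at_right_real by blast
    have "cbox (\<epsilon>, \<epsilon>) (x + t, y + t) \<subseteq> region"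
      using region_downward[OF t(1)] \<epsilon> by (auto simp: cbox_Pair_eq)
    from rectangle_identity[OF region_open Vr t(2) \<epsilon>(2,3) this weak] show ?thesis by simp
  qed
  note near = eventually_point_near_axis[OF p]
  have lim: "((\<lambda>\<epsilon>. V (f \<epsilon>)) \<longlongrightarrow> V q) (at_right 0)"
    if "(f \<longlongrightarrow> q) (at_right 0)" "q \<in> closed_region" "\<And>\<epsilon>. 0 < \<epsilon> \<Longrightarrow> \<epsilon> < x \<Longrightarrow> \<epsilon> < y \<Longrightarrow> f \<epsilon> \<in> region"
    for f :: "real \<Rightarrow> _" and q
  proof (rule continuous_on_tendsto_compose[OF V that(1,2)])
    show "\<forall>\<^sub>F \<epsilon> in at_right 0. f \<epsilon> \<in> closed_region"
      using near by eventually_elim (use that(3) region_subset in auto)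
  qed
  have xy: "x \<in> {0..1}" "y \<in> {0..1}" "0 < x" "0 < y"
    using closed_region_coords[OF subsetD[OF region_subset p]] p by (auto simp: region_def)
  have lx: "((\<lambda>\<epsilon>. V (x, \<epsilon>)) \<longlongrightarrow> V (x, 0)) (at_right 0)"
    by (rule lim) (use xy axis_in_closed_region region_downward[OF p] in \<open>auto intro!: tendsto_intros\<close>)
  have ly: "((\<lambda>\<epsilon>. V (\<epsilon>, y)) \<longlongrightarrow> V (0, y)) (at_right 0)"
    by (rule lim) (use xy axis_in_closed_region region_downward[OF p] in \<open>auto intro!: tendsto_intros\<close>)
  have l0: "((\<lambda>\<epsilon>. V (\<epsilon>, \<epsilon>)) \<longlongrightarrow> V (0, 0)) (at_right 0)"
    by (rule lim) (use axis_in_closed_region(1)[of 0] region_downward[OF p] in \<open>auto intro!: tendsto_intros\<close>)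
  have "((\<lambda>\<epsilon>. V (x, y) - V (x, \<epsilon>) - V (\<epsilon>, y) + V (\<epsilon>, \<epsilon>)) \<longlongrightarrow> V (x, y) - V (x, 0) - V (0, y) + V (0, 0)) (at_right 0)"
    by (intro tendsto_intros lx ly l0)
  moreover have "((\<lambda>\<epsilon>. V (x, y) - V (x, \<epsilon>) - V (\<epsilon>, y) + V (\<epsilon>, \<epsilon>)) \<longlongrightarrow> 0) (at_right 0)"
    by (rule tendsto_eventually, use near in eventually_elim) (use rect in auto)
  ultimately have "V (x, y) - V (x, 0) - V (0, y) + V (0, 0) = 0"
    using tendsto_unique trivial_limit_at_right_real by blast
  then show ?thesis by simp
qed

text \<open>m R1 + n R2 is the derivative along the characteristic through p, which runs inside the
  region until it hits the curve at \<open>point (height p)\<close>.\<close>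

lemma const_along_lines:
  assumes R: "continuous_on closed_region R" and c: "continuous_on region R2"
    and d: "\<And>x y. (x, y) \<in> region \<Longrightarrow> ((\<lambda>t. R (t, y)) has_real_derivative R1 (x, y)) (at x)"
      "\<And>x y. (x, y) \<in> region \<Longrightarrow> ((\<lambda>t. R (x, t)) has_real_derivative R2 (x, y)) (at y)"
    and zero: "\<And>p. p \<in> region \<Longrightarrow> m * R1 p + n * R2 p = 0"
    and p: "p \<in> closed_region"
  shows "R p = R (point (height p))"
proof (cases "gap p = 0")
  case True
  then show ?thesis using point_height[of p] by (simp flip: zero_prod_def)
next
  case False
  define T where "T = gap p / (m * n)"
  have "gap p > 0" using False p by (simp add: closed_region_def)
  then have T: "T > 0" "T * (m * n) = gap p" using mn by (auto simp: T_def)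
  have end_T: "p + T *\<^sub>R (m, n) = point (height p)" unfolding T_def by (rule point_height)
  have inR: "p + t *\<^sub>R (m, n) \<in> region" if "0 < t" "t < T" for t
    by (rule line_in_region[OF p]) (use that T mult_strict_right_mono[of t T "m * n"] mn in auto)
  have "R (p + T *\<^sub>R (m, n)) = R (p + 0 *\<^sub>R (m, n))"
  proof (rule DERIV_isconst_end[OF T(1)])
    have "p + t *\<^sub>R (m, n) \<in> closed_region" if t: "t \<in> {0..T}" for t
    proof -
      consider "t = 0" | "0 < t" "t < T" | "t = T" using t by fastforce
      then show ?thesis
      proof cases
        case 1
        then show ?thesis using p by (simp flip: zero_prod_def)
      next
        case 2
        then show ?thesis using inR region_subset by blast
      next
        case 3
        then show ?thesis using end_T point_in_closed_region[OF closed_region_height[OF p]] by simp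
      qed
    qed
    then show "continuous_on {0..T} (\<lambda>t. R (p + t *\<^sub>R (m, n)))"
      by (intro continuous_on_compose2[OF R] continuous_intros) auto
    show "((\<lambda>t. R (p + t *\<^sub>R (m, n))) has_real_derivative 0) (at t)" if "0 < t" "t < T" for t
      by (rule DERIV_cong[OF DERIV_along_line[OF region_open c d inR[OF that]]])
         (use zero[OF inR[OF that]] in \<open>auto simp: mult.commute\<close>)
  qed
  then show ?thesis using end_T by (simp flip: zero_prod_def)
qed

text \<open>The profile \<open>k\<close> is read off the two axes, hence only one-sided derivatives at \<open>0\<close> are
  immediate. They agree because the characteristic line through the origin meets the interior.\<close>

lemma solution_decomposes:
  assumes sol: "generalized_solution m n region g u"
    and u: "continuous_on closed_region u1" "continuous_on closed_region u2"
    and d: "\<And>x y. (x, y) \<in> region \<Longrightarrow> ((\<lambda>t. u (t, y)) has_real_derivative u1 (x, y)) (at x)"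
      "\<And>x y. (x, y) \<in> region \<Longrightarrow> ((\<lambda>t. u (x, t)) has_real_derivative u2 (x, y)) (at y)"
    and gx: "\<And>x. x \<in> {0..1} \<Longrightarrow> ((\<lambda>x. g (x, 0)) has_real_derivative gx x) (at x within {0..1})"
      "continuous_on {0..1} gx"
    and gy: "\<And>y. y \<in> {0..1} \<Longrightarrow> ((\<lambda>y. g (0, y)) has_real_derivative gy y) (at y within {0..1})"
      "continuous_on {0..1} gy"
  obtains k w where "decomposes u g k" "continuous_on {- m..n} w"
    "\<And>s. s \<in> {- m..n} \<Longrightarrow> (k has_real_derivative w s) (at s within {- m..n})"
proof -
  have uc: "continuous_on closed_region u" and bd: "\<And>p. p \<in> boundary \<Longrightarrow> u p = g p"
    using sol by (auto simp: generalized_solution_def closure_region frontier_region)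
  note cr = continuous_on_subset[OF _ region_subset]
  define V where "V p = m * u1 p + n * u2 p" for p
  have Vc: "continuous_on closed_region V" unfolding V_def[abs_def] by (intro continuous_intros u)
  have Vsum: "V (x, y) = V (x, 0) + V (0, y) - V (0, 0)" if "(x, y) \<in> region" for x y
  proof (rule mixed_difference_zero[OF Vc _ that])
    fix \<phi> assume \<phi>: "test_function region \<phi>"
    then show "(LINT p:region|lborel. V p * partial_x (partial_y \<phi>) p) = 0"
      using weak_form_first_order[OF region_open \<phi> cr[OF uc] cr[OF u(1)] cr[OF u(2)] d, of m n] sol
      by (simp add: V_def generalized_solution_def)
  qed
  \<comment> \<open>V splits as A(x) + B(y), with the correction V(0, 0) assigned to A.\<close>
  define A where "A x = V (x, 0) - V (0, 0)" for x
  define B where "B y = V (0, y)" for y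
  \<comment> \<open>With m f' = A and n h' = B, the remainder u - f - h is annihilated by m d/dx + n
    d/dy and so depends on the height alone.\<close>
  define f where "f x = integral {0..x} A / m" for x
  define h where "h y = integral {0..y} B / n" for y
  have Ac: "continuous_on {0..1} A"
    unfolding A_def[abs_def]
    by (intro continuous_intros continuous_on_compose2[OF Vc] image_subsetI axis_in_closed_region)
  have Bc: "continuous_on {0..1} B"
    unfolding B_def[abs_def]
    by (intro continuous_intros continuous_on_compose2[OF Vc] image_subsetI axis_in_closed_region)
  have fd: "(f has_real_derivative A x / m) (at x within {0..1})" if "x \<in> {0..1}" for x
    unfolding f_def[abs_def] by (rule DERIV_cdivide[OF DERIV_integral_Icc[OF Ac that]])
  have hd: "(h has_real_derivative B y / n) (at y within {0..1})" if "y \<in> {0..1}" for y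
    unfolding h_def[abs_def] by (rule DERIV_cdivide[OF DERIV_integral_Icc[OF Bc that]])
  have f0: "f 0 = 0" and h0: "h 0 = 0" by (simp_all add: f_def h_def)
  have fc: "continuous_on {0..1} f" by (rule DERIV_continuous_on[OF fd])
  have hc: "continuous_on {0..1} h" by (rule DERIV_continuous_on[OF hd])
  define R where "R p = u p - f (fst p) - h (snd p)" for p
  define R1 where "R1 p = u1 p - A (fst p) / m" for p
  define R2 where "R2 p = u2 p - B (snd p) / n" for p
  have coords: "fst ` closed_region \<subseteq> {0..1}" "snd ` closed_region \<subseteq> {0..1}"
    using closed_region_coords by auto
  have Rc: "continuous_on closed_region R"
    unfolding R_def[abs_def]
    by (intro continuous_on_diff uc continuous_on_compose2[OF fc _ coords(1)]
        continuous_on_compose2[OF hc _ coords(2)] continuous_on_fst continuous_on_snd continuous_on_id)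
  have R2c: "continuous_on region R2"
    unfolding R2_def[abs_def]
    by (intro cr continuous_on_diff u continuous_on_divide continuous_on_compose2[OF Bc _ coords(2)]
        continuous_on_snd continuous_on_id continuous_on_const) (use mn in auto)
  have R1d: "((\<lambda>t. R (t, y)) has_real_derivative R1 (x, y)) (at x)" if "(x, y) \<in> region" for x y
  proof -
    have "(f has_real_derivative A x / m) (at x)"
      using fd[of x] region_coords[OF that] by (simp add: at_within_Icc_at)
    then show ?thesis
      unfolding R_def R1_def by (auto intro!: derivative_eq_intros d(1)[OF that])
  qed
  have R2d: "((\<lambda>t. R (x, t)) has_real_derivative R2 (x, y)) (at y)" if "(x, y) \<in> region" for x y
  proof -
    have "(h has_real_derivative B y / n) (at y)"
      using hd[of y] region_coords[OF that] by (simp add: at_within_Icc_at)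
    then show ?thesis
      unfolding R_def R2_def by (auto intro!: derivative_eq_intros d(2)[OF that])
  qed
  have R0: "m * R1 p + n * R2 p = 0" if "p \<in> region" for p
  proof -
    have "m * R1 p = m * u1 p - A (fst p)" "n * R2 p = n * u2 p - B (snd p)"
      using mn by (simp_all add: R1_def R2_def right_diff_distrib)
    then have "m * R1 p + n * R2 p = V p - A (fst p) - B (snd p)" by (simp add: V_def)
    then show ?thesis using Vsum[of "fst p" "snd p"] that by (simp add: A_def B_def)
  qed
  define k where "k s = R (point s)" for s
  have Rk: "R p = k (height p)" if "p \<in> closed_region" for p
    unfolding k_def by (rule const_along_lines[OF Rc R2c R1d R2d R0 that])
  have kx: "k (n * x) = g (x, 0) - f x" if "x \<in> {0..1}" for x
    using Rk[OF axis_in_closed_region(1)[OF that]] bd[of "(x, 0)"] that h0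
    by (simp add: R_def height_def axis1)
  have ky: "k (- (m * y)) = g (0, y) - h y" if "y \<in> {0..1}" for y
    using Rk[OF axis_in_closed_region(2)[OF that]] bd[of "(0, y)"] that f0
    by (simp add: R_def height_def axis2)
  \<comment> \<open>Derivatives of the profile as read off the x-axis, for s >= 0, and off the
    y-axis, for s <= 0.\<close>
  define kr where "kr s = (gx (s / n) - A (s / n) / m) * (1 / n)" for s
  define kl where "kl s = (gy (- s / m) - B (- s / m) / n) * (- 1 / m)" for s
  have r: "(k has_real_derivative kr s) (at s within {0..n})" if s: "s \<in> {0..n}" for s
  proof -
    have im: "(\<lambda>s. s / n) ` {0..n} \<subseteq> {0..1}" using mn by auto
    have "((\<lambda>s. s / n) has_real_derivative 1 / n) (at s within {0..n})"
      using mn by (auto intro!: derivative_eq_intros)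
    moreover have "s / n \<in> {0..1}" using im s by blast
    ultimately have "((\<lambda>s. g (s / n, 0) - f (s / n)) has_real_derivative kr s) (at s within {0..n})"
      using DERIV_compose_within[OF _ DERIV_diff[OF gx(1) fd] im] unfolding kr_def by blast
    then show ?thesis
      by (rule has_field_derivative_transform_within[OF _ zero_less_one s])
         (use kx[of "_ / n"] im mn in auto)
  qed
  have l: "(k has_real_derivative kl s) (at s within {- m..0})" if s: "s \<in> {- m..0}" for s
  proof -
    have im: "(\<lambda>s. - s / m) ` {- m..0} \<subseteq> {0..1}" using mn by (auto simp: field_simps)
    have ky': "k s = g (0, - s / m) - h (- s / m)" if "s \<in> {- m..0}" for s
      using ky[OF subsetD[OF im imageI[OF that]]] mn by simp
    have "((\<lambda>s. - s / m) has_real_derivative - 1 / m) (at s within {- m..0})"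
      using mn by (auto intro!: derivative_eq_intros)
    moreover have "- s / m \<in> {0..1}" using im s by blast
    ultimately have "((\<lambda>s. g (0, - s / m) - h (- s / m)) has_real_derivative kl s) (at s within {- m..0})"
      using DERIV_compose_within[OF _ DERIV_diff[OF gy(1) hd] im] unfolding kl_def by blast
    then show ?thesis
      by (rule has_field_derivative_transform_within[OF _ zero_less_one s])
         (use ky' in simp)
  qed
  have "kl 0 = kr 0"
  proof -
    have "gap (0, 0) > 0" using strict[of 0] mn by (simp add: gap_def height_def)
    define t where "t = gap (0, 0) / (2 * (m * n))"
    have "0 < t" "t * (m * n) < gap (0, 0)" using \<open>gap (0, 0) > 0\<close> mn by (auto simp: t_def)
    then have "(0, 0) + t *\<^sub>R (m, n) \<in> region"
      by (intro line_in_region axis_in_closed_region) auto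
    then have p0: "(t * m, t * n) \<in> region" by simp
    \<comment> \<open>On the horizontal line through the interior point (t m, t n), the point with
      abscissa t m + s / n has height s. There k equals R and is differentiable from both sides of
      0.\<close>
    let ?S = "{s. (t * m + s / n, t * n) \<in> region}"
    have "open ?S"
    proof -
      have "open ((\<lambda>s. (t * m + s / n, t * n)) -` region)"
        by (rule continuous_open_vimage[OF region_open]) (use mn in \<open>auto intro!: continuous_intros\<close>)
      then show ?thesis by (simp add: vimage_def)
    qed
    have "((\<lambda>s. R (t * m + s / n, t * n)) has_real_derivative R1 (t * m + 0 / n, t * n) * (1 / n)) (at 0)"
      by (rule DERIV_chain2[where f="\<lambda>x. R (x, t * n)"])
         (use p0 mn in \<open>auto intro!: R1d derivative_eq_intros\<close>)
    then have D: "(k has_real_derivative R1 (t * m + 0 / n, t * n) * (1 / n)) (at 0)"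
    proof (rule has_field_derivative_transform_within_open[OF _ \<open>open ?S\<close>])
      fix s assume "s \<in> ?S"
      then have "(t * m + s / n, t * n) \<in> closed_region" using region_subset by auto
      from Rk[OF this] show "R (t * m + s / n, t * n) = k s"
        using mn by (simp add: height_def algebra_simps)
    qed (use p0 in simp)
    show ?thesis
      using DERIV_within_Icc_unique[OF l[of 0] has_field_derivative_at_within[OF D]]
        DERIV_within_Icc_unique[OF r[of 0] has_field_derivative_at_within[OF D]] mn
      by simp
  qed
  define w where "w s = (if s \<le> 0 then kl s else kr s)" for s
  have kd: "(k has_real_derivative w s) (at s within {- m..n})" if "s \<in> {- m..n}" for s
    unfolding w_def by (rule DERIV_glue[OF l r \<open>kl 0 = kr 0\<close> _ _ that]) (use mn in auto)
  have "continuous_on {- m..0} kl"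
  proof -
    have "continuous_on {0..1} (\<lambda>y. gy y - B y / n)" by (intro continuous_intros gy Bc) (use mn in auto)
    then have "continuous_on {- m..0} (\<lambda>s. gy (- s / m) - B (- s / m) / n)"
      by (rule continuous_on_compose2[where f="\<lambda>s. - s / m"])
         (use mn in \<open>auto intro!: continuous_intros simp: field_simps\<close>)
    then show ?thesis unfolding kl_def[abs_def] by (rule continuous_on_mult) (rule continuous_on_const)
  qed
  moreover have "continuous_on {0..n} kr"
  proof -
    have "continuous_on {0..1} (\<lambda>x. gx x - A x / m)" by (intro continuous_intros gx Ac) (use mn in auto)
    then have "continuous_on {0..n} (\<lambda>s. gx (s / n) - A (s / n) / m)"
      by (rule continuous_on_compose2[where f="\<lambda>s. s / n"])
         (use mn in \<open>auto intro!: continuous_intros simp: field_simps\<close>)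
    then show ?thesis unfolding kr_def[abs_def] by (rule continuous_on_mult) (rule continuous_on_const)
  qed
  moreover have "kl s = w s" if "s \<in> {- m..0}" for s using that by (simp add: w_def)
  moreover have "kr s = w s" if "s \<in> {0..n}" for s
    using that \<open>kl 0 = kr 0\<close> by (cases "s = 0") (simp_all add: w_def)
  ultimately have "continuous_on {- m..0} w" "continuous_on {0..n} w"
    using continuous_on_eq by blast+
  then have "continuous_on ({- m..0} \<union> {0..n}) w"
    by (intro continuous_on_closed_Un) auto
  moreover have "{- m..0} \<union> {0..n} = {- m..n}" using mn by auto
  ultimately have "continuous_on {- m..n} w" by simp
  moreover have "decomposes u g k"
    unfolding decomposes_def
  proof (intro conjI ballI)
    show "k 0 = g (0, 0)" using kx[of 0] f0 by simp
    fix p assume p: "p \<in> closed_region"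
    then show "u p = g (fst p, 0) + g (0, snd p) + k (height p) - k (n * fst p) - k (- (m * snd p))"
      using closed_region_coords[OF p] kx[of "fst p"] ky[of "snd p"] Rk[OF p] by (simp add: R_def)
  qed
  ultimately show thesis using that kd by blast
qed

end

subsection \<open>Unique solvability and minimality\<close>

lemma C_diff_on_2:
  "C_diff_on 2 S f \<longleftrightarrow> (\<exists>f' f''. (\<forall>x\<in>S. (f has_real_derivative f' x) (at x within S)) \<and>
    (\<forall>x\<in>S. (f' has_real_derivative f'' x) (at x within S)) \<and> continuous_on S f'')"
  by (auto simp: numeral_2_eq_2)

lemma C_diff_on_2D:
  assumes "C_diff_on 2 S f"
  obtains f' f'' where "\<And>x. x \<in> S \<Longrightarrow> (f has_real_derivative f' x) (at x within S)"
    "\<And>x. x \<in> S \<Longrightarrow> (f' has_real_derivative f'' x) (at x within S)"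
    "continuous_on S f" "continuous_on S f'" "continuous_on S f''"
proof -
  obtain f' f'' where f: "\<And>x. x \<in> S \<Longrightarrow> (f has_real_derivative f' x) (at x within S)"
    "\<And>x. x \<in> S \<Longrightarrow> (f' has_real_derivative f'' x) (at x within S)" "continuous_on S f''"
    using assms unfolding C_diff_on_2 by blast
  then show thesis using that DERIV_continuous_on by metis
qed

lemma C_diff_on_2_cong:
  assumes "C_diff_on 2 S f" "\<And>x. x \<in> S \<Longrightarrow> f x = g x"
  shows "C_diff_on 2 S g"
  using assms has_field_derivative_transform_within[OF _ zero_less_one, of f _ _ S g]
  unfolding C_diff_on_2 by blast

lemma C_diff_on_2_diff:
  assumes "C_diff_on 2 S f" "C_diff_on 2 S g"
  shows "C_diff_on 2 S (\<lambda>x. f x - g x)"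
proof -
  obtain f' f'' where f: "\<And>x. x \<in> S \<Longrightarrow> (f has_real_derivative f' x) (at x within S)"
    "\<And>x. x \<in> S \<Longrightarrow> (f' has_real_derivative f'' x) (at x within S)" "continuous_on S f''"
    using assms(1) unfolding C_diff_on_2 by blast
  obtain g' g'' where g: "\<And>x. x \<in> S \<Longrightarrow> (g has_real_derivative g' x) (at x within S)"
    "\<And>x. x \<in> S \<Longrightarrow> (g' has_real_derivative g'' x) (at x within S)" "continuous_on S g''"
    using assms(2) unfolding C_diff_on_2 by blast
  show ?thesis
    unfolding C_diff_on_2
    by (rule exI[of _ "\<lambda>x. f' x - g' x"], rule exI[of _ "\<lambda>x. f'' x - g'' x"])
       (auto intro!: DERIV_diff f g continuous_on_diff)
qed

lemma C_diff_on_2_compose: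
  assumes "C_diff_on 2 T f" "C_diff_on 2 S g" "g ` S \<subseteq> T"
  shows "C_diff_on 2 S (\<lambda>x. f (g x))"
proof -
  obtain f' f'' where f: "\<And>x. x \<in> T \<Longrightarrow> (f has_real_derivative f' x) (at x within T)"
    "\<And>x. x \<in> T \<Longrightarrow> (f' has_real_derivative f'' x) (at x within T)"
    "continuous_on T f" "continuous_on T f'" "continuous_on T f''"
    using C_diff_on_2D[OF assms(1)] by metis
  obtain g' g'' where g: "\<And>x. x \<in> S \<Longrightarrow> (g has_real_derivative g' x) (at x within S)"
    "\<And>x. x \<in> S \<Longrightarrow> (g' has_real_derivative g'' x) (at x within S)"
    "continuous_on S g" "continuous_on S g'" "continuous_on S g''"
    using C_diff_on_2D[OF assms(2)] by metis
  have im: "g x \<in> T" if "x \<in> S" for x using that assms(3) by auto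
  have 1: "((\<lambda>x. f (g x)) has_real_derivative f' (g x) * g' x) (at x within S)" if "x \<in> S" for x
    by (rule DERIV_compose_within[OF g(1)[OF that] f(1)[OF im[OF that]] assms(3)])
  have 2: "((\<lambda>x. f' (g x)) has_real_derivative f'' (g x) * g' x) (at x within S)" if "x \<in> S" for x
    by (rule DERIV_compose_within[OF g(1)[OF that] f(2)[OF im[OF that]] assms(3)])
  have 3: "((\<lambda>x. f' (g x) * g' x) has_real_derivative f'' (g x) * g' x * g' x + g'' x * f' (g x)) (at x within S)"
    if "x \<in> S" for x
    by (rule DERIV_mult[OF 2[OF that] g(2)[OF that]])
  have 4: "continuous_on S (\<lambda>x. f'' (g x) * g' x * g' x + g'' x * f' (g x))"
    by (intro continuous_on_add continuous_on_mult g continuous_on_compose2[OF f(5) g(3) assms(3)]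
        continuous_on_compose2[OF f(4) g(3) assms(3)])
  show ?thesis
    unfolding C_diff_on_2
    by (rule exI[of _ "\<lambda>x. f' (g x) * g' x"], rule exI[of _ "\<lambda>x. f'' (g x) * g' x * g' x + g'' x * f' (g x)"])
       (intro conjI ballI 1 3 4)
qed

lemma C_diff_on_2_affine: "C_diff_on 2 S (\<lambda>x. c * x + e)"
  unfolding C_diff_on_2
  by (rule exI[of _ "\<lambda>_. c"], rule exI[of _ "\<lambda>_. 0"]) (auto intro!: derivative_eq_intros)

lemma C_diff_upto_2I:
  assumes "continuous_on W f" "continuous_on W f1" "continuous_on W f2"
    "continuous_on W f11" "continuous_on W f12" "continuous_on W f22"
    and "\<And>x y. (x, y) \<in> U \<Longrightarrow> ((\<lambda>t. f (t, y)) has_real_derivative f1 (x, y)) (at x)"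
    "\<And>x y. (x, y) \<in> U \<Longrightarrow> ((\<lambda>t. f (x, t)) has_real_derivative f2 (x, y)) (at y)"
    "\<And>x y. (x, y) \<in> U \<Longrightarrow> ((\<lambda>t. f1 (t, y)) has_real_derivative f11 (x, y)) (at x)"
    "\<And>x y. (x, y) \<in> U \<Longrightarrow> ((\<lambda>t. f1 (x, t)) has_real_derivative f12 (x, y)) (at y)"
    "\<And>x y. (x, y) \<in> U \<Longrightarrow> ((\<lambda>t. f2 (t, y)) has_real_derivative f12 (x, y)) (at x)"
    "\<And>x y. (x, y) \<in> U \<Longrightarrow> ((\<lambda>t. f2 (x, t)) has_real_derivative f22 (x, y)) (at y)"
  shows "C_diff_upto 2 U W f"
proof -
  have "C_diff_upto (Suc 0) U W f1" "C_diff_upto (Suc 0) U W f2"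
    using assms unfolding C_diff_upto.simps by blast+
  then show ?thesis
    unfolding numeral_2_eq_2 C_diff_upto.simps(2)[of "Suc 0"] using assms by blast
qed

section \<open>Solutions and the functional equation\<close>

context curve_domain
begin

definition C2_data :: "(real \<times> real \<Rightarrow> real) \<Rightarrow> bool" where
  "C2_data g \<longleftrightarrow> C_diff_on 2 {0..1} (\<lambda>x. g (x, 0)) \<and> C_diff_on 2 {0..1} (\<lambda>y. g (0, y)) \<and>
    C_diff_on 2 {- m..n} (\<lambda>s. g (point s))"

definition classical_solution :: "(real \<times> real \<Rightarrow> real) \<Rightarrow> (real \<times> real \<Rightarrow> real) \<Rightarrow> bool" where
  "classical_solution g u \<longleftrightarrow> generalized_solution m n region g u \<and> C2_closure region u"

lemma classical_solution_decomposes: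
  assumes "classical_solution g u" "C2_data g"
  obtains k w where "decomposes u g k" "continuous_on {- m..n} w"
    "\<And>s. s \<in> {- m..n} \<Longrightarrow> (k has_real_derivative w s) (at s within {- m..n})"
proof -
  obtain u1 u2 where u: "\<And>x y. (x, y) \<in> region \<Longrightarrow> ((\<lambda>t. u (t, y)) has_real_derivative u1 (x, y)) (at x)"
    "\<And>x y. (x, y) \<in> region \<Longrightarrow> ((\<lambda>t. u (x, t)) has_real_derivative u2 (x, y)) (at y)"
    "continuous_on closed_region u1" "continuous_on closed_region u2"
    using assms(1) by (auto simp: classical_solution_def C2_closure_def closure_region numeral_2_eq_2)
  obtain gx where gx: "\<And>x. x \<in> {0..1} \<Longrightarrow> ((\<lambda>x. g (x, 0)) has_real_derivative gx x) (at x within {0..1})"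
    "continuous_on {0..1} gx"
    using C_diff_on_2D[of "{0..1}" "\<lambda>x. g (x, 0)"] assms(2) unfolding C2_data_def by metis
  obtain gy where gy: "\<And>y. y \<in> {0..1} \<Longrightarrow> ((\<lambda>y. g (0, y)) has_real_derivative gy y) (at y within {0..1})"
    "continuous_on {0..1} gy"
    using C_diff_on_2D[of "{0..1}" "\<lambda>y. g (0, y)"] assms(2) unfolding C2_data_def by metis
  have "generalized_solution m n region g u" using assms(1) by (simp add: classical_solution_def)
  from solution_decomposes[OF this u(3,4,1,2) gx gy that] show thesis .
qed

text \<open>The right-hand side G of the functional equation. At both ends of the curve it equals -
  g(0, 0), which is the compatibility condition for solving that equation.\<close>

definition defect :: "(real \<times> real \<Rightarrow> real) \<Rightarrow> real \<Rightarrow> real" where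
  "defect g s = g (point s) - g (\<delta> s / n, 0) - g (0, (\<delta> s - s) / m)"

lemma decomposes_functional_equation:
  assumes "decomposes u g k" "generalized_solution m n region g u" "s \<in> {- m..n}"
  shows "k s - k (\<delta> s) - k (s - \<delta> s) = defect g s"
proof -
  have "u (point s) = g (point s)"
    using assms(2,3) by (auto simp: generalized_solution_def frontier_region)
  moreover have "n * fst (point s) = \<delta> s" "- (m * snd (point s)) = s - \<delta> s"
    using mn by (auto simp: point_def)
  moreover have "defect g s = g (point s) - g (fst (point s), 0) - g (0, snd (point s))"
    by (simp add: defect_def point_def)
  ultimately show ?thesis
    using bspec[OF conjunct2[OF assms(1)[unfolded decomposes_def]] point_in_closed_region[OF assms(3)]]
    by simp
qed

text \<open>The difference q of two profiles solves the homogeneous equation, so q' is constant by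
  the maximum principle and q(s) = c s. A linear profile contributes nothing to u because
  \<open>height p\<close> is the sum of n x and - m y.\<close>

lemma minimal_imp_unique:
  assumes minimal "classical_solution g u" "classical_solution g v" "C2_data g" "p \<in> closed_region"
  shows "v p = u p"
proof -
  obtain k w where k: "decomposes u g k" "continuous_on {- m..n} w"
    "\<And>s. s \<in> {- m..n} \<Longrightarrow> (k has_real_derivative w s) (at s within {- m..n})"
    using classical_solution_decomposes[OF assms(2,4)] by metis
  obtain l z where l: "decomposes v g l" "continuous_on {- m..n} z"
    "\<And>s. s \<in> {- m..n} \<Longrightarrow> (l has_real_derivative z s) (at s within {- m..n})"
    using classical_solution_decomposes[OF assms(3,4)] by metis
  define q where "q s = k s - l s" for s
  have q: "(q has_real_derivative w s - z s) (at s within {- m..n})" if "s \<in> {- m..n}" for s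
    unfolding q_def[abs_def] by (rule DERIV_diff[OF k(3)[OF that] l(3)[OF that]])
  have q_eq: "q s - q (\<delta> s) - q (s - \<delta> s) = 0" if "s \<in> {- m..n}" for s
    using decomposes_functional_equation[OF k(1) _ that] decomposes_functional_equation[OF l(1) _ that] assms(2,3)
    by (simp add: q_def classical_solution_def)
  have "w s - z s = d s * (w (\<delta> s) - z (\<delta> s)) + (1 - d s) * (w (s - \<delta> s) - z (s - \<delta> s))"
    if s: "s \<in> {- m..n}" for s
  proof -
    have "((\<lambda>s. q s - q (\<delta> s) - q (s - \<delta> s)) has_real_derivative 0) (at s within {- m..n})"
      by (rule has_field_derivative_transform_within[OF DERIV_const[of 0] zero_less_one s]) (simp add: q_eq)
    from DERIV_within_Icc_unique[OF functional_deriv[OF q s] this] show ?thesis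
      using mn s by simp
  qed
  then obtain c where c: "\<And>s. s \<in> {- m..n} \<Longrightarrow> w s - z s = c"
    using maximum_principle[OF \<open>minimal\<close>, of "\<lambda>s. w s - z s"] continuous_on_diff[OF k(2) l(2)] by auto
  have lin: "q s = c * s" if "s \<in> {- m..n}" for s
  proof -
    have D: "((\<lambda>s. q s - c * s) has_real_derivative 0) (at s within {- m..n})" if "s \<in> {- m..n}" for s
      by (rule DERIV_cong[OF DERIV_diff[OF q[OF that] DERIV_cmult_Id]]) (simp add: c[OF that])
    have "q 0 = 0" using k(1) l(1) by (simp add: q_def decomposes_def)
    then show ?thesis
      using DERIV_zero_interval_const[OF D that] DERIV_zero_interval_const[OF D, of 0] mn by simp
  qed
  have "q (height p) - q (n * fst p) - q (- (m * snd p)) = 0"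
  proof -
    have "n * fst p \<in> {- m..n}" "- (m * snd p) \<in> {- m..n}"
      using closed_region_coords[OF assms(5)] mn mult_nonneg_nonneg[of n "fst p"] mult_nonneg_nonneg[of m "snd p"]
      by (auto intro: order_trans[of _ 0] simp: mult_left_le)
    then show ?thesis
      using lin closed_region_height[OF assms(5)] by (simp add: height_def algebra_simps)
  qed
  then show ?thesis
    using k(1) l(1) assms(5) by (simp add: decomposes_def q_def)
qed

lemma \<delta>_C2: "C_diff_on 2 {- m..n} \<delta>"
  unfolding C_diff_on_2 using \<delta>_deriv d_deriv e_cont by blast

lemma defect_C2:
  assumes "C2_data g"
  shows "C_diff_on 2 {- m..n} (defect g)"
proof -
  have "C_diff_on 2 {- m..n} (\<lambda>s. (1 / n) * \<delta> s + 0)"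
    by (rule C_diff_on_2_compose[OF C_diff_on_2_affine[of UNIV] \<delta>_C2]) simp
  then have d1: "C_diff_on 2 {- m..n} (\<lambda>s. \<delta> s / n)" by simp
  have "C_diff_on 2 {- m..n} (\<lambda>s. (- 1 / m) * ((1 * s + 0) - \<delta> s) + 0)"
    by (rule C_diff_on_2_compose[OF C_diff_on_2_affine[of UNIV] C_diff_on_2_diff[OF C_diff_on_2_affine \<delta>_C2]]) simp
  then have d2: "C_diff_on 2 {- m..n} (\<lambda>s. (\<delta> s - s) / m)"
    by (rule C_diff_on_2_cong) (use mn in \<open>simp add: field_simps\<close>)
  have "C_diff_on 2 {- m..n} (\<lambda>s. g (point s) - g (\<delta> s / n, 0) - g (0, (\<delta> s - s) / m))"
  proof (intro C_diff_on_2_diff)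
    show "C_diff_on 2 {- m..n} (\<lambda>s. g (point s))" using assms by (simp add: C2_data_def)
    show "C_diff_on 2 {- m..n} (\<lambda>s. g (\<delta> s / n, 0))"
      by (rule C_diff_on_2_compose[of "{0..1}" "\<lambda>x. g (x, 0)", OF _ d1])
         (use assms \<delta>_bounds mn in \<open>auto simp: C2_data_def\<close>)
    show "C_diff_on 2 {- m..n} (\<lambda>s. g (0, (\<delta> s - s) / m))"
    proof (rule C_diff_on_2_compose[of "{0..1}" "\<lambda>y. g (0, y)", OF _ d2])
      show "(\<lambda>s. (\<delta> s - s) / m) ` {- m..n} \<subseteq> {0..1}"
      proof (rule image_subsetI)
        fix s assume "s \<in> {- m..n}"
        from \<delta>_bounds(3,4)[OF this] show "(\<delta> s - s) / m \<in> {0..1}" using mn by (simp add: field_simps)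
      qed
    qed (use assms in \<open>simp add: C2_data_def\<close>)
  qed
  then show ?thesis by (simp add: defect_def[abs_def])
qed

text \<open>In m u_x + n u_y the two contributions of k' cancel, leaving a function of x plus a
  function of y, whose weak mixed derivative is 0.\<close>

lemma plane_waves_classical_solution:
  assumes k: "\<And>s. s \<in> {- m..n} \<Longrightarrow> (k has_real_derivative w s) (at s within {- m..n})"
    "\<And>s. s \<in> {- m..n} \<Longrightarrow> (w has_real_derivative v s) (at s within {- m..n})" "continuous_on {- m..n} v"
    and f: "\<And>x. x \<in> {0..1} \<Longrightarrow> (f has_real_derivative f' x) (at x within {0..1})"
    "\<And>x. x \<in> {0..1} \<Longrightarrow> (f' has_real_derivative f'' x) (at x within {0..1})" "continuous_on {0..1} f''"
    and h: "\<And>y. y \<in> {0..1} \<Longrightarrow> (h has_real_derivative h' y) (at y within {0..1})"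
    "\<And>y. y \<in> {0..1} \<Longrightarrow> (h' has_real_derivative h'' y) (at y within {0..1})" "continuous_on {0..1} h''"
    and u: "\<And>p. u p = f (fst p) + h (snd p) + k (height p)"
    and bd: "\<And>p. p \<in> boundary \<Longrightarrow> u p = g p"
  shows "classical_solution g u"
proof -
  have coords: "fst ` closed_region \<subseteq> {0..1}" "snd ` closed_region \<subseteq> {0..1}" "height ` closed_region \<subseteq> {- m..n}"
    using closed_region_coords closed_region_height by auto
  have cx: "continuous_on closed_region (\<lambda>p. q (fst p))" if "continuous_on {0..1} q" for q :: "real \<Rightarrow> real"
    by (rule continuous_on_compose2[OF that _ coords(1)]) (intro continuous_intros)
  have cy: "continuous_on closed_region (\<lambda>p. q (snd p))" if "continuous_on {0..1} q" for q :: "real \<Rightarrow> real"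
    by (rule continuous_on_compose2[OF that _ coords(2)]) (intro continuous_intros)
  have cs: "continuous_on closed_region (\<lambda>p. q (height p))" if "continuous_on {- m..n} q" for q :: "real \<Rightarrow> real"
    by (rule continuous_on_compose2[OF that height_cont coords(3)])
  note kc = DERIV_continuous_on[OF k(1)] DERIV_continuous_on[OF k(2)] k(3)
  note fc = DERIV_continuous_on[OF f(1)] DERIV_continuous_on[OF f(2)] f(3)
  note hc = DERIV_continuous_on[OF h(1)] DERIV_continuous_on[OF h(2)] h(3)
  have interior: "x \<in> {0<..<1}" "y \<in> {0<..<1}" "height (x, y) \<in> {- m<..<n}" if "(x, y) \<in> region" for x y
    using region_coords[OF that] region_height[OF that] by auto
  have dx: "(q has_real_derivative q' x) (at x)" if "\<And>x. x \<in> {0..1} \<Longrightarrow> (q has_real_derivative q' x) (at x within {0..1})"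
    "x \<in> {0<..<1}" for q q' :: "real \<Rightarrow> real" and x
    using that(1)[of x] that(2) by (simp add: at_within_Icc_at)
  have ds: "((\<lambda>t. q (height (t, y))) has_real_derivative n * q' (height (x, y))) (at x)"
    "((\<lambda>t. q (height (x, t))) has_real_derivative - m * q' (height (x, y))) (at y)"
    if q: "\<And>s. s \<in> {- m..n} \<Longrightarrow> (q has_real_derivative q' s) (at s within {- m..n})" and "(x, y) \<in> region"
    for q q' :: "real \<Rightarrow> real" and x y
  proof -
    have D: "(q has_real_derivative q' (height (x, y))) (at (height (x, y)))"
      using q[of "height (x, y)"] interior(3)[OF that(2)] by (simp add: at_within_Icc_at)
    show "((\<lambda>t. q (height (t, y))) has_real_derivative n * q' (height (x, y))) (at x)"
      by (rule DERIV_cong[OF DERIV_chain2[where g="\<lambda>t. height (t, y)", OF D, of n]])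
         (auto simp: height_def intro!: derivative_eq_intros)
    show "((\<lambda>t. q (height (x, t))) has_real_derivative - m * q' (height (x, y))) (at y)"
      by (rule DERIV_cong[OF DERIV_chain2[where g="\<lambda>t. height (x, t)", OF D, of "- m"]])
         (auto simp: height_def intro!: derivative_eq_intros)
  qed
  define u1 where "u1 p = f' (fst p) + n * w (height p)" for p
  define u2 where "u2 p = h' (snd p) + - m * w (height p)" for p
  have uc: "continuous_on closed_region u"
    unfolding u[abs_def] by (intro continuous_intros cx cy cs kc fc hc)
  have u1c: "continuous_on closed_region u1"
    unfolding u1_def[abs_def] by (intro continuous_intros cx cs kc fc)
  have u2c: "continuous_on closed_region u2"
    unfolding u2_def[abs_def] by (intro continuous_intros cy cs kc hc)
  have d1: "((\<lambda>t. u (t, y)) has_real_derivative u1 (x, y)) (at x)" if "(x, y) \<in> region" for x y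
    unfolding u u1_def fst_conv snd_conv
    by (rule DERIV_cong[OF DERIV_add[OF DERIV_add[OF _ DERIV_const] ds(1)[OF k(1) that]]])
       (use dx[OF f(1) interior(1)[OF that]] in auto)
  have d2: "((\<lambda>t. u (x, t)) has_real_derivative u2 (x, y)) (at y)" if "(x, y) \<in> region" for x y
    unfolding u u2_def fst_conv snd_conv
    by (rule DERIV_cong[OF DERIV_add[OF DERIV_add[OF DERIV_const] ds(2)[OF k(1) that]]])
       (use dx[OF h(1) interior(2)[OF that]] in auto)
  have "C_diff_upto 2 region closed_region u"
  proof (rule C_diff_upto_2I[OF uc u1c u2c _ _ _ d1 d2])
    show "continuous_on closed_region (\<lambda>p. f'' (fst p) + n * (n * v (height p)))"
      "continuous_on closed_region (\<lambda>p. n * (- m * v (height p)))"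
      "continuous_on closed_region (\<lambda>p. h'' (snd p) + - m * (- m * v (height p)))"
      by (intro continuous_intros cx cy cs kc fc hc)+
    fix x y assume xy: "(x, y) \<in> region"
    show "((\<lambda>t. u1 (t, y)) has_real_derivative f'' (fst (x, y)) + n * (n * v (height (x, y)))) (at x)"
      unfolding u1_def fst_conv snd_conv using dx[OF f(2) interior(1)[OF xy]] ds(1)[OF k(2) xy]
      by (intro DERIV_add DERIV_cmult) auto
    show "((\<lambda>t. u1 (x, t)) has_real_derivative n * (- m * v (height (x, y)))) (at y)"
      unfolding u1_def fst_conv snd_conv using DERIV_add[OF DERIV_const DERIV_cmult[OF ds(2)[OF k(2) xy]]] by simp
    show "((\<lambda>t. u2 (t, y)) has_real_derivative n * (- m * v (height (x, y)))) (at x)"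
      unfolding u2_def fst_conv snd_conv
      by (rule DERIV_cong[OF DERIV_add[OF DERIV_const DERIV_cmult[OF ds(1)[OF k(2) xy]]]]) auto
    show "((\<lambda>t. u2 (x, t)) has_real_derivative h'' (snd (x, y)) + - m * (- m * v (height (x, y)))) (at y)"
      unfolding u2_def fst_conv snd_conv using dx[OF h(2) interior(2)[OF xy]] ds(2)[OF k(2) xy]
      by (intro DERIV_add DERIV_cmult) auto
  qed
  moreover have "- (LINT p:region|lborel. u p * third_order_op m n \<phi> p) = 0" if \<phi>: "test_function region \<phi>" for \<phi>
  proof -
    note cr = continuous_on_subset[OF _ region_subset]
    have "- (LINT p:region|lborel. u p * third_order_op m n \<phi> p) =
      (LINT p:region|lborel. (m * u1 p + n * u2 p) * partial_x (partial_y \<phi>) p)"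
      by (rule weak_form_first_order[OF region_open \<phi> cr[OF uc] cr[OF u1c] cr[OF u2c] d1 d2])
    also have "\<dots> = (LINT p:region|lborel. (m * f' (fst p) + n * h' (snd p)) * partial_x (partial_y \<phi>) p)"
      by (simp add: u1_def u2_def algebra_simps)
    also have "\<dots> = 0"
    proof (rule separated_weak_mixed_derivative_zero[OF region_open \<phi>, of "\<lambda>x. m * f' x" "\<lambda>x. m * f'' x" "\<lambda>y. n * h' y"])
      show "continuous_on region (\<lambda>(x, y). m * f' x)" "continuous_on region (\<lambda>(x, y). m * f'' x)"
        "continuous_on region (\<lambda>(x, y). n * h' y)"
        unfolding case_prod_beta'
        using cr[OF continuous_on_mult[OF continuous_on_const cx[OF fc(2)]]]
          cr[OF continuous_on_mult[OF continuous_on_const cx[OF fc(3)]]]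
          cr[OF continuous_on_mult[OF continuous_on_const cy[OF hc(2)]]] by blast+
      show "((\<lambda>x. m * f' x) has_real_derivative m * f'' x) (at x)" if "(x, y) \<in> region" for x y
        by (intro DERIV_cmult dx[OF f(2) interior(1)[OF that]])
    qed
    finally show ?thesis .
  qed
  ultimately show ?thesis
    using uc bd
    by (simp add: classical_solution_def generalized_solution_def C2_closure_def closure_region frontier_region)
qed

lemma minimal_imp_solvable:
  assumes minimal and g: "C2_data g"
  shows "\<exists>u. classical_solution g u"
proof -
  obtain G' G'' where G: "\<And>s. s \<in> {- m..n} \<Longrightarrow> (defect g has_real_derivative G' s) (at s within {- m..n})"
    "\<And>s. s \<in> {- m..n} \<Longrightarrow> (G' has_real_derivative G'' s) (at s within {- m..n})" "continuous_on {- m..n} G''"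
    using defect_C2[OF g] unfolding C_diff_on_2 by blast
  \<comment> \<open>Equality of the end values is required for solvability, and their common value
    yields \<open>k 0 = g (0, 0)\<close>.\<close>
  have ends: "defect g (- m) = - g (0, 0)" "defect g n = - g (0, 0)"
    using mn by (simp_all add: defect_def point_def \<delta>_ends)
  obtain k w v where k: "\<And>s. s \<in> {- m..n} \<Longrightarrow> (k has_real_derivative w s) (at s within {- m..n})"
    "\<And>s. s \<in> {- m..n} \<Longrightarrow> (w has_real_derivative v s) (at s within {- m..n})" "continuous_on {- m..n} v"
    "k 0 = g (0, 0)" "\<And>s. s \<in> {- m..n} \<Longrightarrow> k s - k (\<delta> s) - k (s - \<delta> s) = defect g s"
    using functional_equation_solvable[OF \<open>minimal\<close> G] ends by (metis add.inverse_inverse)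
  have "C_diff_on 2 {- m..n} k" unfolding C_diff_on_2 using k by blast
  note kC = C_diff_on_2_compose[OF this C_diff_on_2_affine]
  have "C_diff_on 2 {0..1} (\<lambda>x. k (n * x + 0))"
  proof (rule kC, rule image_subsetI)
    fix x :: real assume "x \<in> {0..1}"
    then have "0 \<le> n * x" "n * x \<le> n * 1" using mn by auto
    moreover from this(1) have "- m \<le> n * x" using mn by linarith
    ultimately show "n * x + 0 \<in> {- m..n}" by simp
  qed
  moreover have "C_diff_on 2 {0..1} (\<lambda>x. k (- m * x + 0))"
  proof (rule kC, rule image_subsetI)
    fix x :: real assume "x \<in> {0..1}"
    then have "0 \<le> m * x" "m * x \<le> m * 1" using mn by auto
    moreover from this(1) have "- (m * x) \<le> n" using mn by linarith
    ultimately show "- m * x + 0 \<in> {- m..n}" by simp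
  qed
  ultimately have fC: "C_diff_on 2 {0..1} (\<lambda>x. g (x, 0) - k (n * x))" and hC: "C_diff_on 2 {0..1} (\<lambda>y. g (0, y) - k (- (m * y)))"
    using g by (auto simp: C2_data_def intro: C_diff_on_2_diff)
  obtain f' f'' where f: "\<And>x. x \<in> {0..1} \<Longrightarrow> ((\<lambda>x. g (x, 0) - k (n * x)) has_real_derivative f' x) (at x within {0..1})"
    "\<And>x. x \<in> {0..1} \<Longrightarrow> (f' has_real_derivative f'' x) (at x within {0..1})" "continuous_on {0..1} f''"
    using fC unfolding C_diff_on_2 by blast
  obtain h' h'' where h: "\<And>x. x \<in> {0..1} \<Longrightarrow> ((\<lambda>y. g (0, y) - k (- (m * y))) has_real_derivative h' x) (at x within {0..1})"
    "\<And>x. x \<in> {0..1} \<Longrightarrow> (h' has_real_derivative h'' x) (at x within {0..1})" "continuous_on {0..1} h''"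
    using hC unfolding C_diff_on_2 by blast
  define u where "u p = (g (fst p, 0) - k (n * fst p)) + (g (0, snd p) - k (- (m * snd p))) + k (height p)" for p
  have "u p = g p" if "p \<in> boundary" for p
  proof -
    from that consider "\<exists>x. p = (x, 0)" | "\<exists>y. p = (0, y)" | s where "s \<in> {- m..n}" "p = point s"
      by (auto simp: axis1 axis2)
    then show ?thesis
    proof cases
      case 3
      have "n * fst (point s) = \<delta> s" "- (m * snd (point s)) = s - \<delta> s"
        using mn by (auto simp: point_def)
      moreover have "defect g s = g (point s) - g (fst (point s), 0) - g (0, snd (point s))"
        by (simp add: defect_def point_def)
      ultimately show ?thesis using k(5)[OF 3(1)] by (simp add: u_def 3(2))
    qed (auto simp: u_def height_def k(4))
  qed
  then show ?thesis
    using plane_waves_classical_solution[OF k(1-3) f h u_def] by blast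
qed

text \<open>A proper closed invariant F leaves room for a smooth G with slope 1 on F: its gain n + m
  over the interval is undone by a step inside a window off F. Boundary data equal to G on the curve
  and 0 on the axes have no solution.\<close>

lemma solvable_imp_minimal:
  assumes solv: "\<And>g. continuous_on boundary g \<Longrightarrow> C2_data g \<Longrightarrow> \<exists>u. classical_solution g u"
  shows minimal
proof (rule ccontr)
  assume "\<not> minimal"
  then obtain F where F: "closed F" "F \<noteq> {}" "invariant F" "F \<noteq> {- m..n}"
    unfolding minimal_def by blast
  have FS: "F \<subseteq> {- m..n}" using F(3) by (simp add: invariant_def)
  \<comment> \<open>A closed F cannot miss end points only, so the window can be placed away from
    both ends of the interval.\<close>
  have "\<not> {- m<..<n} \<subseteq> F"
  proof
    assume "{- m<..<n} \<subseteq> F"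
    from closure_minimal[OF this F(1)] show False using FS F(4) mn by auto
  qed
  then obtain s0 where s0: "- m < s0" "s0 < n" "s0 \<notin> F"
    unfolding subset_iff greaterThanLessThan_iff by blast
  have "open ({- m<..<n} - F)" using F(1) by (intro open_Diff) auto
  then obtain r where r: "r > 0" "ball s0 r \<subseteq> {- m<..<n} - F" using s0 openE[of "{- m<..<n} - F" s0] by auto
  define \<rho> where "\<rho> = r / 2"
  have \<rho>: "\<rho> > 0" "{s0..s0 + \<rho>} \<subseteq> {- m<..<n} - F"
  proof -
    show "\<rho> > 0" using r by (simp add: \<rho>_def)
    have "{s0..s0 + \<rho>} \<subseteq> ball s0 r" using r by (auto simp: \<rho>_def dist_real_def)
    then show "{s0..s0 + \<rho>} \<subseteq> {- m<..<n} - F" using r(2) by blast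
  qed
  \<comment> \<open>The step then descends by exactly n + m, the growth of s + m from one end to the
    other.\<close>
  define C where "C = (n + m) / smooth_step 1"
  have C: "C * smooth_step 1 = n + m" using smooth_step_1_pos by (simp add: C_def)
  define G where "G s = (s + m) - C * smooth_step ((s - s0) / \<rho>)" for s
  define G' where "G' s = 1 - C * (bump ((s - s0) / \<rho>) * (1 / \<rho>))" for s
  have Gd: "(G has_real_derivative G' s) (at s)" for s
  proof -
    have "((\<lambda>s. smooth_step ((s - s0) / \<rho>)) has_real_derivative bump ((s - s0) / \<rho>) * (1 / \<rho>)) (at s)"
      by (rule DERIV_chain2[OF smooth_step_deriv]) (use \<rho>(1) in \<open>auto intro!: derivative_eq_intros\<close>)
    from DERIV_diff[OF DERIV_add[OF DERIV_ident DERIV_const] DERIV_cmult[OF this]] show ?thesis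
      unfolding G_def[abs_def] G'_def by (simp only: add_0_right)
  qed
  have G_ends: "G (- m) = 0" "G n = 0"
  proof -
    have "(- m - s0) / \<rho> \<le> 0" using s0 \<rho> by (simp add: divide_nonpos_pos)
    then show "G (- m) = 0" by (simp add: G_def smooth_step_left)
    have "s0 + \<rho> < n" using \<rho> by (force dest: subsetD[where c="s0 + \<rho>"])
    then have "(n - s0) / \<rho> \<ge> 1" using \<rho>(1) by (simp add: field_simps)
    then show "G n = 0" using smooth_step_right[of "(n - s0) / \<rho>"] C by (simp add: G_def)
  qed
  have G'_F: "G' s = 1" if "s \<in> F" for s
  proof -
    have "s \<notin> {s0..s0 + \<rho>}" using \<rho>(2) that by blast
    then have "s < s0 \<or> s > s0 + \<rho>" by auto
    then have "(s - s0) / \<rho> \<le> 0 \<or> (s - s0) / \<rho> \<ge> 1" using \<rho>(1) by (auto simp: field_simps)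
    then show ?thesis by (simp add: G'_def bump_zero)
  qed
  have GC2: "C_diff_on 2 S G" for S
  proof -
    have sG': "elem_smooth G'"
    proof -
      have "elem_smooth (\<lambda>s. bump (1 / \<rho> * s + - s0 / \<rho>))"
        by (rule elem_smooth.affine[OF bump_smooth])
      then have "elem_smooth (\<lambda>s. bump ((s - s0) / \<rho>))" by (simp add: diff_divide_distrib)
      then have "elem_smooth (\<lambda>s. 1 + (- C / \<rho>) * bump ((s - s0) / \<rho>))"
        by (intro elem_smooth.add elem_smooth.mult elem_smooth.const)
      then show ?thesis by (simp add: G'_def[abs_def] algebra_simps)
    qed
    then obtain G'' where "elem_smooth G''" "\<And>s. (G' has_real_derivative G'' s) (at s)"
      using elem_smooth_deriv by blast
    then show ?thesis
      unfolding C_diff_on_2 using Gd elem_smooth_cont has_field_derivative_at_within by blast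
  qed
  \<comment> \<open>The two branches agree at the end points of the curve because G vanishes
    there.\<close>
  define g where "g p = (if fst p = 0 \<or> snd p = 0 then 0 else G (height p))" for p :: "real \<times> real"
  have g_point: "g (point s) = G s" if s: "s \<in> {- m..n}" for s
  proof -
    consider "s = - m" | "s = n" | "- m < s" "s < n" using s by fastforce
    then show ?thesis
    proof cases
      case 3
      then show ?thesis using strict[of s] mn by (auto simp: g_def point_def height_def)
    qed (auto simp: G_ends g_def point_def \<delta>_ends)
  qed
  have "continuous_on boundary g"
  proof (intro continuous_on_closed_Un closed_Un)
    show "continuous_on (closed_segment (0, 0) (1, 0)) g"
      by (rule continuous_on_eq[OF continuous_on_const[of _ 0]]) (auto simp: g_def axis1)
    show "continuous_on (closed_segment (0, 0) (0, 1)) g"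
      by (rule continuous_on_eq[OF continuous_on_const[of _ 0]]) (auto simp: g_def axis2)
    have Gc: "continuous_on UNIV G" by (rule DERIV_continuous_on[OF Gd])
    have "continuous_on (point ` {- m..n}) (\<lambda>p. G (height p))"
      by (rule continuous_on_compose2[OF Gc height_cont]) simp
    then show "continuous_on (point ` {- m..n}) g"
      by (rule continuous_on_eq) (auto simp: g_point)
    show "closed (point ` {- m..n})"
      by (intro compact_imp_closed compact_continuous_image point_cont compact_Icc)
  qed auto
  moreover have gC2: "C2_data g"
  proof -
    have "C_diff_on 2 {0..1} (\<lambda>_. 0)" using C_diff_on_2_affine[of _ 0 0] by simp
    moreover have "C_diff_on 2 {- m..n} (\<lambda>s. g (point s))"
      by (rule C_diff_on_2_cong[OF GC2]) (simp add: g_point)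
    ultimately show ?thesis by (simp add: C2_data_def g_def)
  qed
  ultimately obtain u where u: "classical_solution g u" using solv by blast
  obtain k w where k: "decomposes u g k" "continuous_on {- m..n} w"
    "\<And>s. s \<in> {- m..n} \<Longrightarrow> (k has_real_derivative w s) (at s within {- m..n})"
    using classical_solution_decomposes[OF u gC2] by metis
  have eq: "k s - k (\<delta> s) - k (s - \<delta> s) = G s" if "s \<in> {- m..n}" for s
    using decomposes_functional_equation[OF k(1) _ that] u g_point[OF that]
    by (simp add: classical_solution_def defect_def) (simp add: g_def)
  show False
  proof (rule unsolvable_positive_rhs[OF F(1-3) k(2)])
    fix s assume "s \<in> F"
    then have s: "s \<in> {- m..n}" using FS by blast
    have "((\<lambda>s. k s - k (\<delta> s) - k (s - \<delta> s)) has_real_derivative G' s) (at s within {- m..n})"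
      by (rule has_field_derivative_transform_within[OF has_field_derivative_at_within[OF Gd] zero_less_one s])
         (simp add: eq)
    from DERIV_within_Icc_unique[OF functional_deriv[OF k(3) s] this]
    show "w s - (d s * w (\<delta> s) + (1 - d s) * w (s - \<delta> s)) > 0"
      using mn s G'_F[OF \<open>s \<in> F\<close>] by simp
  qed
qed

theorem unique_solvability_iff_minimal:
  "(\<forall>g. continuous_on boundary g \<and> C2_data g \<longrightarrow>
      (\<exists>u. classical_solution g u \<and> (\<forall>v. classical_solution g v \<longrightarrow> (\<forall>p\<in>closed_region. v p = u p))))
    \<longleftrightarrow> minimal"
  using minimal_imp_solvable minimal_imp_unique solvable_imp_minimal by meson

end

subsection \<open>The guided dynamical system\<close>

lemma orbit_set_refl: "p \<in> X \<Longrightarrow> p \<in> orbit_set X I \<zeta> \<Omega> p"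
  unfolding orbit_set_def proper_orbit_def by (auto intro!: exI[of _ "[p]"])

lemma orbit_set_subset: "orbit_set X I \<zeta> \<Omega> p \<subseteq> X"
  unfolding orbit_set_def proper_orbit_def using last_in_set by blast

lemma orbit_set_step:
  assumes "q \<in> orbit_set X I \<zeta> \<Omega> p" "i \<in> I" "q \<notin> \<Omega> i" "\<zeta> i q \<in> X"
  shows "\<zeta> i q \<in> orbit_set X I \<zeta> \<Omega> p"
proof -
  obtain ps where ps: "proper_orbit X I \<zeta> \<Omega> ps" "hd ps = p" "last ps = q"
    using assms(1) by (auto simp: orbit_set_def)
  have ne: "ps \<noteq> []" using ps(1) by (simp add: proper_orbit_def)
  have "proper_orbit X I \<zeta> \<Omega> (ps @ [\<zeta> i q])"
    unfolding proper_orbit_def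
  proof (intro conjI allI impI)
    show "set (ps @ [\<zeta> i q]) \<subseteq> X" using ps(1) assms(4) by (simp add: proper_orbit_def)
    fix j assume j: "Suc j < length (ps @ [\<zeta> i q])"
    show "\<exists>i'\<in>I. (ps @ [\<zeta> i q]) ! j \<notin> \<Omega> i' \<and> (ps @ [\<zeta> i q]) ! Suc j = \<zeta> i' ((ps @ [\<zeta> i q]) ! j)"
    proof (cases "Suc j < length ps")
      case True
      then show ?thesis using ps(1) by (simp add: proper_orbit_def nth_append)
    next
      case False
      then have "Suc j = length ps" using j by simp
      moreover from this have "ps ! j = q"
        using ps(3) ne last_conv_nth[OF ne] by (metis diff_Suc_1)
      ultimately show ?thesis using assms(2,3) by (intro bexI[of _ i]) (auto simp: nth_append)
    qed
  qed simp
  then show ?thesis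
    unfolding orbit_set_def using ps(2) ne by (auto intro!: exI[of _ "ps @ [\<zeta> i q]"])
qed

lemma orbit_set_least:
  assumes "p \<in> S" "\<And>q i. q \<in> S \<Longrightarrow> i \<in> I \<Longrightarrow> q \<notin> \<Omega> i \<Longrightarrow> \<zeta> i q \<in> S"
  shows "orbit_set X I \<zeta> \<Omega> p \<subseteq> S"
proof
  fix q assume "q \<in> orbit_set X I \<zeta> \<Omega> p"
  then obtain ps where ps: "proper_orbit X I \<zeta> \<Omega> ps" "hd ps = p" "last ps = q"
    by (auto simp: orbit_set_def)
  have ne: "ps \<noteq> []" using ps(1) by (simp add: proper_orbit_def)
  have "ps ! j \<in> S" if "j < length ps" for j
    using that
  proof (induction j)
    case 0
    then show ?case using ps(2) assms(1) hd_conv_nth[OF ne] by simp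
  next
    case (Suc j)
    then have "\<exists>i\<in>I. ps ! j \<notin> \<Omega> i \<and> ps ! Suc j = \<zeta> i (ps ! j)"
      using ps(1) by (simp add: proper_orbit_def)
    then show ?case using Suc assms(2) by auto
  qed
  then show "q \<in> S" using ps(3) last_conv_nth[OF ne] ne by (metis diff_less length_greater_0_conv less_one)
qed

context curve_domain
begin

abbreviation curve :: "(real \<times> real) set" where
  "curve \<equiv> point ` {- m..n}"

text \<open>Height is constant on characteristic lines and recovers the parameter of a point of the
  curve, which gives uniqueness of the intersection.\<close>

lemma proj_3_curve:
  assumes "height p \<in> {- m..n}"
  shows "proj_3 m n curve p = point (height p)"
  unfolding proj_3_def
proof (rule the_equality)
  have "point (height p) = p + (m * (gap p / (m * n)), n * (gap p / (m * n)))"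
    using point_height[of p] by (simp add: mult.commute)
  then show "point (height p) \<in> curve \<and> (\<exists>t. point (height p) = p + (m * t, n * t))"
    using assms by blast
  fix q assume "q \<in> curve \<and> (\<exists>t. q = p + (m * t, n * t))"
  then obtain s t where s: "q = point s" and "q = p + (m * t, n * t)" by blast
  from this(2) have "q = p + t *\<^sub>R (m, n)" by (simp add: mult.commute)
  with s have "s = height p" using height_point[of s] height_line[of p t] by simp
  then show "q = point (height p)" using s by simp
qed

lemma zeta_point:
  assumes "s \<in> {- m..n}"
  shows "zeta m n curve 1 (point s) = point (\<delta> s)" "zeta m n curve 2 (point s) = point (s - \<delta> s)"
proof -
  have "height (proj_1 (point s)) = \<delta> s" "height (proj_2 (point s)) = s - \<delta> s"
    using mn by (simp_all add: proj_1_def proj_2_def height_def point_def)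
  then show "zeta m n curve 1 (point s) = point (\<delta> s)" "zeta m n curve 2 (point s) = point (s - \<delta> s)"
    using proj_3_curve[of "proj_1 (point s)"] proj_3_curve[of "proj_2 (point s)"] \<delta>_in[OF assms] co\<delta>_in[OF assms]
    by (simp_all add: zeta_def)
qed

lemma point_mem_image: "point s \<in> point ` F \<longleftrightarrow> s \<in> F"
  by (auto dest: arg_cong[where f=height])

lemma closed_curve_image: "closed F \<Longrightarrow> F \<subseteq> {- m..n} \<Longrightarrow> closed (point ` F)"
  by (intro compact_imp_closed compact_continuous_image point_cont)
    (auto simp: compact_eq_bounded_closed intro: bounded_subset[OF bounded_closed_interval])

text \<open>Orbits cannot leave the image of a closed invariant set, which gives one direction. For
  the other, the closure of an orbit is itself invariant because the guiding sets are
  closed.\<close>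

lemma Omega_minimal_iff:
  assumes \<Omega>: "\<And>s. s \<in> {- m..n} \<Longrightarrow> point s \<in> \<Omega> 1 \<longleftrightarrow> d s = 0" "\<And>s. s \<in> {- m..n} \<Longrightarrow> point s \<in> \<Omega> 2 \<longleftrightarrow> d s = 1"
  shows "Omega_minimal curve {1, 2} (zeta m n curve) \<Omega> \<longleftrightarrow> minimal"
proof
  assume om: "Omega_minimal curve {1, 2} (zeta m n curve) \<Omega>"
  show minimal
    unfolding minimal_def
  proof (intro allI impI)
    fix F assume "closed F \<and> F \<noteq> {} \<and> invariant F"
    then obtain s where F: "closed F" "invariant F" "s \<in> F" by blast
    then have sub: "F \<subseteq> {- m..n}" by (simp add: invariant_def)
    have "orbit_set curve {1, 2} (zeta m n curve) \<Omega> (point s) \<subseteq> point ` F"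
    proof (rule orbit_set_least)
      fix q and i :: nat assume q: "q \<in> point ` F" "i \<in> {1, 2}" "q \<notin> \<Omega> i"
      then obtain r where r: "r \<in> F" "q = point r" by blast
      then have "r \<in> {- m..n}" using sub by blast
      then show "zeta m n curve i q \<in> point ` F"
        using q r F(2) \<Omega> zeta_point unfolding invariant_def by auto
    qed (use F in simp)
    then have "closure (orbit_set curve {1, 2} (zeta m n curve) \<Omega> (point s)) \<subseteq> point ` F"
      by (rule closure_minimal[OF _ closed_curve_image[OF F(1) sub]])
    then have "curve \<subseteq> point ` F"
      using om F(3) sub unfolding Omega_minimal_def by blast
    then show "F = {- m..n}" using sub point_mem_image by blast
  qed
next
  assume min: minimal
  show "Omega_minimal curve {1, 2} (zeta m n curve) \<Omega>"
    unfolding Omega_minimal_def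
  proof
    fix p assume p: "p \<in> curve"
    define Orb where "Orb = orbit_set curve {1, 2} (zeta m n curve) \<Omega> p"
    define T where "T = {s \<in> {- m..n}. point s \<in> Orb}"
    have step: "\<delta> s \<in> T" if "s \<in> T" "d s \<noteq> 0" for s
    proof -
      have s: "s \<in> {- m..n}" "point s \<in> Orb" using that by (auto simp: T_def)
      have "zeta m n curve 1 (point s) \<in> Orb"
        unfolding Orb_def by (rule orbit_set_step) (use s that \<Omega>(1) zeta_point \<delta>_in in \<open>auto simp: Orb_def\<close>)
      then show ?thesis using zeta_point(1)[OF s(1)] \<delta>_in[OF s(1)] by (simp add: T_def)
    qed
    have costep: "s - \<delta> s \<in> T" if "s \<in> T" "d s \<noteq> 1" for s
    proof -
      have s: "s \<in> {- m..n}" "point s \<in> Orb" using that by (auto simp: T_def)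
      have "zeta m n curve 2 (point s) \<in> Orb"
        unfolding Orb_def by (rule orbit_set_step) (use s that \<Omega>(2) zeta_point(2)[OF s(1)] co\<delta>_in[OF s(1)] in \<open>auto simp: Orb_def\<close>)
      then show ?thesis using zeta_point(2)[OF s(1)] co\<delta>_in[OF s(1)] by (simp add: T_def)
    qed
    have TS: "closure T \<subseteq> {- m..n}" by (rule closure_minimal) (auto simp: T_def)
    \<comment> \<open>A guard d s ~= c is an open condition, so it also holds along a sequence of
      orbit parameters tending to s, where the move is allowed.\<close>
    have limit: "f s \<in> closure T"
      if s: "s \<in> closure T" and c: "d s \<noteq> c" and f: "continuous_on {- m..n} f"
        and fT: "\<And>s. s \<in> T \<Longrightarrow> d s \<noteq> c \<Longrightarrow> f s \<in> T" for f s c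
    proof -
      obtain x where x: "\<And>j. x j \<in> T" "x \<longlonglongrightarrow> s" using s unfolding closure_sequential by blast
      have xS: "\<forall>\<^sub>F j in sequentially. x j \<in> {- m..n}" using x(1) by (simp add: T_def)
      have sS: "s \<in> {- m..n}" using s TS by blast
      have "(\<lambda>j. d (x j)) \<longlonglongrightarrow> d s" by (rule continuous_on_tendsto_compose[OF d_cont x(2) sS xS])
      then have "\<forall>\<^sub>F j in sequentially. d (x j) \<noteq> c" using c tendsto_imp_eventually_ne by blast
      then have "\<forall>\<^sub>F j in sequentially. f (x j) \<in> closure T"
        by eventually_elim (use fT x(1) closure_subset in blast)
      moreover have "(\<lambda>j. f (x j)) \<longlonglongrightarrow> f s" by (rule continuous_on_tendsto_compose[OF f x(2) sS xS])
      ultimately show ?thesis by (intro Lim_in_closed_set[OF closed_closure]) auto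
    qed
    have "invariant (closure T)"
      unfolding invariant_def
      using TS limit[OF _ _ \<delta>_cont step] limit[OF _ _ co\<delta>_cont costep] by blast
    moreover have "closure T \<noteq> {}"
      using p orbit_set_refl[OF p] by (auto simp: T_def Orb_def)
    ultimately have T: "closure T = {- m..n}" using min unfolding minimal_def by blast
    have "curve \<subseteq> closure Orb"
      unfolding T[symmetric]
      by (rule image_closure_subset[OF point_cont closed_closure]) (use closure_subset[of Orb] in \<open>auto simp: T_def\<close>)
    moreover have "closure Orb \<subseteq> curve"
      unfolding Orb_def by (rule closure_minimal[OF orbit_set_subset closed_curve_image]) auto
    ultimately show "closure (orbit_set curve {1, 2} (zeta m n curve) \<Omega> p) = curve"
      unfolding Orb_def by blast
  qed
qed

end

subsection \<open>From the parametrization to the characteristic coordinate\<close>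

lemma DERIV_inverse_within:
  fixes \<sigma> \<tau> :: "real \<Rightarrow> real"
  assumes \<sigma>: "(\<sigma> has_real_derivative D) (at (\<tau> x) within T)" "D \<noteq> 0"
    and \<tau>: "continuous_on S \<tau>" "\<And>y. y \<in> S \<Longrightarrow> \<tau> y \<in> T" "\<And>y. y \<in> S \<Longrightarrow> \<sigma> (\<tau> y) = y" and x: "x \<in> S"
  shows "(\<tau> has_real_derivative 1 / D) (at x within S)"
proof -
  have ev: "\<forall>\<^sub>F y in at x within S. y \<in> S \<and> y \<noteq> x" by (simp add: eventually_at_filter)
  have ne: "\<tau> y \<noteq> \<tau> x" if "y \<in> S" "y \<noteq> x" for y using \<tau>(3) that x by metis
  have "filterlim \<tau> (at (\<tau> x) within T) (at x within S)"
    unfolding filterlim_at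
  proof
    show "(\<tau> \<longlongrightarrow> \<tau> x) (at x within S)" using \<tau>(1) x by (simp add: continuous_on_def)
    show "\<forall>\<^sub>F y in at x within S. \<tau> y \<in> T \<and> \<tau> y \<noteq> \<tau> x"
      using ev by eventually_elim (use \<tau>(2) ne in blast)
  qed
  from tendsto_inverse[OF filterlim_compose[OF \<sigma>(1)[unfolded has_field_derivative_iff] this] \<sigma>(2)]
  have "((\<lambda>y. inverse ((\<sigma> (\<tau> y) - \<sigma> (\<tau> x)) / (\<tau> y - \<tau> x))) \<longlongrightarrow> inverse D) (at x within S)" .
  then have "((\<lambda>y. (\<tau> y - \<tau> x) / (y - x)) \<longlongrightarrow> inverse D) (at x within S)"
    by (rule Lim_transform_eventually, use ev in eventually_elim) (use \<tau>(3) x in auto)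
  then show ?thesis by (simp add: has_field_derivative_iff inverse_eq_divide)
qed

lemma C_diff_on_2_inverse:
  fixes \<sigma> \<tau> :: "real \<Rightarrow> real"
  assumes \<sigma>: "\<And>x. x \<in> T \<Longrightarrow> (\<sigma> has_real_derivative \<sigma>' x) (at x within T)"
    "\<And>x. x \<in> T \<Longrightarrow> (\<sigma>' has_real_derivative \<sigma>'' x) (at x within T)"
    "continuous_on T \<sigma>''" "\<And>x. x \<in> T \<Longrightarrow> \<sigma>' x \<noteq> 0"
    and \<tau>: "continuous_on S \<tau>" "\<And>y. y \<in> S \<Longrightarrow> \<tau> y \<in> T" "\<And>y. y \<in> S \<Longrightarrow> \<sigma> (\<tau> y) = y"
  shows "C_diff_on 2 S \<tau>"
proof -
  have 1: "(\<tau> has_real_derivative 1 / \<sigma>' (\<tau> y)) (at y within S)" if "y \<in> S" for y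
    by (rule DERIV_inverse_within[OF \<sigma>(1) \<sigma>(4) \<tau> that]) (use that \<tau>(2) in auto)
  have im: "\<tau> ` S \<subseteq> T" using \<tau>(2) by auto
  have 2: "((\<lambda>y. 1 / \<sigma>' (\<tau> y)) has_real_derivative
      (0 * \<sigma>' (\<tau> y) - 1 * (\<sigma>'' (\<tau> y) * (1 / \<sigma>' (\<tau> y)))) / (\<sigma>' (\<tau> y) * \<sigma>' (\<tau> y))) (at y within S)" if "y \<in> S" for y
    by (rule DERIV_divide[OF DERIV_const DERIV_compose_within[OF 1[OF that] \<sigma>(2)[OF \<tau>(2)[OF that]] im]])
       (use \<sigma>(4) \<tau>(2) that in blast)
  have "continuous_on T \<sigma>'" by (rule DERIV_continuous_on[OF \<sigma>(2)])
  then have c: "continuous_on S (\<lambda>y. \<sigma>' (\<tau> y))" "continuous_on S (\<lambda>y. \<sigma>'' (\<tau> y))"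
    using continuous_on_compose2[OF _ \<tau>(1) im] \<sigma>(3) by blast+
  have "continuous_on S (\<lambda>y. (0 * \<sigma>' (\<tau> y) - 1 * (\<sigma>'' (\<tau> y) * (1 / \<sigma>' (\<tau> y)))) / (\<sigma>' (\<tau> y) * \<sigma>' (\<tau> y)))"
    by (intro continuous_on_divide continuous_on_diff continuous_on_mult continuous_on_const c)
       (use \<sigma>(4) \<tau>(2) in auto)
  then show ?thesis
    unfolding C_diff_on_2
    by (intro exI[of _ "\<lambda>y. 1 / \<sigma>' (\<tau> y)"]
        exI[of _ "\<lambda>y. (0 * \<sigma>' (\<tau> y) - 1 * (\<sigma>'' (\<tau> y) * (1 / \<sigma>' (\<tau> y)))) / (\<sigma>' (\<tau> y) * \<sigma>' (\<tau> y))"] conjI ballI 1 2)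
qed

lemma span_singleton_unit_iff:
  fixes a b :: real
  assumes "(a, b) \<noteq> (0, 0)"
  shows "(0, 1) \<in> span {(a, b)} \<longleftrightarrow> a = 0" "(1, 0) \<in> span {(a, b)} \<longleftrightarrow> b = 0"
proof -
  show "(0, 1) \<in> span {(a, b)} \<longleftrightarrow> a = 0"
  proof
    assume "a = 0"
    then have "(0, 1) = (1 / b) *\<^sub>R (a, b)" using assms by simp
    then show "(0, 1) \<in> span {(a, b)}" unfolding span_singleton by (rule range_eqI)
  qed (auto simp: span_singleton)
  show "(1, 0) \<in> span {(a, b)} \<longleftrightarrow> b = 0"
  proof
    assume "b = 0"
    then have "(1, 0) = (1 / a) *\<^sub>R (a, b)" using assms by simp
    then show "(1, 0) \<in> span {(a, b)}" unfolding span_singleton by (rule range_eqI)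
  qed (auto simp: span_singleton)
qed

theorem theorem4p1p2:
  fixes m n :: real and \<alpha>\<^sub>1 \<alpha>\<^sub>2 :: "real \<Rightarrow> real"
    and \<Gamma> D :: "(real \<times> real) set"
  assumes "m > 0" and "n > 0"
    and "admissible_curve \<alpha>\<^sub>1 \<alpha>\<^sub>2"
    and "\<Gamma> = Curve \<alpha>\<^sub>1 \<alpha>\<^sub>2"
    and "D = Domain_D \<alpha>\<^sub>1 \<alpha>\<^sub>2"
  shows "(\<forall>g. C2_boundary \<alpha>\<^sub>1 \<alpha>\<^sub>2 g \<longrightarrow>
            (\<exists>u. generalized_solution m n D g u \<and> C2_closure D u \<and>
              (\<forall>v. generalized_solution m n D g v \<and> C2_closure D v \<longrightarrow>
                (\<forall>p\<in>closure D. v p = u p))))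
         \<longleftrightarrow> Omega_minimal \<Gamma> {1, 2} (zeta m n \<Gamma>) (guiding_set \<alpha>\<^sub>1 \<alpha>\<^sub>2)"
proof -
  have \<alpha>C2: "C_diff_on 2 {-1..1} \<alpha>\<^sub>1" "C_diff_on 2 {-1..1} \<alpha>\<^sub>2"
    and reg: "\<forall>z\<in>{-1..1}. param_deriv \<alpha>\<^sub>1 z \<ge> 0 \<and> param_deriv \<alpha>\<^sub>2 z \<le> 0 \<and>
      (param_deriv \<alpha>\<^sub>1 z, param_deriv \<alpha>\<^sub>2 z) \<noteq> (0, 0)"
    and end_points: "(\<alpha>\<^sub>1 (- 1), \<alpha>\<^sub>2 (- 1)) = (0, 1)" "(\<alpha>\<^sub>1 1, \<alpha>\<^sub>2 1) = (1, 0)"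
    and axes: "Curve \<alpha>\<^sub>1 \<alpha>\<^sub>2 \<inter> {(x, y). x = 0 \<or> y = 0} = {(1, 0), (0, 1)}"
    using assms(3) unfolding admissible_curve_def by - (elim conjE, assumption)+
  obtain a1 a1' where a1: "\<And>z. z \<in> {-1..1} \<Longrightarrow> (\<alpha>\<^sub>1 has_real_derivative a1 z) (at z within {-1..1})"
    "\<And>z. z \<in> {-1..1} \<Longrightarrow> (a1 has_real_derivative a1' z) (at z within {-1..1})" "continuous_on {-1..1} a1'"
    using \<alpha>C2(1) unfolding C_diff_on_2 by blast
  obtain a2 a2' where a2: "\<And>z. z \<in> {-1..1} \<Longrightarrow> (\<alpha>\<^sub>2 has_real_derivative a2 z) (at z within {-1..1})"
    "\<And>z. z \<in> {-1..1} \<Longrightarrow> (a2 has_real_derivative a2' z) (at z within {-1..1})" "continuous_on {-1..1} a2'"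
    using \<alpha>C2(2) unfolding C_diff_on_2 by blast
  have pd: "param_deriv \<alpha>\<^sub>1 z = a1 z" "param_deriv \<alpha>\<^sub>2 z = a2 z" if "z \<in> {-1..1}" for z
    using vector_derivative_within_cbox[where a="-1" and b=1 and x=z and f=\<alpha>\<^sub>1 and f'="a1 z"]
      vector_derivative_within_cbox[where a="-1" and b=1 and x=z and f=\<alpha>\<^sub>2 and f'="a2 z"]
      a1(1)[OF that] a2(1)[OF that] that
    by (simp_all add: has_real_derivative_iff_has_vector_derivative)
  have sgn: "a1 z \<ge> 0" "a2 z \<le> 0" "(a1 z, a2 z) \<noteq> (0, 0)" if "z \<in> {-1..1}" for z
    using bspec[OF reg that] unfolding pd[OF that] by blast+
  have ends: "\<alpha>\<^sub>1 (- 1) = 0" "\<alpha>\<^sub>2 (- 1) = 1" "\<alpha>\<^sub>1 1 = 1" "\<alpha>\<^sub>2 1 = 0" using end_points by simp_all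
  \<comment> \<open>The characteristic coordinate along the parametrization. The sign conditions and
    the nonvanishing velocity make its derivative positive, hence \<tau> below is again C^2.\<close>
  define \<sigma> where "\<sigma> z = n * \<alpha>\<^sub>1 z - m * \<alpha>\<^sub>2 z" for z
  define \<sigma>' where "\<sigma>' z = n * a1 z - m * a2 z" for z
  have \<sigma>d: "(\<sigma> has_real_derivative \<sigma>' z) (at z within {-1..1})" if "z \<in> {-1..1}" for z
    unfolding \<sigma>_def[abs_def] \<sigma>'_def by (intro DERIV_diff DERIV_cmult a1 a2 that)
  have \<sigma>'d: "(\<sigma>' has_real_derivative n * a1' z - m * a2' z) (at z within {-1..1})" if "z \<in> {-1..1}" for z
    unfolding \<sigma>'_def[abs_def] by (intro DERIV_diff DERIV_cmult a1 a2 that)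
  have \<sigma>''c: "continuous_on {-1..1} (\<lambda>z. n * a1' z - m * a2' z)"
    by (intro continuous_intros a1 a2)
  have \<sigma>'pos: "\<sigma>' z > 0" if "z \<in> {-1..1}" for z
  proof -
    have "n * a1 z \<ge> 0" "m * a2 z \<le> 0" using sgn[OF that] assms(1,2) by (auto simp: mult_nonneg_nonpos)
    moreover have "n * a1 z \<noteq> 0 \<or> m * a2 z \<noteq> 0" using sgn(3)[OF that] assms(1,2) by auto
    ultimately show ?thesis unfolding \<sigma>'_def by linarith
  qed
  have \<sigma>_mono: "\<sigma> x < \<sigma> y" if xy: "-1 \<le> x" "x < y" "y \<le> 1" for x y
  proof -
    obtain z where "z \<in> {x<..<y}" "\<sigma> y - \<sigma> x = \<sigma>' z * (y - x)"
      using mvt_within_interval[OF \<sigma>d xy] by auto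
    moreover from this(1) have "\<sigma>' z * (y - x) > 0" using \<sigma>'pos[of z] that by simp
    ultimately show ?thesis by linarith
  qed
  have \<sigma>_ends: "\<sigma> (- 1) = - m" "\<sigma> 1 = n" by (simp_all add: \<sigma>_def ends)
  have \<sigma>c: "continuous_on {-1..1} \<sigma>" by (rule DERIV_continuous_on[OF \<sigma>d])
  have \<sigma>_inj: "inj_on \<sigma> {-1..1}"
    by (rule inj_onI) (metis \<sigma>_mono atLeastAtMost_iff less_irrefl linorder_neqE_linordered_idom)
  have \<sigma>_img: "\<sigma> ` {-1..1} = {- m..n}"
  proof
    show "\<sigma> ` {-1..1} \<subseteq> {- m..n}"
    proof (rule image_subsetI)
      fix z :: real assume z: "z \<in> {-1..1}"
      have "\<sigma> (- 1) \<le> \<sigma> z" using \<sigma>_mono[of "-1" z] z by (cases "z = - 1") auto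
      moreover have "\<sigma> z \<le> \<sigma> 1" using \<sigma>_mono[of z 1] z by (cases "z = 1") auto
      ultimately show "\<sigma> z \<in> {- m..n}" by (simp add: \<sigma>_ends)
    qed
    show "{- m..n} \<subseteq> \<sigma> ` {-1..1}"
      using IVT'[of \<sigma> "-1" _ 1] \<sigma>c by (fastforce simp: \<sigma>_ends)
  qed
  define \<tau> where "\<tau> = inv_into {-1..1} \<sigma>"
  have \<tau>: "\<tau> s \<in> {-1..1}" "\<sigma> (\<tau> s) = s" if "s \<in> {- m..n}" for s
    using that inv_into_into[of s \<sigma> "{-1..1}"] f_inv_into_f[of s \<sigma> "{-1..1}"] unfolding \<tau>_def \<sigma>_img by auto
  have \<tau>\<sigma>: "\<tau> (\<sigma> z) = z" if "z \<in> {-1..1}" for z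
    unfolding \<tau>_def by (rule inv_into_f_f[OF \<sigma>_inj that])
  have \<tau>c: "continuous_on {- m..n} \<tau>"
    using continuous_on_inv[OF \<sigma>c compact_Icc] \<tau>\<sigma> unfolding \<sigma>_img by blast
  have \<tau>C2: "C_diff_on 2 {- m..n} \<tau>"
    by (rule C_diff_on_2_inverse[OF \<sigma>d \<sigma>'d \<sigma>''c less_imp_neq[OF \<sigma>'pos, symmetric] \<tau>c \<tau>])
  have \<tau>d: "(\<tau> has_real_derivative 1 / \<sigma>' (\<tau> s)) (at s within {- m..n})" if "s \<in> {- m..n}" for s
    by (rule DERIV_inverse_within[OF \<sigma>d _ \<tau>c \<tau> that]) (use \<tau>(1)[OF that] \<sigma>'pos[of "\<tau> s"] in auto)
  have \<tau>im: "\<tau> ` {- m..n} \<subseteq> {-1..1}" using \<tau>(1) by blast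
  \<comment> \<open>Clamping s to [-m, n] builds in the constant extension demanded by
    \<open>curve_domain\<close>.\<close>
  define \<delta> where "\<delta> s = n * \<alpha>\<^sub>1 (\<tau> (max (- m) (min n s)))" for s
  have \<delta>: "\<delta> s = n * \<alpha>\<^sub>1 (\<tau> s)" if "s \<in> {- m..n}" for s using that by (simp add: \<delta>_def)
  have "C_diff_on 2 {- m..n} (\<lambda>s. n * \<alpha>\<^sub>1 (\<tau> s) + 0)"
    by (rule C_diff_on_2_compose[OF C_diff_on_2_affine[of UNIV] C_diff_on_2_compose[OF \<alpha>C2(1) \<tau>C2 \<tau>im]]) simp
  then have "C_diff_on 2 {- m..n} \<delta>" by (rule C_diff_on_2_cong) (simp add: \<delta>)
  then obtain d e where d: "\<And>s. s \<in> {- m..n} \<Longrightarrow> (\<delta> has_real_derivative d s) (at s within {- m..n})"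
    "\<And>s. s \<in> {- m..n} \<Longrightarrow> (d has_real_derivative e s) (at s within {- m..n})" "continuous_on {- m..n} e"
    unfolding C_diff_on_2 by blast
  have mn: "- m < n" using assms(1,2) by simp
  have d_eq: "d s = n * a1 (\<tau> s) / \<sigma>' (\<tau> s)" if s: "s \<in> {- m..n}" for s
  proof -
    have "((\<lambda>s. n * \<alpha>\<^sub>1 (\<tau> s)) has_real_derivative n * (a1 (\<tau> s) * (1 / \<sigma>' (\<tau> s)))) (at s within {- m..n})"
      by (intro DERIV_cmult DERIV_compose_within[OF \<tau>d[OF s] a1(1)[OF \<tau>(1)[OF s]] \<tau>im])
    then have "(\<delta> has_real_derivative n * (a1 (\<tau> s) * (1 / \<sigma>' (\<tau> s)))) (at s within {- m..n})"
      by (rule has_field_derivative_transform_within[OF _ zero_less_one s]) (simp add: \<delta>)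
    from DERIV_within_Icc_unique[OF d(1)[OF s] this mn s] show ?thesis by simp
  qed
  \<comment> \<open>With a1 and a2 taken at \<tau> s, d = n a1 / (n a1 - m a2), where n a1 and - m
    a2 are nonnegative. So d is 0 exactly at vertical and 1 exactly at horizontal tangents.\<close>
  have d_iff: "0 \<le> d s \<and> d s \<le> 1 \<and> (d s = 0 \<longleftrightarrow> a1 (\<tau> s) = 0) \<and> (d s = 1 \<longleftrightarrow> a2 (\<tau> s) = 0)"
    if s: "s \<in> {- m..n}" for s
  proof -
    have "0 < \<sigma>' (\<tau> s)" "0 \<le> n * a1 (\<tau> s)" "m * a2 (\<tau> s) \<le> 0"
      using \<sigma>'pos[OF \<tau>(1)[OF s]] sgn[OF \<tau>(1)[OF s]] assms(1,2) by (auto simp: mult_nonneg_nonpos)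
    then show ?thesis
      using assms(1,2) unfolding d_eq[OF s] by (auto simp: \<sigma>'_def field_simps)
  qed
  have \<tau>_ends: "\<tau> (- m) = - 1" "\<tau> n = 1" using \<tau>\<sigma>[of "-1"] \<tau>\<sigma>[of 1] by (simp_all add: \<sigma>_ends)
  have \<alpha>1_mono: "\<alpha>\<^sub>1 x \<le> \<alpha>\<^sub>1 y" and \<alpha>2_mono: "\<alpha>\<^sub>2 y \<le> \<alpha>\<^sub>2 x" if xy: "-1 \<le> x" "x < y" "y \<le> 1" for x y
  proof -
    obtain z where "z \<in> {x<..<y}" "\<alpha>\<^sub>1 y - \<alpha>\<^sub>1 x = a1 z * (y - x)"
      using mvt_within_interval[OF a1(1) xy] by auto
    moreover from this(1) have "a1 z * (y - x) \<ge> 0" using sgn(1)[of z] that by simp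
    ultimately show "\<alpha>\<^sub>1 x \<le> \<alpha>\<^sub>1 y" by linarith
    obtain z where "z \<in> {x<..<y}" "\<alpha>\<^sub>2 y - \<alpha>\<^sub>2 x = a2 z * (y - x)"
      using mvt_within_interval[OF a2(1) xy] by auto
    moreover from this(1) have "a2 z * (y - x) \<le> 0" using sgn(2)[of z] that by (simp add: mult_nonpos_nonneg)
    ultimately show "\<alpha>\<^sub>2 y \<le> \<alpha>\<^sub>2 x" by linarith
  qed
  have off_axes: "\<alpha>\<^sub>1 z > 0 \<and> \<alpha>\<^sub>2 z > 0" if z: "-1 < z" "z < 1" for z
  proof -
    have "\<alpha>\<^sub>1 z \<ge> 0" "\<alpha>\<^sub>2 z \<ge> 0" using \<alpha>1_mono[of "-1" z] \<alpha>2_mono[of z 1] z ends by auto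
    moreover have "\<alpha>\<^sub>1 z \<noteq> 0 \<and> \<alpha>\<^sub>2 z \<noteq> 0"
    proof (rule ccontr)
      assume "\<not> ?thesis"
      then have "(\<alpha>\<^sub>1 z, \<alpha>\<^sub>2 z) \<in> Curve \<alpha>\<^sub>1 \<alpha>\<^sub>2 \<inter> {(x, y). x = 0 \<or> y = 0}"
        using z by (auto simp: Curve_def)
      then have "(\<alpha>\<^sub>1 z, \<alpha>\<^sub>2 z) \<in> {(1, 0), (0, 1)}" unfolding axes .
      \<comment> \<open>Returning to an end point would repeat a value of \<sigma>, which is
        strictly increasing.\<close>
      then have "\<sigma> z = \<sigma> 1 \<or> \<sigma> z = \<sigma> (- 1)" by (auto simp: \<sigma>_def ends)
      then show False using \<sigma>_mono[of z 1] \<sigma>_mono[of "-1" z] z by auto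
    qed
    ultimately show ?thesis by simp
  qed
  interpret curve_domain m n \<delta> d e
  proof
    show "- m < 0" "0 < n" using assms(1,2) by auto
    show "\<delta> (- m) = 0" "\<delta> n = n" using mn \<tau>_ends ends by (auto simp: \<delta>)
    show "continuous_on {- m..n} e" by (rule d(3))
    fix s
    show "(\<delta> has_real_derivative d s) (at s within {- m..n})" if "s \<in> {- m..n}" using d(1)[OF that] .
    show "(d has_real_derivative e s) (at s within {- m..n})" if "s \<in> {- m..n}" using d(2)[OF that] .
    show "0 \<le> d s \<and> d s \<le> 1" if "s \<in> {- m..n}" using d_iff[OF that] by blast
    show "\<delta> s = 0" if "s \<le> - m" using that assms(1,2) \<tau>_ends ends by (simp add: \<delta>_def)
    show "\<delta> s = n" if "s \<ge> n" using that assms(1,2) \<tau>_ends ends by (simp add: \<delta>_def)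
    show "0 < \<delta> s \<and> s < \<delta> s" if "- m < s" "s < n"
    proof -
      have s: "s \<in> {- m..n}" using that by simp
      have "\<tau> s \<noteq> - 1" "\<tau> s \<noteq> 1" using \<tau>(2)[OF s] that \<sigma>_ends by auto
      then have "\<alpha>\<^sub>1 (\<tau> s) > 0" "\<alpha>\<^sub>2 (\<tau> s) > 0" using off_axes[of "\<tau> s"] \<tau>(1)[OF s] by auto
      then have "n * \<alpha>\<^sub>1 (\<tau> s) > 0" "m * \<alpha>\<^sub>2 (\<tau> s) > 0" using assms(1,2) by auto
      moreover have "s = n * \<alpha>\<^sub>1 (\<tau> s) - m * \<alpha>\<^sub>2 (\<tau> s)" using \<tau>(2)[OF s] by (simp add: \<sigma>_def)
      ultimately show ?thesis unfolding \<delta>[OF s] by linarith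
    qed
  qed
  have point_eq: "point s = (\<alpha>\<^sub>1 (\<tau> s), \<alpha>\<^sub>2 (\<tau> s))" if s: "s \<in> {- m..n}" for s
  proof -
    have "\<delta> s - s = m * \<alpha>\<^sub>2 (\<tau> s)" using \<tau>(2)[OF s] by (simp add: \<delta>[OF s] \<sigma>_def)
    then show ?thesis using assms(1,2) unfolding point_def by (simp add: \<delta>[OF s])
  qed
  have \<sigma>_in: "\<sigma> z \<in> {- m..n}" if "z \<in> {-1..1}" for z using \<sigma>_img that by blast
  have point_\<sigma>: "point (\<sigma> z) = (\<alpha>\<^sub>1 z, \<alpha>\<^sub>2 z)" if "z \<in> {-1..1}" for z
    using point_eq[OF \<sigma>_in[OF that]] \<tau>\<sigma>[OF that] by simp
  have \<Gamma>: "\<Gamma> = curve"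
    unfolding assms(4) Curve_def \<sigma>_img[symmetric] image_image by (rule image_cong) (simp_all add: point_\<sigma>)
  have D: "D = region"
    unfolding assms(5) Domain_D_def using inside_boundary \<Gamma> assms(4) by simp
  \<comment> \<open>Both \<sigma> and its inverse \<tau> are C^2, so C^2 regularity along the curve
    can be tested in either parameter.\<close>
  have bd: "C2_boundary \<alpha>\<^sub>1 \<alpha>\<^sub>2 g \<longleftrightarrow> continuous_on boundary g \<and> C2_data g" for g
  proof -
    have "C_diff_on 2 {-1..1} (\<lambda>z. g (\<alpha>\<^sub>1 z, \<alpha>\<^sub>2 z)) \<longleftrightarrow> C_diff_on 2 {- m..n} (\<lambda>s. g (point s))"
    proof
      assume "C_diff_on 2 {-1..1} (\<lambda>z. g (\<alpha>\<^sub>1 z, \<alpha>\<^sub>2 z))"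
      from C_diff_on_2_compose[OF this \<tau>C2 \<tau>im] show "C_diff_on 2 {- m..n} (\<lambda>s. g (point s))"
        by (rule C_diff_on_2_cong) (simp only: point_eq)
    next
      assume *: "C_diff_on 2 {- m..n} (\<lambda>s. g (point s))"
      have "C_diff_on 2 {-1..1} \<sigma>"
        unfolding C_diff_on_2
        by (intro exI[of _ \<sigma>'] exI[of _ "\<lambda>z. n * a1' z - m * a2' z"] conjI ballI \<sigma>d \<sigma>'d \<sigma>''c)
      from C_diff_on_2_compose[OF * this equalityD1[OF \<sigma>_img]]
      show "C_diff_on 2 {-1..1} (\<lambda>z. g (\<alpha>\<^sub>1 z, \<alpha>\<^sub>2 z))"
        by (rule C_diff_on_2_cong) (simp only: point_\<sigma>)
    qed
    then show ?thesis
      unfolding C2_boundary_def C2_data_def D[unfolded assms(5)] frontier_region by blast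
  qed
  have tangent: "tangent_space \<alpha>\<^sub>1 \<alpha>\<^sub>2 (point s) = span {(a1 (\<tau> s), a2 (\<tau> s))}" if s: "s \<in> {- m..n}" for s
  proof -
    \<comment> \<open>The parametrization is injective, so a single velocity vector spans the
      tangent space.\<close>
    have "z = \<tau> s" if "z \<in> {-1..1}" "(\<alpha>\<^sub>1 z, \<alpha>\<^sub>2 z) = point s" for z
      using that point_\<sigma>[OF that(1)] \<tau>\<sigma>[OF that(1)] height_point by metis
    then have "{(param_deriv \<alpha>\<^sub>1 z, param_deriv \<alpha>\<^sub>2 z) | z. z \<in> {-1..1} \<and> (\<alpha>\<^sub>1 z, \<alpha>\<^sub>2 z) = point s}
        = {(a1 (\<tau> s), a2 (\<tau> s))}"
      using pd[OF \<tau>(1)[OF s]] \<tau>(1)[OF s] point_eq[OF s] by force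
    then show ?thesis unfolding tangent_space_def by simp
  qed
  have guide: "point s \<in> guiding_set \<alpha>\<^sub>1 \<alpha>\<^sub>2 1 \<longleftrightarrow> d s = 0" "point s \<in> guiding_set \<alpha>\<^sub>1 \<alpha>\<^sub>2 2 \<longleftrightarrow> d s = 1"
    if s: "s \<in> {- m..n}" for s
  proof -
    have "point s \<in> Curve \<alpha>\<^sub>1 \<alpha>\<^sub>2" using s \<Gamma> assms(4) by auto
    then show "point s \<in> guiding_set \<alpha>\<^sub>1 \<alpha>\<^sub>2 1 \<longleftrightarrow> d s = 0" "point s \<in> guiding_set \<alpha>\<^sub>1 \<alpha>\<^sub>2 2 \<longleftrightarrow> d s = 1"
      using d_iff[OF s] span_singleton_unit_iff[OF sgn(3)[OF \<tau>(1)[OF s]]]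
      by (simp_all add: guiding_set_def tangent[OF s])
  qed
  have "Omega_minimal \<Gamma> {1, 2} (zeta m n \<Gamma>) (guiding_set \<alpha>\<^sub>1 \<alpha>\<^sub>2) \<longleftrightarrow> minimal"
    unfolding \<Gamma> by (rule Omega_minimal_iff[OF guide])
  then show ?thesis
    using unique_solvability_iff_minimal
    unfolding D bd closure_region classical_solution_def by simp
qed

end
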